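(* Consider the general stochastic block model with $r\ge1$ clusters of sizes $K_k=\rho_k n$ ($k\in[r]$) and $n-\sum_kK_k$ outlier vertices, with $a>b>0$ and $\rho_1\ge\dots\ge\rho_r>0$ fixed. Suppose there exist $\psi_1>0,\psi_2>0$ with $b+\psi_1+\psi_2<a$ such that $$I(a,b+\psi_1+\psi_2)>1/\rho_r,\quad I(b,b+\psi_1)>1/\rho_r,\quad I(b,b+\psi_2)>1/\rho_{r-1},\quad I(b,b+\psi_1+\psi_2)>1/\rho_r,$$ where the second and third conditions are dropped if $r=1$, and the fourth condition is dropped unless $r=1$ and there are outlier vertices. Let $\eta^*=C\sqrt{\log n}$ for a sufficiently large constant $C$ and $\lambda^*=(b+\psi_1+\psi_2)\frac{\log n}{n}$. Let $\widehat Z_{\mathrm{SDP}}$ be produced by either (i) $\max_Z\langle A,Z\rangle$ s.t. $Z\succeq0$, $Z_{ii}\le1$, $Z_{ij}\ge0$, $\langle\mathbf I,Z\rangle=K_1+\dots+K_r$, $\langle\mathbf J,Z\rangle=K_1^2+\dots+K_r^2$; or (ii) $\max_Z\langle A,Z\rangle-\eta^*\langle\mathbf I,Z\rangle-\lambda^*\langle\mathbf J,Z\rangle$ s.t. $Z\succeq0$, $Z_{ii}\le1$, $Z_{ij}\ge0$. Then $\min_{Z^*\in\mathcal Z_n}\mathbb P\{\widehat Z_{\mathrm{SDP}}=Z^*\}\ge1-n^{-\Omega(1)}$ (where $\widehat Z_{\mathrm{SDP}}=Z^*$ means $Z^*$ is the unique optimal solution).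
   Context: General SBM: out of $n$ vertices, disjoint clusters $C_1,\dots,C_r$ of sizes $K_1,\dots,K_r$ are planted and the remaining vertices are outliers (belonging to no cluster). Two vertices in the same cluster are connected with probability $p=a\log n/n$; every other pair is connected with probability $q=b\log n/n$, all independently. $A$ is the adjacency matrix. $\xi^*_k$ is the indicator vector of $C_k$, $Z^*=\sum_{k=1}^r\xi^*_k(\xi^*_k)^\top$, and $\mathcal Z_n$ is the set of all such cluster matrices (for the given sizes). $\mathbf I$ is the identity and $\mathbf J$ the all-ones matrix. For $\mu,d>0$, $I(\mu,d)=\mu-d\log\frac{e\mu}{d}$. *)

theory Defs
  imports "HOL-Probability.Probability"
begin

text \<open>Square n x n real matrices are represented as functions nat => nat => real,
  required to vanish outside the index range {0..<n} x {0..<n}.\<close>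

definition supported_n :: "nat \<Rightarrow> (nat \<Rightarrow> nat \<Rightarrow> real) \<Rightarrow> bool" where
  "supported_n n Z \<longleftrightarrow> (\<forall>i j. (n \<le> i \<or> n \<le> j) \<longrightarrow> Z i j = 0)"

definition inner_n :: "nat \<Rightarrow> (nat \<Rightarrow> nat \<Rightarrow> real) \<Rightarrow> (nat \<Rightarrow> nat \<Rightarrow> real) \<Rightarrow> real" where
  "inner_n n A Z = (\<Sum>i<n. \<Sum>j<n. A i j * Z i j)"

definition Id_n :: "nat \<Rightarrow> nat \<Rightarrow> nat \<Rightarrow> real" where
  "Id_n n = (\<lambda>i j. if i < n \<and> j < n \<and> i = j then 1 else 0)"

definition J_n :: "nat \<Rightarrow> nat \<Rightarrow> nat \<Rightarrow> real" where
  "J_n n = (\<lambda>i j. if i < n \<and> j < n then 1 else 0)"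

definition psd_n :: "nat \<Rightarrow> (nat \<Rightarrow> nat \<Rightarrow> real) \<Rightarrow> bool" where
  "psd_n n Z \<longleftrightarrow> (\<forall>i<n. \<forall>j<n. Z i j = Z j i) \<and>
     (\<forall>x :: nat \<Rightarrow> real. 0 \<le> (\<Sum>i<n. \<Sum>j<n. x i * Z i j * x j))"

definition sdp_base_feasible :: "nat \<Rightarrow> (nat \<Rightarrow> nat \<Rightarrow> real) \<Rightarrow> bool" where
  "sdp_base_feasible n Z \<longleftrightarrow> supported_n n Z \<and> psd_n n Z \<and>
     (\<forall>i<n. Z i i \<le> 1) \<and> (\<forall>i<n. \<forall>j<n. 0 \<le> Z i j)"

definition sdp1_feasible :: "nat \<Rightarrow> nat \<Rightarrow> (nat \<Rightarrow> nat) \<Rightarrow> (nat \<Rightarrow> nat \<Rightarrow> real) \<Rightarrow> bool" where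
  "sdp1_feasible n r K Z \<longleftrightarrow> sdp_base_feasible n Z \<and>
     inner_n n (Id_n n) Z = real (\<Sum>k\<in>{1..r}. K k) \<and>
     inner_n n (J_n n) Z = real (\<Sum>k\<in>{1..r}. (K k)^2)"

definition sdp2_objective :: "nat \<Rightarrow> real \<Rightarrow> real \<Rightarrow> (nat \<Rightarrow> nat \<Rightarrow> real) \<Rightarrow> (nat \<Rightarrow> nat \<Rightarrow> real) \<Rightarrow> real" where
  "sdp2_objective n eta lam A Z = inner_n n A Z - eta * inner_n n (Id_n n) Z - lam * inner_n n (J_n n) Z"

definition unique_maximizer :: "('a \<Rightarrow> bool) \<Rightarrow> ('a \<Rightarrow> real) \<Rightarrow> 'a \<Rightarrow> bool" where
  "unique_maximizer F f Z0 \<longleftrightarrow> F Z0 \<and> (\<forall>Z. F Z \<and> Z \<noteq> Z0 \<longrightarrow> f Z < f Z0)"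

definition valid_clusters :: "nat \<Rightarrow> nat \<Rightarrow> (nat \<Rightarrow> nat) \<Rightarrow> (nat \<Rightarrow> nat set) \<Rightarrow> bool" where
  "valid_clusters n r K C \<longleftrightarrow>
     (\<forall>k\<in>{1..r}. C k \<subseteq> {..<n} \<and> card (C k) = K k) \<and>
     (\<forall>k\<in>{1..r}. \<forall>l\<in>{1..r}. k \<noteq> l \<longrightarrow> C k \<inter> C l = {})"

definition cluster_matrix :: "nat \<Rightarrow> (nat \<Rightarrow> nat set) \<Rightarrow> nat \<Rightarrow> nat \<Rightarrow> real" where
  "cluster_matrix r C = (\<lambda>i j. \<Sum>k\<in>{1..r}. indicator (C k) i * indicator (C k) j)"

definition same_cluster :: "nat \<Rightarrow> (nat \<Rightarrow> nat set) \<Rightarrow> nat \<Rightarrow> nat \<Rightarrow> bool" where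
  "same_cluster r C i j \<longleftrightarrow> (\<exists>k\<in>{1..r}. i \<in> C k \<and> j \<in> C k)"

definition sbm_adj :: "nat \<Rightarrow> nat \<Rightarrow> (nat \<Rightarrow> nat set) \<Rightarrow> real \<Rightarrow> real \<Rightarrow> (nat \<Rightarrow> nat \<Rightarrow> real) pmf" where
  "sbm_adj n r C p q =
     map_pmf (\<lambda>e i j. if i < j then (if e (i, j) then 1 else 0)
                      else if j < i then (if e (j, i) then 1 else 0) else 0)
       (Pi_pmf {(i, j). i < j \<and> j < n} False
          (\<lambda>(i, j). bernoulli_pmf (if same_cluster r C i j then p else q)))"

definition rate_I :: "real \<Rightarrow> real \<Rightarrow> real" where
  "rate_I \<mu> d = \<mu> - d * ln (exp 1 * \<mu> / d)"

definition cluster_size :: "(nat \<Rightarrow> real) \<Rightarrow> nat \<Rightarrow> nat \<Rightarrow> nat" where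
  "cluster_size \<rho> n k = nat \<lfloor>\<rho> k * real n\<rfloor>"

end

theory Submission
  imports Defs
begin

text \<open>
  Program (i) follows from program (ii), since the two extra constraints fix the penalty terms.
  For (ii) one exhibits a dual certificate \<open>S = D - B - A + \<eta>I + \<lambda>J\<close> that annihilates the cluster
  indicators. Writing \<open>e(i, C)\<close> for the number of edges from \<open>i\<close> to \<open>C\<close>, one takes
  \<open>d\<^sub>i = e(i, C\<^sub>k) - \<eta> - \<lambda>K\<^sub>k\<close> on cluster \<open>C\<^sub>k\<close>, and on the block \<open>C\<^sub>k \<times> C\<^sub>l\<close> the entries
  \<open>B\<^sub>i\<^sub>j = \<lambda> - e(i, C\<^sub>l)/K\<^sub>l - e(j, C\<^sub>k)/K\<^sub>k + e(C\<^sub>k, C\<^sub>l)/(K\<^sub>kK\<^sub>l)\<close>. The quadratic form of \<open>B\<close> vanishes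
  orthogonally to the cluster indicators, so there \<open>S\<close> is positive definite as soon as
  \<open>\<eta>\<close> exceeds the spectral norm of \<open>A - EA\<close>. The signs of \<open>d\<close> and \<open>B\<close> follow from Chernoff bounds
  for the degrees, whose exponents are the rates \<open>I\<close>; the density \<open>e(C\<^sub>k, C\<^sub>l)/(K\<^sub>kK\<^sub>l)\<close> is again
  controlled by the spectral norm.

  The bound \<open>\<parallel>A - EA\<parallel> = O(\<surd>log n)\<close> is proved by the trace method in the style of Bandeira and
  van Handel: grouping closed walks by the equality pattern of their vertices shows that
  \<open>E tr (A - EA)\<^sup>2\<^sup>k\<close> is at most \<open>n/m\<close> times \<open>E tr Y\<^sup>2\<^sup>k\<close>, where \<open>Y\<close> is a dense \<open>m \<times> m\<close>
  symmetric matrix of size \<open>m \<sim> np + k \<sim> log n\<close> with independent entries in \<open>{-1, 2}\<close>. The norm of \<open>Y\<close> is bounded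
  by a union bound over an integer net.
\<close>

section \<open>Matrix powers and closed walks\<close>

text \<open>A net argument for \<open>A - EA\<close> itself does not reach sqrt(log n): entries of
  variance about log n / n have tails too heavy for a union over exp(O(n)) points. In dimension of
  order log n, with bounded entries, the net has only n^O(1) points; under a root of order 2k, with
  k of order log n, this factor and the prefactor n become constants. Roles of the conditions, in
  units of log n / n: the first makes every d_i positive. For i in C_k and j in C_l with k < l,
  positivity of B_ij asks that e(i, C_l)/K_l + e(j, C_k)/K_k stay below \<lambda> plus the density
  between the clusters, which is about b. The first term gets the budget b + \<psi>1, the second b +
  \<psi>2. Since \<psi>2 is spent only on the smaller index k, which is at most r - 1, the third
  condition involves \<rho> (r - 1). An outlier only needs e(i, C_k) to be at most \<lambda> K_k,
  which the second condition already yields when r is at least 2; hence the fourth concerns r = 1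
  alone. The strict inequalities leave room for an \<epsilon> that pays for \<eta> and for the
  fluctuation of the density.\<close>

fun mpow :: "nat \<Rightarrow> (nat \<Rightarrow> nat \<Rightarrow> real) \<Rightarrow> nat \<Rightarrow> nat \<Rightarrow> nat \<Rightarrow> real" where
  "mpow n X 0 i j = (if i = j then 1 else 0)"
| "mpow n X (Suc m) i j = (\<Sum>l<n. mpow n X m i l * X l j)"

definition mtrace :: "nat \<Rightarrow> (nat \<Rightarrow> nat \<Rightarrow> real) \<Rightarrow> real" where
  "mtrace n M = (\<Sum>i<n. M i i)"

definition bilin :: "nat \<Rightarrow> (nat \<Rightarrow> nat \<Rightarrow> real) \<Rightarrow> (nat \<Rightarrow> real) \<Rightarrow> (nat \<Rightarrow> real) \<Rightarrow> real" where
  "bilin n M x y = (\<Sum>i<n. \<Sum>j<n. x i * M i j * y j)"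

definition sqn :: "nat \<Rightarrow> (nat \<Rightarrow> real) \<Rightarrow> real" where
  "sqn n x = (\<Sum>i<n. (x i)\<^sup>2)"

lemma sqn_nonneg [simp]: "0 \<le> sqn n x"
  by (simp add: sqn_def sum_nonneg)

lemma mpow_one: "i < n \<Longrightarrow> mpow n X (Suc 0) i j = X i j"
  by (simp add: if_distrib[of "\<lambda>c. c * _"] cong: if_cong)

lemma mpow_add:
  assumes "j < n"
  shows "mpow n X (m + m') i j = (\<Sum>l<n. mpow n X m i l * mpow n X m' l j)"
  using assms
proof (induction m' arbitrary: j)
  case 0
  then show ?case by (simp add: if_distrib[of "\<lambda>c. _ * c"] cong: if_cong)
next
  case (Suc m')
  have "mpow n X (m + Suc m') i j = (\<Sum>k<n. mpow n X (m + m') i k * X k j)" by simp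
  also have "\<dots> = (\<Sum>k<n. \<Sum>l<n. mpow n X m i l * mpow n X m' l k * X k j)"
    by (intro sum.cong) (auto simp: Suc.IH sum_distrib_right)
  also have "\<dots> = (\<Sum>l<n. \<Sum>k<n. mpow n X m i l * mpow n X m' l k * X k j)"
    by (rule sum.swap)
  finally show ?case by (simp add: sum_distrib_left mult.assoc)
qed

lemma mpow_sym:
  assumes sym: "\<And>i j. i < n \<Longrightarrow> j < n \<Longrightarrow> X i j = X j i" and "i < n" "j < n"
  shows "mpow n X m i j = mpow n X m j i"
  using assms(2,3)
proof (induction m arbitrary: i j)
  case (Suc m)
  have "mpow n X (Suc m) j i = (\<Sum>l<n. mpow n X m j l * X l i)" by simp
  also have "\<dots> = (\<Sum>l<n. mpow n X (Suc 0) i l * mpow n X m l j)"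
    by (intro sum.cong refl)
       (use Suc sym in \<open>auto simp: mpow_one simp del: mpow.simps intro: arg_cong2[where f="(*)"]\<close>)
  also have "\<dots> = mpow n X (Suc 0 + m) i j" by (rule mpow_add[symmetric]) fact
  finally show ?case by simp
qed simp

lemma mpow_double:
  assumes sym: "\<And>i j. i < n \<Longrightarrow> j < n \<Longrightarrow> X i j = X j i" and "i < n" "j < n"
  shows "mpow n X (2 * h) i j = (\<Sum>l<n. mpow n X h l i * mpow n X h l j)"
proof -
  have "mpow n X (2 * h) i j = (\<Sum>l<n. mpow n X h i l * mpow n X h l j)"
    unfolding mult_2 by (rule mpow_add) fact
  also have "\<dots> = (\<Sum>l<n. mpow n X h l i * mpow n X h l j)"
    by (intro sum.cong refl, subst mpow_sym[OF sym]) (use assms in auto)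
  finally show ?thesis .
qed

lemma bilin_mpow_double:
  assumes sym: "\<And>i j. i < n \<Longrightarrow> j < n \<Longrightarrow> X i j = X j i"
  shows "bilin n (mpow n X (2 * h)) x x = sqn n (\<lambda>l. \<Sum>j<n. mpow n X h l j * x j)"
proof -
  have "bilin n (mpow n X (2 * h)) x x =
      (\<Sum>i<n. \<Sum>j<n. \<Sum>l<n. (mpow n X h l i * x i) * (mpow n X h l j * x j))"
    unfolding bilin_def
    by (intro sum.cong refl, subst mpow_double[OF sym])
       (auto simp: sum_distrib_left sum_distrib_right mult_ac)
  also have "\<dots> = (\<Sum>l<n. \<Sum>i<n. \<Sum>j<n. (mpow n X h l i * x i) * (mpow n X h l j * x j))"
  proof -
    have "(\<Sum>i<n. \<Sum>j<n. \<Sum>l<n. f i j l) = (\<Sum>l<n. \<Sum>i<n. \<Sum>j<n. f i j l)" for f :: "nat \<Rightarrow> nat \<Rightarrow> nat \<Rightarrow> real"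
      by (subst sum.swap[of "\<lambda>l i. \<Sum>j<n. f i j l"]) (intro sum.cong refl sum.swap)
    then show ?thesis .
  qed
  finally show ?thesis
    by (simp add: sqn_def power2_eq_square sum_product)
qed

lemma mtrace_mpow_double:
  assumes sym: "\<And>i j. i < n \<Longrightarrow> j < n \<Longrightarrow> X i j = X j i"
  shows "mtrace n (mpow n X (2 * h)) = (\<Sum>i<n. \<Sum>l<n. (mpow n X h l i)\<^sup>2)"
  unfolding mtrace_def
  by (intro sum.cong refl, subst mpow_double[OF sym]) (auto simp: power2_eq_square)

text \<open>Repeated squaring in place of the spectral theorem: for symmetric M and a unit vector x,
  Cauchy-Schwarz gives (x, Mx)^2 <= |Mx|^2 = (x, M^2 x). The price is that only exponents that are
  powers of two are reached.\<close>

lemma bilin_power_le: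
  assumes sym: "\<And>i j. i < n \<Longrightarrow> j < n \<Longrightarrow> X i j = X j i" and x: "sqn n x = 1"
  shows "\<bar>bilin n X x x\<bar> ^ (2 ^ s) \<le> \<bar>bilin n (mpow n X (2 ^ s)) x x\<bar>"
proof (induction s)
  case 0
  have "bilin n (mpow n X 1) x x = bilin n X x x"
    unfolding bilin_def by (intro sum.cong refl) (simp add: mpow_one del: mpow.simps)
  then show ?case by (simp del: mpow.simps)
next
  case (Suc s)
  let ?h = "2 ^ s :: nat"
  have "\<bar>bilin n X x x\<bar> ^ (2 ^ Suc s) = (\<bar>bilin n X x x\<bar> ^ ?h)\<^sup>2"
    by (simp flip: power_mult add: mult.commute)
  also have "\<dots> \<le> (\<bar>bilin n (mpow n X ?h) x x\<bar>)\<^sup>2"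
    by (intro power_mono Suc.IH) simp
  also have "\<dots> = (\<Sum>i<n. x i * (\<Sum>j<n. mpow n X ?h i j * x j))\<^sup>2"
    by (simp add: bilin_def sum_distrib_left mult_ac)
  also have "\<dots> \<le> sqn n x * sqn n (\<lambda>i. \<Sum>j<n. mpow n X ?h i j * x j)"
    unfolding sqn_def by (rule Cauchy_Schwarz_ineq_sum)
  also have "\<dots> = bilin n (mpow n X (2 * ?h)) x x"
    by (simp add: x bilin_mpow_double[OF sym])
  finally show ?case by simp
qed

text \<open>The last doubling is spent differently: with h half the exponent, (x, X^2h x) = |X^h
  x|^2 is at most the squared Frobenius norm of X^h, which is the trace of X^2h.\<close>

lemma bilin_power_le_mtrace:
  assumes sym: "\<And>i j. i < n \<Longrightarrow> j < n \<Longrightarrow> X i j = X j i" and x: "sqn n x = 1"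
  shows "\<bar>bilin n X x x\<bar> ^ (2 ^ Suc s) \<le> mtrace n (mpow n X (2 ^ Suc s))"
proof -
  let ?h = "2 ^ s :: nat"
  have "\<bar>bilin n X x x\<bar> ^ (2 ^ Suc s) \<le> \<bar>bilin n (mpow n X (2 ^ Suc s)) x x\<bar>"
    by (rule bilin_power_le[OF sym x])
  also have "\<dots> = sqn n (\<lambda>i. \<Sum>j<n. mpow n X ?h i j * x j)"
    by (simp add: bilin_mpow_double[OF sym])
  also have "\<dots> \<le> (\<Sum>i<n. (\<Sum>j<n. (mpow n X ?h i j)\<^sup>2) * sqn n x)"
    unfolding sqn_def by (intro sum_mono Cauchy_Schwarz_ineq_sum)
  also have "\<dots> = mtrace n (mpow n X (2 * ?h))"
    by (subst mtrace_mpow_double[OF sym], assumption, assumption) (simp add: x sum.swap[of "\<lambda>i j. (mpow n X ?h i j)\<^sup>2"])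
  finally show ?thesis by simp
qed

lemma bilin_scale: "bilin n M (\<lambda>i. c * x i) (\<lambda>i. d * y i) = c * d * bilin n M x y"
  by (simp add: bilin_def sum_distrib_left mult_ac)

lemma sqn_scale: "sqn n (\<lambda>i. c * x i) = c\<^sup>2 * sqn n x"
  by (simp add: sqn_def sum_distrib_left power_mult_distrib)

lemma sqn_eq_0: "sqn n x = 0 \<longleftrightarrow> (\<forall>i<n. x i = 0)"
  by (auto simp: sqn_def sum_nonneg_eq_0_iff)

lemma bilin_le_of_mtrace_le:
  assumes sym: "\<And>i j. i < n \<Longrightarrow> j < n \<Longrightarrow> X i j = X j i" and "0 \<le> t"
    and tr: "mtrace n (mpow n X (2 ^ Suc s)) \<le> t ^ (2 ^ Suc s)"
  shows "\<bar>bilin n X x x\<bar> \<le> t * sqn n x"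
proof (cases "sqn n x = 0")
  case True
  then have "bilin n X x x = 0" by (auto simp: sqn_eq_0 bilin_def)
  with True show ?thesis by simp
next
  case False
  then have pos: "sqn n x > 0" by (simp add: less_le)
  define c where "c = 1 / sqrt (sqn n x)"
  have c2: "c\<^sup>2 = 1 / sqn n x" using pos by (simp add: c_def power_divide)
  have "sqn n (\<lambda>i. c * x i) = 1" using pos by (simp add: sqn_scale c2)
  with bilin_power_le_mtrace[where s = s and n = n and X = X and x = "\<lambda>i. c * x i"] sym tr
  have "\<bar>bilin n X (\<lambda>i. c * x i) (\<lambda>i. c * x i)\<bar> ^ (2 ^ Suc s) \<le> t ^ (2 ^ Suc s)"
    by (meson order_trans)
  then have "\<bar>bilin n X (\<lambda>i. c * x i) (\<lambda>i. c * x i)\<bar> \<le> t"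
    using \<open>0 \<le> t\<close> by (subst (asm) power_mono_iff) auto
  then have "\<bar>c\<^sup>2 * bilin n X x x\<bar> \<le> t" by (simp add: bilin_scale power2_eq_square)
  then show ?thesis using pos by (simp add: c2 abs_mult field_simps)
qed

section \<open>Expansion of matrix powers over walks\<close>

definition walks :: "nat \<Rightarrow> nat \<Rightarrow> (nat \<Rightarrow> nat) set" where
  "walks n m = {..m} \<rightarrow>\<^sub>E {..<n}"

definition walk_prod :: "(nat \<Rightarrow> nat \<Rightarrow> real) \<Rightarrow> nat \<Rightarrow> (nat \<Rightarrow> nat) \<Rightarrow> real" where
  "walk_prod X m w = (\<Prod>t<m. X (w t) (w (Suc t)))"

lemma finite_walks [simp]: "finite (walks n m)"
  by (simp add: walks_def finite_PiE)

text \<open>The arbitrary weight \<open>\<phi>\<close> on the endpoint carries the induction: the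
  last step of a walk is absorbed into the new weight
  \<open>\<lambda>l. \<Sum>j<n. X l j * \<phi> j\<close>. The indicator of the starting point as
  weight then picks out the closed walks.\<close>

lemma mpow_eq_sum_walks:
  assumes "i < n"
  shows "(\<Sum>l<n. mpow n X m i l * \<phi> l) = (\<Sum>w | w \<in> walks n m \<and> w 0 = i. walk_prod X m w * \<phi> (w m))"
proof (induction m arbitrary: \<phi>)
  case 0
  have "{w. w \<in> walks n 0 \<and> w 0 = i} = {(\<lambda>t. if t = 0 then i else undefined)}"
    using assms by (auto simp: walks_def PiE_iff extensional_def fun_eq_iff)
  with assms show ?case
    by (simp add: walk_prod_def if_distrib[of "\<lambda>c. c * _"] cong: if_cong)
next
  case (Suc m)
  let ?P = "\<lambda>m. {w. w \<in> walks n m \<and> w 0 = i}"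
  have "(\<Sum>j<n. mpow n X (Suc m) i j * \<phi> j) = (\<Sum>j<n. \<Sum>l<n. mpow n X m i l * X l j * \<phi> j)"
    by (simp add: sum_distrib_right)
  also have "\<dots> = (\<Sum>l<n. mpow n X m i l * (\<Sum>j<n. X l j * \<phi> j))"
    by (subst sum.swap) (simp add: sum_distrib_left mult.assoc)
  also have "\<dots> = (\<Sum>w\<in>?P m. walk_prod X m w * (\<Sum>j<n. X (w m) j * \<phi> j))"
    by (rule Suc.IH)
  also have "\<dots> = (\<Sum>(w, j)\<in>?P m \<times> {..<n}. walk_prod X m w * X (w m) j * \<phi> j)"
    by (subst sum.cartesian_product[symmetric]) (simp add: sum_distrib_left mult.assoc)
  also have "\<dots> = (\<Sum>w\<in>?P (Suc m). walk_prod X (Suc m) w * \<phi> (w (Suc m)))"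
  proof (rule sum.reindex_bij_witness[where
        i = "\<lambda>w. (restrict w {..m}, w (Suc m))" and j = "\<lambda>(w, j). w(Suc m := j)"])
    fix a assume "a \<in> ?P m \<times> {..<n}"
    then obtain w j where a: "a = (w, j)" and w: "w \<in> walks n m" "w 0 = i" and j: "j < n" by auto
    show "(restrict ((\<lambda>(w, j). w(Suc m := j)) a) {..m}, ((\<lambda>(w, j). w(Suc m := j)) a) (Suc m)) = a"
      using w by (auto simp: a fun_eq_iff restrict_def walks_def PiE_iff extensional_def)
    show "(\<lambda>(w, j). w(Suc m := j)) a \<in> ?P (Suc m)"
      using w j by (auto simp: a walks_def PiE_iff extensional_def le_Suc_eq)
    have "walk_prod X m (w(Suc m := j)) = walk_prod X m w"
      unfolding walk_prod_def by (intro prod.cong) auto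
    then show "walk_prod X (Suc m) ((\<lambda>(w, j). w(Suc m := j)) a) * \<phi> (((\<lambda>(w, j). w(Suc m := j)) a) (Suc m)) =
      (case a of (w, j) \<Rightarrow> walk_prod X m w * X (w m) j * \<phi> j)"
      by (simp add: a walk_prod_def)
  next
    fix w assume w: "w \<in> ?P (Suc m)"
    then show "(\<lambda>(w, j). w(Suc m := j)) (restrict w {..m}, w (Suc m)) = w"
      by (auto simp: fun_eq_iff restrict_def walks_def PiE_iff extensional_def le_Suc_eq)
    show "(restrict w {..m}, w (Suc m)) \<in> ?P m \<times> {..<n}"
      using w by (auto simp: walks_def PiE_iff extensional_def)
  qed
  finally show ?case .
qed

lemma mtrace_mpow_eq_sum_walks:
  "mtrace n (mpow n X m) = (\<Sum>w | w \<in> walks n m \<and> w 0 = w m. walk_prod X m w)"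
proof -
  have "mpow n X m i i = (\<Sum>w | w \<in> {w \<in> walks n m. w 0 = w m} \<and> w 0 = i. walk_prod X m w)" if "i < n" for i
  proof -
    have "mpow n X m i i = (\<Sum>l<n. mpow n X m i l * (if l = i then 1 else 0))"
      using that by (simp add: if_distrib[of "\<lambda>c. _ * c"] cong: if_cong)
    also have "\<dots> = (\<Sum>w | w \<in> walks n m \<and> w 0 = i. walk_prod X m w * (if w m = i then 1 else 0))"
      by (rule mpow_eq_sum_walks[OF that])
    also have "\<dots> = (\<Sum>w | w \<in> {w \<in> walks n m. w 0 = w m} \<and> w 0 = i. walk_prod X m w)"
      by (rule sum.mono_neutral_cong_right) auto
    finally show ?thesis .
  qed
  then have "mtrace n (mpow n X m) =
      (\<Sum>i<n. \<Sum>w | w \<in> {w \<in> walks n m. w 0 = w m} \<and> w 0 = i. walk_prod X m w)"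
    by (simp add: mtrace_def)
  also have "\<dots> = (\<Sum>w\<in>{w \<in> walks n m. w 0 = w m}. walk_prod X m w)"
    by (rule sum.group) (simp, simp, auto simp: walks_def PiE_iff)
  finally show ?thesis .
qed

section \<open>Comparison of trace moments\<close>

definition pairs :: "nat \<Rightarrow> (nat \<times> nat) set" where
  "pairs n = {(i, j). i < j \<and> j < n}"

definition edge_pmf :: "nat \<Rightarrow> (nat \<times> nat \<Rightarrow> real) \<Rightarrow> (nat \<times> nat \<Rightarrow> bool) pmf" where
  "edge_pmf n P = Pi_pmf (pairs n) False (\<lambda>e. bernoulli_pmf (P e))"

text \<open>The entry function \<open>f\<close> sees the edge as well as its state, so one
  construction covers the adjacency matrix, its centring by edge-dependent means, the dense
  comparison matrix, and even deterministic matrices, where \<open>f\<close> ignores the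
  state.\<close>

definition symmat :: "(nat \<times> nat \<Rightarrow> bool \<Rightarrow> real) \<Rightarrow> (nat \<times> nat \<Rightarrow> bool) \<Rightarrow> nat \<Rightarrow> nat \<Rightarrow> real" where
  "symmat f \<omega> i j = (if i < j then f (i, j) (\<omega> (i, j)) else if j < i then f (j, i) (\<omega> (j, i)) else 0)"

definition wedge :: "(nat \<Rightarrow> nat) \<Rightarrow> nat \<Rightarrow> nat \<times> nat" where
  "wedge w t = (min (w t) (w (Suc t)), max (w t) (w (Suc t)))"

definition wmult :: "nat \<Rightarrow> (nat \<Rightarrow> nat) \<Rightarrow> nat \<times> nat \<Rightarrow> nat" where
  "wmult m w e = card {t \<in> {..<m}. wedge w t = e}"

lemma finite_pairs [simp]: "finite (pairs n)"
  by (rule finite_subset[of _ "{..<n} \<times> {..<n}"]) (auto simp: pairs_def)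

lemma symmat_sym: "symmat f \<omega> i j = symmat f \<omega> j i"
  by (auto simp: symmat_def)

lemma finite_set_edge_pmf: "finite (set_pmf (edge_pmf n P))"
  unfolding edge_pmf_def
  by (rule finite_subset[OF set_Pi_pmf_subset']) auto

lemma integrable_edge_pmf [simp]: "integrable (measure_pmf (edge_pmf n P)) (g :: _ \<Rightarrow> real)"
  by (intro integrable_measure_pmf_finite finite_set_edge_pmf)

lemma expectation_prod_edge_pmf:
  fixes g :: "nat \<times> nat \<Rightarrow> bool \<Rightarrow> real"
  shows "measure_pmf.expectation (edge_pmf n P) (\<lambda>\<omega>. \<Prod>e\<in>pairs n. g e (\<omega> e)) =
    (\<Prod>e\<in>pairs n. measure_pmf.expectation (bernoulli_pmf (P e)) (g e))"
proof (cases "pairs n = {}")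
  case False
  have "prob_space.indep_vars (measure_pmf (edge_pmf n P)) (\<lambda>_. count_space UNIV) (\<lambda>e \<omega>. \<omega> e) (pairs n)"
    unfolding edge_pmf_def by (rule indep_vars_Pi_pmf) simp
  then have "prob_space.indep_vars (measure_pmf (edge_pmf n P)) (\<lambda>_. borel) (\<lambda>e \<omega>. g e (\<omega> e)) (pairs n)"
    by (rule prob_space.indep_vars_compose2[OF measure_pmf.prob_space_axioms]) auto
  then have "measure_pmf.expectation (edge_pmf n P) (\<lambda>\<omega>. \<Prod>e\<in>pairs n. g e (\<omega> e)) =
      (\<Prod>e\<in>pairs n. measure_pmf.expectation (edge_pmf n P) (\<lambda>\<omega>. g e (\<omega> e)))"
    by (intro prob_space.indep_vars_lebesgue_integral[OF measure_pmf.prob_space_axioms]) auto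
  also have "\<dots> = (\<Prod>e\<in>pairs n. measure_pmf.expectation (bernoulli_pmf (P e)) (g e))"
  proof (intro prod.cong refl)
    fix e assume e: "e \<in> pairs n"
    have "map_pmf (\<lambda>\<omega>. \<omega> e) (edge_pmf n P) = bernoulli_pmf (P e)"
      using e unfolding edge_pmf_def by (subst Pi_pmf_component) auto
    then have "measure_pmf.expectation (bernoulli_pmf (P e)) (g e) =
        measure_pmf.expectation (map_pmf (\<lambda>\<omega>. \<omega> e) (edge_pmf n P)) (g e)" by simp
    then show "measure_pmf.expectation (edge_pmf n P) (\<lambda>\<omega>. g e (\<omega> e)) =
        measure_pmf.expectation (bernoulli_pmf (P e)) (g e)"
      by simp
  qed
  finally show ?thesis .
qed simp

lemma walk_prod_symmat:
  assumes w: "w \<in> walks n m" and loop: "\<forall>t<m. w t \<noteq> w (Suc t)"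
  shows "walk_prod (symmat f \<omega>) m w = (\<Prod>e\<in>pairs n. f e (\<omega> e) ^ wmult m w e)"
proof -
  have "walk_prod (symmat f \<omega>) m w = (\<Prod>t<m. f (wedge w t) (\<omega> (wedge w t)))"
    unfolding walk_prod_def
  proof (intro prod.cong refl)
    fix t assume "t \<in> {..<m}"
    then have "w t < w (Suc t) \<or> w (Suc t) < w t" using loop by (auto simp: neq_iff)
    then show "symmat f \<omega> (w t) (w (Suc t)) = f (wedge w t) (\<omega> (wedge w t))"
      by (auto simp: symmat_def wedge_def min_def max_def)
  qed
  also have "\<dots> = (\<Prod>e\<in>pairs n. \<Prod>t | t \<in> {..<m} \<and> wedge w t = e. f (wedge w t) (\<omega> (wedge w t)))"
  proof (rule prod.group[symmetric])
    show "wedge w ` {..<m} \<subseteq> pairs n"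
      using w loop by (auto simp: walks_def PiE_iff wedge_def pairs_def min_def max_def)
  qed auto
  also have "\<dots> = (\<Prod>e\<in>pairs n. f e (\<omega> e) ^ wmult m w e)"
    by (intro prod.cong refl) (simp add: wmult_def)
  finally show ?thesis .
qed

text \<open>The closed walks that contribute to a trace moment of centred entries: no loops, every edge used at least twice.\<close>

definition good_walk :: "nat \<Rightarrow> (nat \<Rightarrow> nat) \<Rightarrow> bool" where
  "good_walk m w \<longleftrightarrow> w 0 = w m \<and>
    (\<forall>t<m. w t \<noteq> w (Suc t) \<and> (\<exists>s<m. s \<noteq> t \<and> wedge w s = wedge w t))"

lemma good_walk_wmult:
  assumes "good_walk m w" "wmult m w e \<noteq> 0"
  shows "2 \<le> wmult m w e"
proof -
  from assms(2) obtain t where t: "t < m" "wedge w t = e"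
    by (auto simp: wmult_def card_eq_0_iff)
  with assms(1) obtain s where s: "s < m" "s \<noteq> t" "wedge w s = e"
    by (auto simp: good_walk_def)
  have "card {s, t} \<le> wmult m w e"
    unfolding wmult_def by (rule card_mono) (use s t in auto)
  then show ?thesis using s by simp
qed

lemma not_good_walk_wmult:
  assumes "\<not> good_walk m w" "w 0 = w m" "\<forall>t<m. w t \<noteq> w (Suc t)"
  obtains t where "t < m" "wmult m w (wedge w t) = 1"
proof -
  from assms obtain t where t: "t < m" "\<And>s. s < m \<Longrightarrow> s \<noteq> t \<Longrightarrow> wedge w s \<noteq> wedge w t"
    by (auto simp: good_walk_def)
  then have "{s \<in> {..<m}. wedge w s = wedge w t} = {t}" by auto
  then have "wmult m w (wedge w t) = 1" by (simp add: wmult_def)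
  with t that show ?thesis by blast
qed

lemma wedge_in_pairs:
  assumes "w \<in> walks n m" "t < m" "w t \<noteq> w (Suc t)"
  shows "wedge w t \<in> pairs n"
  using assms
  by (auto simp: walks_def PiE_iff wedge_def pairs_def min_def max_def Suc_le_eq) 

lemma expectation_walk_prod:
  assumes w: "w \<in> walks n m" and loop: "\<forall>t<m. w t \<noteq> w (Suc t)"
  shows "measure_pmf.expectation (edge_pmf n P) (\<lambda>\<omega>. walk_prod (symmat f \<omega>) m w) =
    (\<Prod>e\<in>pairs n. measure_pmf.expectation (bernoulli_pmf (P e)) (\<lambda>v. f e v ^ wmult m w e))"
  unfolding walk_prod_symmat[OF assms]
  by (rule expectation_prod_edge_pmf[where g = "\<lambda>e v. f e v ^ wmult m w e"])

lemma walk_prod_loop: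
  assumes "t < m" "w t = w (Suc t)"
  shows "walk_prod (symmat f \<omega>) m w = 0"
  unfolding walk_prod_def using assms by (intro prod_zero bexI[of _ t]) (auto simp: symmat_def)

text \<open>Either a loop meets the zero diagonal, or some edge is traversed exactly once and its
  mean-zero factor splits off by independence.\<close>

lemma expectation_walk_prod_not_good:
  assumes w: "w \<in> walks n m" "w 0 = w m" "\<not> good_walk m w"
    and mean: "\<And>e. e \<in> pairs n \<Longrightarrow> measure_pmf.expectation (bernoulli_pmf (P e)) (f e) = 0"
  shows "measure_pmf.expectation (edge_pmf n P) (\<lambda>\<omega>. walk_prod (symmat f \<omega>) m w) = 0"
proof (cases "\<forall>t<m. w t \<noteq> w (Suc t)")
  case True
  from not_good_walk_wmult[OF w(3,2) True] obtain t where t: "t < m" "wmult m w (wedge w t) = 1" .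
  have e: "wedge w t \<in> pairs n" using w t True by (intro wedge_in_pairs) auto
  show ?thesis
    unfolding expectation_walk_prod[OF w(1) True]
    by (rule prod_zero) (use e t mean[OF e] in \<open>auto intro!: bexI[of _ "wedge w t"]\<close>)
next
  case False
  then show ?thesis using walk_prod_loop by auto
qed

lemma card_walk_vertices: "card (w ` {..m}) \<le> card (wedge w ` {..<m}) + 1"
proof (induction m)
  case (Suc m)
  show ?case
  proof (cases "w (Suc m) \<in> w ` {..m}")
    case True
    then have "w ` {..Suc m} = w ` {..m}" by (auto simp: atMost_Suc)
    moreover have "card (wedge w ` {..<m}) \<le> card (wedge w ` {..<Suc m})"
      by (intro card_mono image_mono) auto
    ultimately show ?thesis using Suc by simp
  next
    case False
    have "wedge w m \<notin> wedge w ` {..<m}"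
    proof
      assume "wedge w m \<in> wedge w ` {..<m}"
      then obtain t where t: "t < m" "wedge w m = wedge w t" by auto
      then have "w (Suc m) = w t \<or> w (Suc m) = w (Suc t)"
        by (auto simp: wedge_def min_def max_def split: if_splits)
      with t False show False by auto
    qed
    then have "card (wedge w ` {..<Suc m}) = Suc (card (wedge w ` {..<m}))"
      by (simp add: lessThan_Suc)
    then show ?thesis using Suc False by (simp add: atMost_Suc)
  qed
qed simp

lemma good_walk_card_edges:
  assumes "good_walk m w"
  shows "2 * card (wedge w ` {..<m}) \<le> m"
proof -
  have "(\<Sum>e\<in>wedge w ` {..<m}. 2) \<le> (\<Sum>e\<in>wedge w ` {..<m}. wmult m w e)"
  proof (rule sum_mono)
    fix e assume "e \<in> wedge w ` {..<m}"
    then have "wmult m w e \<noteq> 0" by (auto simp: wmult_def card_eq_0_iff)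
    then show "2 \<le> wmult m w e" by (rule good_walk_wmult[OF assms])
  qed
  also have "\<dots> = (\<Sum>t<m. 1)"
    unfolding wmult_def card_eq_sum by (rule sum.group) auto
  finally show ?thesis by simp
qed

text \<open>Each distinct edge costs a factor \<open>\<pi>\<close>. There are at least as many of
  them as vertices minus one, and \<open>\<pi>\<close> is at most 1, so the edge count may be traded
  for the vertex count, which is also what the number of walks of a given shape depends on.\<close>

lemma expectation_walk_prod_upper:
  assumes w: "w \<in> walks n m" "good_walk m w" and \<pi>: "0 \<le> \<pi>" "\<pi> \<le> 1"
    and mom: "\<And>e k. e \<in> pairs n \<Longrightarrow> 2 \<le> k \<Longrightarrow>
      \<bar>measure_pmf.expectation (bernoulli_pmf (P e)) (\<lambda>v. f e v ^ k)\<bar> \<le> \<pi>"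
  shows "\<bar>measure_pmf.expectation (edge_pmf n P) (\<lambda>\<omega>. walk_prod (symmat f \<omega>) m w)\<bar> \<le> \<pi> ^ (card (w ` {..m}) - 1)"
proof -
  let ?M = "\<lambda>e. measure_pmf.expectation (bernoulli_pmf (P e)) (\<lambda>v. f e v ^ wmult m w e)"
  have loop: "\<forall>t<m. w t \<noteq> w (Suc t)" using w by (auto simp: good_walk_def)
  have sub: "wedge w ` {..<m} \<subseteq> pairs n" using w loop by (auto intro!: wedge_in_pairs)
  have "\<bar>\<Prod>e\<in>pairs n. ?M e\<bar> = (\<Prod>e\<in>pairs n. \<bar>?M e\<bar>)" by (rule abs_prod)
  also have "\<dots> = (\<Prod>e\<in>wedge w ` {..<m}. \<bar>?M e\<bar>)"
  proof (rule prod.mono_neutral_right)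
    show "\<forall>i\<in>pairs n - wedge w ` {..<m}. \<bar>?M i\<bar> = 1"
    proof
      fix e assume "e \<in> pairs n - wedge w ` {..<m}"
      then have "wmult m w e = 0" by (auto simp: wmult_def card_eq_0_iff)
      then show "\<bar>?M e\<bar> = 1" by simp
    qed
  qed (use sub in auto)
  also have "\<dots> \<le> (\<Prod>e\<in>wedge w ` {..<m}. \<pi>)"
  proof (intro prod_mono conjI)
    fix e assume e: "e \<in> wedge w ` {..<m}"
    then have "wmult m w e \<noteq> 0" by (auto simp: wmult_def card_eq_0_iff)
    then have "2 \<le> wmult m w e" by (rule good_walk_wmult[OF w(2)])
    then show "\<bar>?M e\<bar> \<le> \<pi>" using e sub by (intro mom) auto
  qed auto
  also have "\<dots> = \<pi> ^ card (wedge w ` {..<m})" by simp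
  also have "\<dots> \<le> \<pi> ^ (card (w ` {..m}) - 1)"
    using card_walk_vertices[of w m] \<pi> by (intro power_decreasing) auto
  finally show ?thesis unfolding expectation_walk_prod[OF w(1) loop] .
qed

lemma expectation_walk_prod_lower:
  assumes w: "w \<in> walks n m" "good_walk m w"
    and mom: "\<And>e k. e \<in> pairs n \<Longrightarrow> 2 \<le> k \<Longrightarrow>
      1 \<le> measure_pmf.expectation (bernoulli_pmf (P e)) (\<lambda>v. f e v ^ k)"
  shows "1 \<le> measure_pmf.expectation (edge_pmf n P) (\<lambda>\<omega>. walk_prod (symmat f \<omega>) m w)"
proof -
  have loop: "\<forall>t<m. w t \<noteq> w (Suc t)" using w by (auto simp: good_walk_def)
  show ?thesis
    unfolding expectation_walk_prod[OF w(1) loop]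
  proof (rule prod_ge_1)
    fix e assume e: "e \<in> pairs n"
    show "1 \<le> measure_pmf.expectation (bernoulli_pmf (P e)) (\<lambda>v. f e v ^ wmult m w e)"
    proof (cases "wmult m w e = 0")
      case False
      then show ?thesis using good_walk_wmult[OF w(2)] e mom by blast
    qed simp
  qed
qed

text \<open>The equality pattern of a walk, written as a relation on times. It does not mention
  vertex labels, so walks on vertex sets of different sizes can share a pattern.\<close>

definition wker :: "nat \<Rightarrow> (nat \<Rightarrow> nat) \<Rightarrow> (nat \<times> nat) set" where
  "wker m w = {(s, t). s \<le> m \<and> t \<le> m \<and> w s = w t}"

lemma wker_eqD: "wker m w = wker m w' \<Longrightarrow> s \<le> m \<Longrightarrow> t \<le> m \<Longrightarrow> w s = w t \<longleftrightarrow> w' s = w' t"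
  by (auto simp: wker_def set_eq_iff)

lemma wedge_eq_iff: "wedge w s = wedge w t \<longleftrightarrow>
    (w s = w t \<and> w (Suc s) = w (Suc t)) \<or> (w s = w (Suc t) \<and> w (Suc s) = w t)"
  by (auto simp: wedge_def min_def max_def)

lemma good_walk_wker:
  assumes "wker m w = wker m w'"
  shows "good_walk m w \<longleftrightarrow> good_walk m w'"
proof -
  have "wedge w s = wedge w t \<longleftrightarrow> wedge w' s = wedge w' t" if "s < m" "t < m" for s t
    unfolding wedge_eq_iff using that by (simp add: wker_eqD[OF assms])
  then show ?thesis
    unfolding good_walk_def using wker_eqD[OF assms]
    by (intro arg_cong2[where f = "(\<and>)"] all_cong ex_cong arg_cong[where f = Not]) (auto simp: Suc_le_eq)
qed

lemma card_image_wker: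
  assumes "wker m w = wker m w'"
  shows "card (w ` {..m}) = card (w' ` {..m})"
proof (rule bij_betw_same_card)
  let ?f = "\<lambda>v. w' (inv_into {..m} w v)"
  have f: "?f (w t) = w' t" if "t \<le> m" for t
  proof -
    have "inv_into {..m} w (w t) \<in> {..m}" "w (inv_into {..m} w (w t)) = w t"
      using that by (auto intro!: inv_into_into f_inv_into_f simp del: atMost_iff)
    then show ?thesis using wker_eqD[OF assms] that by auto
  qed
  show "bij_betw ?f (w ` {..m}) (w' ` {..m})"
    unfolding bij_betw_def
  proof
    show "inj_on ?f (w ` {..m})" using f wker_eqD[OF assms] by (auto simp: inj_on_def)
    show "?f ` w ` {..m} = w' ` {..m}" using f by (force simp: image_iff)
  qed
qed

text \<open>A walk with the pattern of \<open>w0\<close> is an injective relabelling of the vertices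
  of \<open>w0\<close>. The walk \<open>w0\<close> itself need not stay below \<open>n\<close>, so a
  representative taken from the large vertex set also counts walks on the small one; if there are
  too few labels, the product contains the factor 0.\<close>

lemma card_walks_wker:
  "card {w \<in> walks n m. wker m w = wker m w0} = (\<Prod>i<card (w0 ` {..m}). n - i)"
proof -
  let ?V = "w0 ` {..m}"
  let ?I = "{\<phi> \<in> ?V \<rightarrow>\<^sub>E {..<n}. inj_on \<phi> ?V}"
  have "bij_betw (\<lambda>\<phi>. restrict (\<phi> \<circ> w0) {..m}) ?I {w \<in> walks n m. wker m w = wker m w0}"
  proof (rule bij_betw_byWitness[where f' = "\<lambda>w. restrict (\<lambda>v. w (inv_into {..m} w0 v)) ?V"])
    have inv: "inv_into {..m} w0 (w0 t) \<le> m \<and> w0 (inv_into {..m} w0 (w0 t)) = w0 t" if "t \<le> m" for t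
    proof -
      have "w0 t \<in> w0 ` {..m}" using that by auto
      then show ?thesis using inv_into_into[of "w0 t" w0 "{..m}"] f_inv_into_f[of "w0 t" w0 "{..m}"] by auto
    qed
    show "\<forall>\<phi>\<in>?I. restrict (\<lambda>v. restrict (\<phi> \<circ> w0) {..m} (inv_into {..m} w0 v)) ?V = \<phi>"
      using inv by (auto simp: fun_eq_iff restrict_def PiE_iff extensional_def)
    show "\<forall>w\<in>{w \<in> walks n m. wker m w = wker m w0}.
        restrict (restrict (\<lambda>v. w (inv_into {..m} w0 v)) ?V \<circ> w0) {..m} = w"
    proof
      fix w assume w: "w \<in> {w \<in> walks n m. wker m w = wker m w0}"
      then have "w (inv_into {..m} w0 (w0 t)) = w t" if "t \<le> m" for t
        using that inv[OF that] wker_eqD[of m w w0] by blast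
      then show "restrict (restrict (\<lambda>v. w (inv_into {..m} w0 v)) ?V \<circ> w0) {..m} = w"
        using w by (auto simp: fun_eq_iff restrict_def walks_def PiE_iff extensional_def)
    qed
    show "(\<lambda>\<phi>. restrict (\<phi> \<circ> w0) {..m}) ` ?I \<subseteq> {w \<in> walks n m. wker m w = wker m w0}"
    proof (intro image_subsetI CollectI conjI)
      fix \<phi> assume \<phi>: "\<phi> \<in> ?I"
      then show "restrict (\<phi> \<circ> w0) {..m} \<in> walks n m"
        by (auto simp: walks_def PiE_iff)
      have "\<phi> (w0 s) = \<phi> (w0 t) \<longleftrightarrow> w0 s = w0 t" if "s \<le> m" "t \<le> m" for s t
        using \<phi> that by (auto simp: inj_on_def)
      then show "wker m (restrict (\<phi> \<circ> w0) {..m}) = wker m w0"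
        by (auto simp: wker_def)
    qed
    show "(\<lambda>w. restrict (\<lambda>v. w (inv_into {..m} w0 v)) ?V) ` {w \<in> walks n m. wker m w = wker m w0} \<subseteq> ?I"
    proof (intro image_subsetI CollectI conjI)
      fix w assume w: "w \<in> {w \<in> walks n m. wker m w = wker m w0}"
      then have *: "w (inv_into {..m} w0 (w0 t)) = w t" if "t \<le> m" for t
        using that inv[OF that] wker_eqD[of m w w0] by blast
      show "restrict (\<lambda>v. w (inv_into {..m} w0 v)) ?V \<in> ?V \<rightarrow>\<^sub>E {..<n}"
        using w * by (auto simp: walks_def PiE_iff)
      show "inj_on (restrict (\<lambda>v. w (inv_into {..m} w0 v)) ?V) ?V"
        using w * wker_eqD[of m w w0] by (auto simp: inj_on_def)
    qed
  qed
  then have "card {w \<in> walks n m. wker m w = wker m w0} = card ?I"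
    by (simp add: bij_betw_same_card)
  also have "\<dots> = (\<Prod>i<card ?V. n - i)"
    by (subst card_inj_on_subset_funcset) (auto simp: atLeast0LessThan)
  finally show ?thesis .
qed

text \<open>Factor by factor, (n - i)\<pi> <= n\<pi> <= r - k <= r - i for 1 <= i <= k; this
  dictates the size of the small dimension \<open>r\<close>. There is one power of
  \<open>\<pi>\<close> fewer than there are vertices, and the unpaired first factor leaves the ratio
  n / r.\<close>

lemma falling_factorial_compare:
  assumes r: "0 < r" "real n * \<pi> + real k \<le> real r" and \<pi>: "0 \<le> \<pi>" and m: "1 \<le> m" "m \<le> k + 1"
  shows "real (\<Prod>i<m. n - i) * \<pi> ^ (m - 1) \<le> real n / real r * real (\<Prod>i<m. r - i)"
proof -
  obtain l where l: "m = Suc l" using m by (cases m) auto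
  have "0 \<le> real n * \<pi>" using \<pi> by simp
  with r have kr: "k \<le> r" by linarith
  have "real (\<Prod>i<m. n - i) = real n * (\<Prod>i<l. real (n - Suc i))"
    unfolding l by (subst prod.lessThan_Suc_shift) simp
  also have "\<dots> * \<pi> ^ (m - 1) = real n * (\<Prod>i<l. real (n - Suc i) * \<pi>)"
    by (simp add: l prod.distrib)
  also have "\<dots> \<le> real n * (\<Prod>i<l. real (r - Suc i))"
  proof (intro mult_left_mono prod_mono conjI)
    fix i assume i: "i \<in> {..<l}"
    have "real (n - Suc i) * \<pi> \<le> real n * \<pi>" using \<pi> by (intro mult_right_mono) auto
    also have "\<dots> \<le> real (r - k)" using r kr by (simp add: of_nat_diff)
    also have "\<dots> \<le> real (r - Suc i)" using i m l by (intro of_nat_mono) auto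
    finally show "real (n - Suc i) * \<pi> \<le> real (r - Suc i)" .
  qed (use \<pi> in auto)
  also have "\<dots> = real n / real r * (real r * (\<Prod>i<l. real (r - Suc i)))" using r by simp
  also have "real r * (\<Prod>i<l. real (r - Suc i)) = real (\<Prod>i<m. r - i)"
    unfolding l by (subst prod.lessThan_Suc_shift) simp
  finally show ?thesis .
qed

lemma sum_good_walks_compare:
  assumes r: "0 < r" "real n * \<pi> + real k \<le> real r" and \<pi>: "0 \<le> \<pi>" and m: "m = 2 * k"
  shows "(\<Sum>w | w \<in> walks n m \<and> good_walk m w. \<pi> ^ (card (w ` {..m}) - 1)) \<le>
    real n / real r * real (card {w \<in> walks r m. good_walk m w})"
proof -
  let ?G = "\<lambda>n. {w. w \<in> walks n m \<and> good_walk m w}"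
  let ?K = "wker m ` ?G n"
  have fin: "finite (?G n)" for n by simp
  have "(\<Sum>w\<in>?G n. \<pi> ^ (card (w ` {..m}) - 1)) =
      (\<Sum>\<kappa>\<in>?K. \<Sum>w | w \<in> ?G n \<and> wker m w = \<kappa>. \<pi> ^ (card (w ` {..m}) - 1))"
    by (rule sum.image_gen) simp
  also have "\<dots> \<le> (\<Sum>\<kappa>\<in>?K. real n / real r * real (card {w \<in> ?G r. wker m w = \<kappa>}))"
  proof (rule sum_mono)
    fix \<kappa> assume "\<kappa> \<in> ?K"
    then obtain w0 where w0: "w0 \<in> walks n m" "good_walk m w0" "\<kappa> = wker m w0" by auto
    let ?v = "card (w0 ` {..m})"
    \<comment> \<open>Being good depends on the pattern only, so the full pattern class consists of
      good walks, in dimension \<open>n\<close> and in dimension \<open>r\<close> alike.\<close>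
    have fib: "{w. w \<in> ?G N \<and> wker m w = \<kappa>} = {w \<in> walks N m. wker m w = wker m w0}" for N
    proof -
      have "good_walk m w" if "wker m w = wker m w0" for w
        using good_walk_wker[OF that] w0(2) by simp
      then show ?thesis using w0(3) by blast
    qed
    have "(\<Sum>w | w \<in> ?G n \<and> wker m w = \<kappa>. \<pi> ^ (card (w ` {..m}) - 1)) =
        (\<Sum>w | w \<in> ?G n \<and> wker m w = \<kappa>. \<pi> ^ (?v - 1))"
    proof (rule sum.cong)
      fix w assume "w \<in> {w. w \<in> ?G n \<and> wker m w = \<kappa>}"
      then have "wker m w = wker m w0" by (simp add: w0)
      from card_image_wker[OF this] show "\<pi> ^ (card (w ` {..m}) - 1) = \<pi> ^ (?v - 1)" by simp
    qed simp
    also have "\<dots> = real (\<Prod>i<?v. n - i) * \<pi> ^ (?v - 1)"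
      unfolding fib by (simp add: card_walks_wker)
    also have "\<dots> \<le> real n / real r * real (\<Prod>i<?v. r - i)"
    proof (rule falling_factorial_compare[OF r \<pi>])
      show "1 \<le> ?v" by (simp add: Suc_le_eq card_gt_0_iff)
      show "?v \<le> k + 1" using card_walk_vertices[of w0 m] good_walk_card_edges[OF w0(2)] m by simp
    qed
    also have "\<dots> = real n / real r * real (card {w \<in> ?G r. wker m w = \<kappa>})"
      using fib[of r] card_walks_wker[of r m w0] by simp
    finally show "(\<Sum>w | w \<in> ?G n \<and> wker m w = \<kappa>. \<pi> ^ (card (w ` {..m}) - 1)) \<le>
        real n / real r * real (card {w \<in> ?G r. wker m w = \<kappa>})" .
  qed
  also have "\<dots> = real n / real r * real (\<Sum>\<kappa>\<in>?K. card {w \<in> ?G r. wker m w = \<kappa>})"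
    by (simp add: sum_distrib_left)
  also have "\<dots> \<le> real n / real r * real (card (?G r))"
  proof (intro mult_left_mono of_nat_mono)
    have "(\<Sum>\<kappa>\<in>?K. card {w \<in> ?G r. wker m w = \<kappa>}) = card (\<Union>\<kappa>\<in>?K. {w \<in> ?G r. wker m w = \<kappa>})"
      by (rule card_UN_disjoint[symmetric]) auto
    also have "\<dots> \<le> card (?G r)"
      by (rule card_mono) auto
    finally show "(\<Sum>\<kappa>\<in>?K. card {w \<in> ?G r. wker m w = \<kappa>}) \<le> card (?G r)" .
  qed simp
  finally show ?thesis by simp
qed

text \<open>The number of good walks in dimension \<open>r\<close> is the bridge. On the sparse side
  the remaining closed walks have expectation 0 and are dropped; on the dense side every good walk
  contributes at least 1, and the other closed walks, again of expectation 0, are added back to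
  complete the trace. Hence both laws must be centred.\<close>

lemma expectation_mtrace_compare:
  assumes r: "0 < r" "real n * \<pi> + real k \<le> real r" and \<pi>: "0 \<le> \<pi>" "\<pi> \<le> 1" and m: "m = 2 * k"
    and mean: "\<And>e. e \<in> pairs n \<Longrightarrow> measure_pmf.expectation (bernoulli_pmf (P e)) (f e) = 0"
    and mom: "\<And>e k. e \<in> pairs n \<Longrightarrow> 2 \<le> k \<Longrightarrow>
      \<bar>measure_pmf.expectation (bernoulli_pmf (P e)) (\<lambda>v. f e v ^ k)\<bar> \<le> \<pi>"
    and mean': "\<And>e. e \<in> pairs r \<Longrightarrow> measure_pmf.expectation (bernoulli_pmf (Q e)) (g e) = 0"
    and mom': "\<And>e k. e \<in> pairs r \<Longrightarrow> 2 \<le> k \<Longrightarrow>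
      1 \<le> measure_pmf.expectation (bernoulli_pmf (Q e)) (\<lambda>v. g e v ^ k)"
  shows "measure_pmf.expectation (edge_pmf n P) (\<lambda>\<omega>. mtrace n (mpow n (symmat f \<omega>) m)) \<le>
    real n / real r * measure_pmf.expectation (edge_pmf r Q) (\<lambda>\<omega>. mtrace r (mpow r (symmat g \<omega>) m))"
proof -
  let ?E = "\<lambda>w. measure_pmf.expectation (edge_pmf n P) (\<lambda>\<omega>. walk_prod (symmat f \<omega>) m w)"
  let ?F = "\<lambda>w. measure_pmf.expectation (edge_pmf r Q) (\<lambda>\<omega>. walk_prod (symmat g \<omega>) m w)"
  have closed: "good_walk m w \<Longrightarrow> w 0 = w m" for w by (simp add: good_walk_def)
  have "measure_pmf.expectation (edge_pmf n P) (\<lambda>\<omega>. mtrace n (mpow n (symmat f \<omega>) m)) =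
      (\<Sum>w | w \<in> walks n m \<and> w 0 = w m. ?E w)"
    unfolding mtrace_mpow_eq_sum_walks by (rule Bochner_Integration.integral_sum) simp
  also have "\<dots> = (\<Sum>w | w \<in> walks n m \<and> good_walk m w. ?E w)"
    by (intro sum.mono_neutral_right ballI expectation_walk_prod_not_good mean) (auto dest: closed)
  also have "\<dots> \<le> (\<Sum>w | w \<in> walks n m \<and> good_walk m w. \<pi> ^ (card (w ` {..m}) - 1))"
    by (rule sum_mono, rule abs_le_D1, rule expectation_walk_prod_upper) (use \<pi> mom in auto)
  also have "\<dots> \<le> real n / real r * real (card {w \<in> walks r m. good_walk m w})"
    by (rule sum_good_walks_compare) fact+
  also have "\<dots> \<le> real n / real r * (\<Sum>w | w \<in> walks r m \<and> good_walk m w. ?F w)"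
  proof (rule mult_left_mono)
    have "real (card {w \<in> walks r m. good_walk m w}) = (\<Sum>w | w \<in> walks r m \<and> good_walk m w. 1)" by simp
    also have "\<dots> \<le> (\<Sum>w | w \<in> walks r m \<and> good_walk m w. ?F w)"
      by (intro sum_mono expectation_walk_prod_lower mom') auto
    finally show "real (card {w \<in> walks r m. good_walk m w}) \<le> (\<Sum>w | w \<in> walks r m \<and> good_walk m w. ?F w)" .
  qed simp
  also have "(\<Sum>w | w \<in> walks r m \<and> good_walk m w. ?F w) = (\<Sum>w | w \<in> walks r m \<and> w 0 = w m. ?F w)"
    by (intro sum.mono_neutral_left ballI expectation_walk_prod_not_good mean') (auto dest: closed)
  also have "\<dots> = measure_pmf.expectation (edge_pmf r Q) (\<lambda>\<omega>. mtrace r (mpow r (symmat g \<omega>) m))"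
    unfolding mtrace_mpow_eq_sum_walks by (rule Bochner_Integration.integral_sum[symmetric]) simp
  finally show ?thesis .
qed

section \<open>An integer net for the operator norm\<close>

text \<open>After scaling by 1 / (2 sqrt r) these integer points have norm at most sqrt 7 / 2 and
  approximate the unit ball within 1/4. The bound 7r leaves room for the rounding error; the box
  provides a finite product set over which to sum.\<close>

definition net :: "nat \<Rightarrow> (nat \<Rightarrow> int) set" where
  "net r = {u \<in> {..<r} \<rightarrow>\<^sub>E {- int (7 * r)..int (7 * r)}. (\<Sum>i<r. (u i)\<^sup>2) \<le> int (7 * r)}"

lemma finite_net [simp]: "finite (net r)"
  by (rule finite_subset[of _ "{..<r} \<rightarrow>\<^sub>E {- int (7 * r)..int (7 * r)}"]) (auto simp: net_def intro!: finite_PiE)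

lemma sum_half_power: "(\<Sum>j\<in>{- int M..int M}. (1 / 2 :: real) ^ nat \<bar>j\<bar>) = 3 - 2 * (1 / 2) ^ M"
proof (induction M)
  case (Suc M)
  have "{- int (Suc M)..int (Suc M)} = insert (- int (Suc M)) (insert (int (Suc M)) {- int M..int M})" by auto
  then show ?case using Suc by (simp add: nat_add_distrib)
qed simp

lemma abs_le_square_int: "\<bar>k :: int\<bar> \<le> k\<^sup>2"
proof (cases "k = 0")
  case False
  then have "\<bar>k\<bar> \<le> \<bar>k\<bar>\<^sup>2" by (intro self_le_power) auto
  then show ?thesis by simp
qed simp

text \<open>Generating-function bound: give \<open>u\<close> the weight 2^-(sum of |u_i|). Integers
  satisfy |k| <= k^2, so each net point weighs at least 2^-7r, while the weights over the whole box
  factorise into r two-sided geometric sums below 3. Thus 3 * 2^7 = 384 per coordinate.\<close>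

lemma card_net: "real (card (net r)) \<le> 384 ^ r"
proof -
  let ?B = "{- int (7 * r)..int (7 * r)}"
  have low: "(1 / 2) ^ (7 * r) \<le> (\<Prod>i<r. (1 / 2 :: real) ^ nat \<bar>u i\<bar>)" if "u \<in> net r" for u
  proof -
    have "int (\<Sum>i<r. nat \<bar>u i\<bar>) = (\<Sum>i<r. \<bar>u i\<bar>)" by simp
    also have "\<dots> \<le> (\<Sum>i<r. (u i)\<^sup>2)"
      by (intro sum_mono abs_le_square_int)
    also have "\<dots> \<le> int (7 * r)" using that by (simp add: net_def)
    finally have "(\<Sum>i<r. nat \<bar>u i\<bar>) \<le> 7 * r" by linarith
    then have "(1 / 2 :: real) ^ (7 * r) \<le> (1 / 2) ^ (\<Sum>i<r. nat \<bar>u i\<bar>)" by (intro power_decreasing) auto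
    then show ?thesis by (simp add: power_sum)
  qed
  have "real (card (net r)) * (1 / 2) ^ (7 * r) = (\<Sum>u\<in>net r. (1 / 2) ^ (7 * r))" by simp
  also have "\<dots> \<le> (\<Sum>u\<in>net r. \<Prod>i<r. (1 / 2 :: real) ^ nat \<bar>u i\<bar>)" by (rule sum_mono) (rule low)
  also have "\<dots> \<le> (\<Sum>u\<in>{..<r} \<rightarrow>\<^sub>E ?B. \<Prod>i<r. (1 / 2 :: real) ^ nat \<bar>u i\<bar>)"
    by (rule sum_mono2) (auto simp: net_def prod_nonneg intro!: finite_PiE)
  also have "\<dots> = (\<Prod>i<r. \<Sum>j\<in>?B. (1 / 2 :: real) ^ nat \<bar>j\<bar>)"
    by (rule prod_sum_PiE[symmetric]) auto
  also have "\<dots> \<le> (\<Prod>i<r. 3)"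
    by (intro prod_mono conjI sum_nonneg) (auto simp only: sum_half_power, auto)
  also have "\<dots> = 3 ^ r" by simp
  finally have "real (card (net r)) * (1 / 2) ^ (7 * r) * 2 ^ (7 * r) \<le> 3 ^ r * 2 ^ (7 * r)"
    by (intro mult_right_mono) auto
  also have "real (card (net r)) * (1 / 2) ^ (7 * r) * 2 ^ (7 * r) = real (card (net r))"
    by (simp add: power_one_over)
  also have "(3 :: real) ^ r * 2 ^ (7 * r) = (3 * 2 ^ 7) ^ r"
    by (simp only: power_mult power_mult_distrib)
  finally show ?thesis by simp
qed

lemma net_rounding:
  assumes r: "0 < r" and x: "sqn r x \<le> 1"
  obtains u where "u \<in> net r" "sqn r (\<lambda>i. x i - of_int (u i) / (2 * sqrt r)) \<le> 1 / 16"
proof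
  define c where "c = 2 * sqrt r"
  have c: "c > 0" "c\<^sup>2 = 4 * r" using r by (auto simp: c_def power_mult_distrib)
  define u where "u = restrict (\<lambda>i. round (c * x i)) {..<r}"
  have u: "u i = round (c * x i)" if "i < r" for i using that by (simp add: u_def)
  have err: "(c * x i - of_int (u i))\<^sup>2 \<le> 1 / 4" if "i < r" for i
  proof -
    have "\<bar>c * x i - of_int (u i)\<bar> \<le> 1 / 2"
      using of_int_round_abs_le[of "c * x i"] u[OF that] by (simp add: abs_minus_commute)
    then have "\<bar>c * x i - of_int (u i)\<bar>\<^sup>2 \<le> (1 / 2)\<^sup>2" by (intro power_mono) auto
    then show ?thesis by (simp add: power2_eq_square)
  qed
  have "(real_of_int (u i))\<^sup>2 \<le> 5 * r * (x i)\<^sup>2 + 5 / 4" if "i < r" for i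
  proof -
    let ?a = "c * x i" let ?b = "c * x i - of_int (u i)"
    \<comment> \<open>This square encodes (a - b)^2 <= (5/4) a^2 + 5 b^2. With the rounding error at
      most 1/2 it yields a total of at most 5r + (5/4) r, below 7r.\<close>
    have "0 \<le> (?a / 2 + 2 * ?b)\<^sup>2" by simp
    then have "(?a - ?b)\<^sup>2 \<le> (5 / 4) * ?a\<^sup>2 + 5 * ?b\<^sup>2"
      by (simp add: power2_eq_square algebra_simps)
    also have "\<dots> \<le> (5 / 4) * ?a\<^sup>2 + 5 * (1 / 4)" using err[OF that] by simp
    finally show ?thesis by (simp add: power_mult_distrib c(2))
  qed
  then have "(\<Sum>i<r. (real_of_int (u i))\<^sup>2) \<le> (\<Sum>i<r. 5 * r * (x i)\<^sup>2 + 5 / 4)" by (intro sum_mono) auto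
  also have "\<dots> = 5 * r * sqn r x + 5 / 4 * r" by (simp add: sum.distrib sqn_def sum_distrib_left)
  also have "\<dots> \<le> 7 * r" using mult_left_mono[OF x, of "real r"] by simp
  finally have "real_of_int (\<Sum>i<r. (u i)\<^sup>2) \<le> real_of_int (int (7 * r))" by simp
  then have sq: "(\<Sum>i<r. (u i)\<^sup>2) \<le> int (7 * r)" by linarith
  have "\<bar>u i\<bar> \<le> int (7 * r)" if "i < r" for i
  proof -
    have "\<bar>u i\<bar> \<le> (u i)\<^sup>2" by (rule abs_le_square_int)
    also have "\<dots> \<le> (\<Sum>i<r. (u i)\<^sup>2)" using that by (intro member_le_sum) auto
    finally show ?thesis using sq by simp
  qed
  then have "u i \<in> {- int (7 * r)..int (7 * r)}" if "i < r" for i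
    using that unfolding atLeastAtMost_iff by (meson abs_le_iff minus_le_iff)
  then show "u \<in> net r" using sq by (simp add: net_def PiE_iff) (simp add: u_def)
  have "sqn r (\<lambda>i. x i - of_int (u i) / c) = (\<Sum>i<r. (c * x i - of_int (u i))\<^sup>2 / c\<^sup>2)"
  proof -
    have "x i - of_int (u i) / c = (c * x i - of_int (u i)) / c" for i using c by (simp add: field_simps)
    then show ?thesis by (simp add: sqn_def power_divide)
  qed
  also have "\<dots> \<le> (\<Sum>i<r. (1 / 4) / c\<^sup>2)"
    using err by (intro sum_mono divide_right_mono) auto
  also have "\<dots> = 1 / 16" using r by (simp add: c)
  finally show "sqn r (\<lambda>i. x i - of_int (u i) / (2 * sqrt r)) \<le> 1 / 16" by (simp add: c_def)
qed

lemma bilin_add_left: "bilin n X (\<lambda>i. x i + x' i) y = bilin n X x y + bilin n X x' y"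
  by (simp add: bilin_def algebra_simps sum.distrib)

lemma bilin_add_right: "bilin n X x (\<lambda>i. y i + y' i) = bilin n X x y + bilin n X x y'"
  by (simp add: bilin_def algebra_simps sum.distrib)

lemma bilin_le_scaled:
  assumes \<sigma>: "\<And>x y. sqn n x \<le> 1 \<Longrightarrow> sqn n y \<le> 1 \<Longrightarrow> bilin n X x y \<le> \<sigma>"
    and x: "sqn n x \<le> c\<^sup>2" "0 < c" and y: "sqn n y \<le> d\<^sup>2" "0 < d"
  shows "bilin n X x y \<le> c * d * \<sigma>"
proof -
  have "sqn n (\<lambda>i. (1 / c) * x i) \<le> 1" "sqn n (\<lambda>i. (1 / d) * y i) \<le> 1"
    unfolding sqn_scale using x y by (simp_all add: power_divide)
  from \<sigma>[OF this] show ?thesis unfolding bilin_scale using x y by (simp add: field_simps)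
qed

text \<open>Let \<sigma> be the supremum over the unit balls. Writing x = u + e and y = v + f with
  net parts of norm at most 4/3 and errors of norm at most 1/4 gives \<sigma> <= N +
  (4/3)(1/4)\<sigma> + (1/4)\<sigma>, hence \<sigma> <= (12/5) N. The factor 4r undoes the scaling
  of the two net points.\<close>

lemma bilin_le_net:
  assumes r: "0 < r" and N: "\<And>u v. u \<in> net r \<Longrightarrow> v \<in> net r \<Longrightarrow> \<bar>bilin r X u v\<bar> \<le> 4 * r * N"
    and xy: "sqn r x \<le> 1" "sqn r y \<le> 1"
  shows "bilin r X x y \<le> 12 / 5 * N"
proof -
  define S where "S = {bilin r X x y | x y. sqn r x \<le> 1 \<and> sqn r y \<le> 1}"
  define \<sigma> where "\<sigma> = Sup S"
  \<comment> \<open>Finiteness of the supremum is what allows \<sigma> to be absorbed into the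
    left-hand side.\<close>
  have bdd: "bdd_above S"
  proof (rule bdd_aboveI)
    fix s assume "s \<in> S"
    then obtain x y where s: "s = bilin r X x y" and xy: "sqn r x \<le> 1" "sqn r y \<le> 1" by (auto simp: S_def)
    have le1: "\<bar>z i\<bar> \<le> 1" if "sqn r z \<le> 1" "i < r" for z i
    proof -
      have "(z i)\<^sup>2 \<le> sqn r z" unfolding sqn_def using that by (intro member_le_sum) auto
      then have "(z i)\<^sup>2 \<le> 1" using that by simp
      then show ?thesis by (simp add: abs_square_le_1)
    qed
    have "s \<le> (\<Sum>i<r. \<Sum>j<r. \<bar>x i * X i j * y j\<bar>)"
      unfolding s bilin_def by (intro sum_mono) auto
    also have "\<dots> \<le> (\<Sum>i<r. \<Sum>j<r. 1 * \<bar>X i j\<bar> * 1)"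
      unfolding abs_mult using le1[OF xy(1)] le1[OF xy(2)] by (intro sum_mono mult_mono) auto
    finally show "s \<le> (\<Sum>i<r. \<Sum>j<r. 1 * \<bar>X i j\<bar> * 1)" .
  qed
  have \<sigma>: "bilin r X x y \<le> \<sigma>" if "sqn r x \<le> 1" "sqn r y \<le> 1" for x y
    unfolding \<sigma>_def by (rule cSup_upper[OF _ bdd]) (use that in \<open>auto simp: S_def\<close>)
  have "bilin r X x y \<le> N + 7 / 12 * \<sigma>" if xy: "sqn r x \<le> 1" "sqn r y \<le> 1" for x y
  proof -
    define c where "c = 1 / (2 * sqrt r)"
    obtain u where u: "u \<in> net r" "sqn r (\<lambda>i. x i - of_int (u i) / (2 * sqrt r)) \<le> 1 / 16"
      using net_rounding[OF r xy(1)] .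
    obtain v where v: "v \<in> net r" "sqn r (\<lambda>i. y i - of_int (v i) / (2 * sqrt r)) \<le> 1 / 16"
      using net_rounding[OF r xy(2)] .
    let ?u = "\<lambda>i. c * of_int (u i)" let ?v = "\<lambda>i. c * of_int (v i)"
    let ?e = "\<lambda>i. x i - c * of_int (u i)" let ?f = "\<lambda>i. y i - c * of_int (v i)"
    have e: "sqn r ?e \<le> (1 / 4)\<^sup>2" and f: "sqn r ?f \<le> (1 / 4)\<^sup>2"
      using u(2) v(2) by (simp_all add: c_def power2_eq_square)
    have "real_of_int (\<Sum>i<r. (u i)\<^sup>2) \<le> real_of_int (int (7 * r))"
      using u(1) unfolding of_int_le_iff by (simp add: net_def)
    then have "sqn r u \<le> 7 * r" by (simp add: sqn_def)
    then have "sqn r ?u \<le> c\<^sup>2 * (7 * r)" unfolding sqn_scale by (intro mult_left_mono) auto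
    also have "\<dots> \<le> (4 / 3)\<^sup>2" using r by (simp add: c_def power_mult_distrib power_divide power2_eq_square[of "4/3::real"])
    finally have su: "sqn r ?u \<le> (4 / 3)\<^sup>2" .
    have "bilin r X x y = bilin r X (\<lambda>i. ?u i + ?e i) y" by simp
    also have "\<dots> = bilin r X ?u (\<lambda>i. ?v i + ?f i) + bilin r X ?e y" unfolding bilin_add_left by simp
    also have "\<dots> = bilin r X ?u ?v + bilin r X ?u ?f + bilin r X ?e y" unfolding bilin_add_right by simp
    also have "bilin r X ?u ?v \<le> N"
    proof -
      have "bilin r X ?u ?v = c * c * bilin r X u v" by (rule bilin_scale)
      also have "\<dots> \<le> c * c * (4 * r * N)"
        using N[OF u(1) v(1)] by (intro mult_left_mono) (auto simp: c_def)
      also have "\<dots> = N" using r by (simp add: c_def)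
      finally show ?thesis .
    qed
    also have "bilin r X ?u ?f \<le> 4 / 3 * (1 / 4) * \<sigma>"
      by (rule bilin_le_scaled[OF \<sigma> su _ f]) auto
    also have "bilin r X ?e y \<le> 1 / 4 * 1 * \<sigma>"
      by (rule bilin_le_scaled[OF \<sigma> e]) (use xy in auto)
    finally show ?thesis by simp
  qed
  then have "\<sigma> \<le> N + 7 / 12 * \<sigma>"
    unfolding \<sigma>_def using xy by (intro cSup_least) (auto simp: S_def)
  then show ?thesis using \<sigma>[OF xy] by simp
qed

lemma sqn_apply_le:
  assumes \<sigma>: "\<And>x y. sqn n x \<le> 1 \<Longrightarrow> sqn n y \<le> 1 \<Longrightarrow> bilin n X x y \<le> \<sigma>"
  shows "sqn n (\<lambda>i. \<Sum>j<n. X i j * z j) \<le> \<sigma>\<^sup>2 * sqn n z"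
proof -
  let ?y = "\<lambda>i. \<Sum>j<n. X i j * z j"
  have bil: "bilin n X ?y z = sqn n ?y"
    by (simp add: bilin_def sqn_def power2_eq_square sum_distrib_left mult_ac)
  have "0 \<le> \<sigma>" using \<sigma>[of "\<lambda>_. 0" "\<lambda>_. 0"] by (simp add: sqn_def bilin_def)
  show ?thesis
  proof (cases "sqn n ?y = 0 \<or> sqn n z = 0")
    case True
    then show ?thesis
    proof
      assume "sqn n z = 0"
      then have "sqn n ?y = 0" by (auto simp: sqn_eq_0)
      then show ?thesis by simp
    qed simp
  next
    case False
    then have pos: "sqn n ?y > 0" "sqn n z > 0" by (auto simp: less_le)
    have "sqn n ?y \<le> sqrt (sqn n ?y) * sqrt (sqn n z) * \<sigma>"
      unfolding bil[symmetric] by (rule bilin_le_scaled[OF \<sigma>]) (use pos bil in auto)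
    then have "sqrt (sqn n ?y) * sqrt (sqn n ?y) \<le> sqrt (sqn n ?y) * (sqrt (sqn n z) * \<sigma>)"
      by (simp add: mult.assoc)
    then have "sqrt (sqn n ?y) \<le> sqrt (sqn n z) * \<sigma>"
      using pos by (subst (asm) mult_le_cancel_left_pos) auto
    then have "(sqrt (sqn n ?y))\<^sup>2 \<le> (sqrt (sqn n z) * \<sigma>)\<^sup>2" by (intro power_mono) auto
    then show ?thesis by (simp add: power_mult_distrib mult.commute)
  qed
qed

text \<open>The trace is the sum over j of |X^h e_j|^2, and each application of X multiplies the
  squared norm by at most \<sigma>^2.\<close>

lemma mtrace_mpow_le:
  assumes sym: "\<And>i j. i < n \<Longrightarrow> j < n \<Longrightarrow> X i j = X j i"
    and \<sigma>: "\<And>x y. sqn n x \<le> 1 \<Longrightarrow> sqn n y \<le> 1 \<Longrightarrow> bilin n X x y \<le> \<sigma>"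
  shows "mtrace n (mpow n X (2 * h)) \<le> n * \<sigma> ^ (2 * h)"
proof -
  have "sqn n (\<lambda>l. mpow n X h l j) \<le> \<sigma> ^ (2 * h)" if j: "j < n" for j
  proof (induction h)
    case 0
    then show ?case using j by (simp add: sqn_def if_distrib[of "\<lambda>c. c\<^sup>2"] cong: if_cong)
  next
    case (Suc h)
    have "mpow n X (Suc h) l j = (\<Sum>k<n. X l k * mpow n X h k j)" if "l < n" for l
      using mpow_add[OF j, of X "Suc 0" h l] that by (simp add: mpow_one del: mpow.simps)
    then have "sqn n (\<lambda>l. mpow n X (Suc h) l j) = sqn n (\<lambda>l. \<Sum>k<n. X l k * mpow n X h k j)"
      unfolding sqn_def by (intro sum.cong refl) auto
    also have "\<dots> \<le> \<sigma>\<^sup>2 * sqn n (\<lambda>k. mpow n X h k j)" by (rule sqn_apply_le[OF \<sigma>])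
    also have "\<dots> \<le> \<sigma>\<^sup>2 * \<sigma> ^ (2 * h)" using Suc by (intro mult_left_mono) auto
    also have "\<dots> = \<sigma> ^ (2 * Suc h)" by (simp add: power_add[symmetric])
    finally show ?case .
  qed
  then have "(\<Sum>j<n. sqn n (\<lambda>l. mpow n X h l j)) \<le> (\<Sum>j<n. \<sigma> ^ (2 * h))" by (intro sum_mono) auto
  also have "(\<Sum>j<n. sqn n (\<lambda>l. mpow n X h l j)) = mtrace n (mpow n X (2 * h))"
    unfolding sqn_def using mtrace_mpow_double[of n X h] sym by simp
  finally show ?thesis by simp
qed

text \<open>The maximum over pairs of net points is replaced by a sum, so that the expectation can
  be taken term by term; this is the union bound at the level of moments.\<close>

lemma mtrace_mpow_le_net:
  assumes r: "0 < r" and sym: "\<And>i j. i < r \<Longrightarrow> j < r \<Longrightarrow> X i j = X j i"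
  shows "mtrace r (mpow r X (2 * k)) \<le>
    r * (12 / 5) ^ (2 * k) * (\<Sum>u\<in>net r. \<Sum>v\<in>net r. (bilin r X u v / (4 * real r)) ^ (2 * k))"
proof -
  define F where "F = (\<lambda>(u :: nat \<Rightarrow> int, v :: nat \<Rightarrow> int). \<bar>bilin r X u v / (4 * real r)\<bar>)"
  define N where "N = Max (F ` (net r \<times> net r))"
  have "sqn r (\<lambda>_. 0) \<le> 1" by (simp add: sqn_def)
  from net_rounding[OF r this] obtain u0 where u0: "u0 \<in> net r" by blast
  have fin: "finite (F ` (net r \<times> net r))" by simp
  have "N \<in> F ` (net r \<times> net r)"
    unfolding N_def using u0 by (intro Max_in fin) auto
  then obtain u v where uv: "u \<in> net r" "v \<in> net r" "N = F (u, v)" by auto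
  have "\<bar>bilin r X u v\<bar> \<le> 4 * real r * N" if "u \<in> net r" "v \<in> net r" for u v
  proof -
    have "F (u, v) \<le> N" unfolding N_def using that by (intro Max_ge fin) auto
    then show ?thesis using r by (simp add: F_def abs_divide field_simps)
  qed
  then have "bilin r X x y \<le> 12 / 5 * N" if "sqn r x \<le> 1" "sqn r y \<le> 1" for x y
    using bilin_le_net[OF r] that by blast
  then have "mtrace r (mpow r X (2 * k)) \<le> r * (12 / 5 * N) ^ (2 * k)"
    using sym by (intro mtrace_mpow_le) auto
  also have "\<dots> = r * (12 / 5) ^ (2 * k) * N ^ (2 * k)" by (simp only: power_mult_distrib mult.assoc)
  also have "N ^ (2 * k) = (bilin r X u v / (4 * real r)) ^ (2 * k)"
    by (simp add: uv F_def power_mult power_divide)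
  also have "\<dots> \<le> (\<Sum>v\<in>net r. (bilin r X u v / (4 * real r)) ^ (2 * k))"
    by (rule member_le_sum) (use uv in \<open>auto simp: power_mult\<close>)
  also have "\<dots> \<le> (\<Sum>u\<in>net r. \<Sum>v\<in>net r. (bilin r X u v / (4 * real r)) ^ (2 * k))"
  proof -
    define G where "G u = (\<Sum>v\<in>net r. (bilin r X u v / (4 * real r)) ^ (2 * k))" for u :: "nat \<Rightarrow> int"
    have "G u \<le> sum G (net r)"
      by (rule member_le_sum) (use uv in \<open>auto simp: G_def power_mult intro!: sum_nonneg\<close>)
    then show ?thesis by (simp add: G_def)
  qed
  finally show ?thesis by (simp add: mult_left_mono)
qed

section \<open>Trace moments of the dense comparison matrix\<close>

lemma sum_pairs:
  fixes F :: "nat \<Rightarrow> nat \<Rightarrow> real"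
  shows "(\<Sum>i<n. \<Sum>j<n. F i j) = (\<Sum>(i, j)\<in>pairs n. F i j + F j i) + (\<Sum>i<n. F i i)"
proof -
  let ?D = "(\<lambda>i. (i, i)) ` {..<n}" and ?L = "prod.swap ` pairs n"
  have "(\<Sum>i<n. \<Sum>j<n. F i j) = (\<Sum>(i, j)\<in>{..<n} \<times> {..<n}. F i j)"
    by (rule sum.cartesian_product)
  also have "{..<n} \<times> {..<n} = pairs n \<union> (?L \<union> ?D)"
    by (auto simp: pairs_def image_iff)
  also have "(\<Sum>(i, j)\<in>pairs n \<union> (?L \<union> ?D). F i j) =
      (\<Sum>(i, j)\<in>pairs n. F i j) + ((\<Sum>(i, j)\<in>?L. F i j) + (\<Sum>(i, j)\<in>?D. F i j))"
    by (subst sum.union_disjoint, simp, simp, fastforce simp: pairs_def,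
        subst sum.union_disjoint, simp, simp, fastforce simp: pairs_def, rule refl)
  also have "(\<Sum>(i, j)\<in>?L. F i j) = (\<Sum>(i, j)\<in>pairs n. F j i)"
    by (subst sum.reindex) (auto simp: case_prod_unfold intro!: sum.cong inj_onI)
  also have "(\<Sum>(i, j)\<in>?D. F i j) = (\<Sum>i<n. F i i)"
    by (subst sum.reindex) (auto intro: inj_onI)
  finally show ?thesis by (simp add: sum.distrib case_prod_unfold)
qed

lemma bilin_symmat:
  "bilin n (symmat f \<omega>) x y = (\<Sum>e\<in>pairs n. f e (\<omega> e) * (x (fst e) * y (snd e) + x (snd e) * y (fst e)))"
  unfolding bilin_def sum_pairs
  by (simp add: symmat_def) (intro sum.cong refl, auto simp: symmat_def pairs_def algebra_simps)

text \<open>Under probability 1/3 this is centred and all its moments of order at least 2 are at least 1,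
  which is exactly what the comparison of trace moments requires of the dense matrix.\<close>

definition twopt :: "bool \<Rightarrow> real" where
  "twopt v = (if v then 2 else -1)"

lemma twopt_moment:
  assumes "2 \<le> k"
  shows "1 \<le> measure_pmf.expectation (bernoulli_pmf (1 / 3)) (\<lambda>v. twopt v ^ k)"
proof (cases "k = 2")
  case False
  then have "(2 :: real) ^ 3 \<le> 2 ^ k" using assms by (intro power_increasing) auto
  moreover have "- 1 \<le> (- 1 :: real) ^ k" by (cases "even k") auto
  ultimately show ?thesis by (simp add: twopt_def)
qed (simp add: twopt_def)

text \<open>Hoeffding's lemma for a range of length 3, whence 3^2 / 8. The auxiliary inequality is
  applied with a nonnegative argument only, so for negative t the two atoms exchange roles, with
  weight 2/3 in place of 1/3.\<close>

lemma twopt_mgf: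
  "measure_pmf.expectation (bernoulli_pmf (1 / 3)) (\<lambda>v. exp (t * twopt v)) \<le> exp (9 / 8 * t\<^sup>2)"
proof (cases "0 \<le> t")
  case True
  have pos: "0 < 1 + 1 / 3 * (exp (3 * t) - 1)" by (simp add: add_pos_pos field_simps)
  have "exp (- (3 * t) * (1 / 3) + ln (1 + 1 / 3 * (exp (3 * t) - 1))) \<le> exp ((3 * t)\<^sup>2 / 8)"
    using Hoeffdings_lemma_aux[of "3 * t" "1 / 3"] True by simp
  also have "exp (- (3 * t) * (1 / 3) + ln (1 + 1 / 3 * (exp (3 * t) - 1))) =
      exp (- t) * (1 + 1 / 3 * (exp (3 * t) - 1))"
    unfolding exp_add using pos by simp
  also have "\<dots> = exp (- t) * (2 / 3) + exp (- t + 3 * t) / 3"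
    unfolding exp_add by (simp add: algebra_simps)
  finally show ?thesis by (simp add: twopt_def power_mult_distrib mult.commute)
next
  case False
  have pos: "0 < 1 + 2 / 3 * (exp (- (3 * t)) - 1)" by (simp add: add_pos_pos field_simps)
  have "exp (- (- (3 * t)) * (2 / 3) + ln (1 + 2 / 3 * (exp (- (3 * t)) - 1))) \<le> exp ((- (3 * t))\<^sup>2 / 8)"
    using Hoeffdings_lemma_aux[of "- (3 * t)" "2 / 3"] False by simp
  also have "exp (- (- (3 * t)) * (2 / 3) + ln (1 + 2 / 3 * (exp (- (3 * t)) - 1))) =
      exp (2 * t) * (1 + 2 / 3 * (exp (- (3 * t)) - 1))"
    unfolding exp_add using pos by simp
  also have "\<dots> = exp (2 * t) / 3 + exp (2 * t + - (3 * t)) * 2 / 3"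
    unfolding exp_add by (simp add: algebra_simps)
  finally show ?thesis by (simp add: twopt_def power_mult_distrib mult.commute)
qed

section \<open>Even moments of subgaussian sums\<close>

lemma power_le_fact_mult_exp:
  fixes x :: real
  assumes "0 \<le> x"
  shows "x ^ k \<le> fact k * exp x"
proof -
  have "(\<Sum>i\<in>{k}. x ^ i /\<^sub>R fact i) \<le> (\<Sum>i. x ^ i /\<^sub>R fact i)"
    using assms by (intro sum_le_suminf summable_exp_generic) auto
  then show ?thesis by (simp add: exp_def field_simps scaleR_conv_of_real)
qed

lemma even_power_le_fact_mult_exp:
  fixes x :: real
  shows "x ^ (2 * k) \<le> fact (2 * k) * (exp x + exp (- x))"
proof -
  have "x ^ (2 * k) = \<bar>x\<bar> ^ (2 * k)" by (simp add: power_mult)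
  also have "\<dots> \<le> fact (2 * k) * exp \<bar>x\<bar>" by (rule power_le_fact_mult_exp) simp
  also have "\<dots> \<le> fact (2 * k) * (exp x + exp (- x))"
    by (intro mult_left_mono) (auto simp: abs_if)
  finally show ?thesis .
qed

text \<open>The moment generating function is used at t = sqrt k and -sqrt k. Then (2k)! <= (2k)^2k
  costs 4^k k^2k, of which k^k is paid back by the scaling; the moment grows like (const * k)^k, as
  for a Gaussian.\<close>

lemma subgaussian_even_moment:
  fixes S :: "'a \<Rightarrow> real"
  assumes int: "\<And>g :: 'a \<Rightarrow> real. integrable (measure_pmf p) g"
    and mgf: "\<And>t. measure_pmf.expectation p (\<lambda>\<omega>. exp (t * S \<omega>)) \<le> exp (c * t\<^sup>2)" and k: "0 < k"
  shows "measure_pmf.expectation p (\<lambda>\<omega>. S \<omega> ^ (2 * k)) \<le> 2 * (4 * exp c * k) ^ k"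
proof -
  let ?t = "sqrt k"
  have kk: "(real k) ^ k > 0" using k by simp
  have "(real k) ^ k * measure_pmf.expectation p (\<lambda>\<omega>. S \<omega> ^ (2 * k)) =
      measure_pmf.expectation p (\<lambda>\<omega>. (?t * S \<omega>) ^ (2 * k))"
    by (simp add: power_mult_distrib power_mult)
  also have "\<dots> \<le> measure_pmf.expectation p (\<lambda>\<omega>. fact (2 * k) * (exp (?t * S \<omega>) + exp ((- ?t) * S \<omega>)))"
    using even_power_le_fact_mult_exp by (intro integral_mono int) auto
  also have "\<dots> = fact (2 * k) * (measure_pmf.expectation p (\<lambda>\<omega>. exp (?t * S \<omega>)) +
      measure_pmf.expectation p (\<lambda>\<omega>. exp ((- ?t) * S \<omega>)))"
    by (subst integral_mult_right_zero, subst Bochner_Integration.integral_add) (auto intro: int)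
  also have "\<dots> \<le> fact (2 * k) * (exp (c * k) + exp (c * k))"
    using mgf[of ?t] mgf[of "- ?t"] by (intro mult_left_mono add_mono) auto
  also have "\<dots> \<le> (2 * real k) ^ (2 * k) * (2 * exp c ^ k)"
    using fact_le_power[of "2 * k", where 'a = real]
    by (intro mult_mono) (auto simp: exp_of_nat2_mult)
  also have "\<dots> = (real k) ^ k * (2 * (4 * exp c * k) ^ k)"
  proof -
    have "(2 * real k) ^ (2 * k) = (4 * (real k * real k)) ^ k" by (simp add: power_mult power2_eq_square)
    then show ?thesis by (simp add: power_mult_distrib mult_ac)
  qed
  finally show ?thesis using kk by (rule mult_left_le_imp_le)
qed

lemma twopt_bilin_mgf:
  assumes r: "0 < r" and u: "sqn r u \<le> 7 * r" "sqn r v \<le> 7 * r"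
  shows "measure_pmf.expectation (edge_pmf r (\<lambda>_. 1 / 3))
    (\<lambda>\<omega>. exp (t * (bilin r (symmat (\<lambda>_. twopt) \<omega>) u v / (4 * real r)))) \<le> exp (7 * t\<^sup>2)"
proof -
  define c where "c e = (u (fst e) * v (snd e) + u (snd e) * v (fst e)) / (4 * real r)" for e
  have "(\<Sum>e\<in>pairs r. (c e)\<^sup>2) \<le> (\<Sum>(i, j)\<in>pairs r. (2 * (u i)\<^sup>2 * (v j)\<^sup>2 + 2 * (u j)\<^sup>2 * (v i)\<^sup>2) / (4 * real r)\<^sup>2)"
  proof (rule sum_mono, clarify)
    fix i j
    have "0 \<le> (u i * v j - u j * v i)\<^sup>2" by simp
    then have "(u i * v j + u j * v i)\<^sup>2 \<le> 2 * (u i)\<^sup>2 * (v j)\<^sup>2 + 2 * (u j)\<^sup>2 * (v i)\<^sup>2"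
      by (simp add: power2_eq_square algebra_simps)
    then show "(c (i, j))\<^sup>2 \<le> (2 * (u i)\<^sup>2 * (v j)\<^sup>2 + 2 * (u j)\<^sup>2 * (v i)\<^sup>2) / (4 * real r)\<^sup>2"
      unfolding c_def power_divide by (intro divide_right_mono) auto
  qed
  also have "\<dots> = (\<Sum>(i, j)\<in>pairs r. 2 * (u i)\<^sup>2 * (v j)\<^sup>2 + 2 * (u j)\<^sup>2 * (v i)\<^sup>2) / (4 * real r)\<^sup>2"
    by (simp add: sum_divide_distrib case_prod_unfold)
  also have "\<dots> \<le> (\<Sum>i<r. \<Sum>j<r. 2 * (u i)\<^sup>2 * (v j)\<^sup>2) / (4 * real r)\<^sup>2"
    unfolding sum_pairs[of "\<lambda>i j. 2 * (u i)\<^sup>2 * (v j)\<^sup>2"]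
    by (intro divide_right_mono) (auto intro!: sum_nonneg)
  also have "(\<Sum>i<r. \<Sum>j<r. 2 * (u i)\<^sup>2 * (v j)\<^sup>2) = 2 * (sqn r u * sqn r v)"
    unfolding sqn_def sum_product by (simp add: sum_distrib_left mult.assoc)
  also have "2 * (sqn r u * sqn r v) / (4 * real r)\<^sup>2 \<le> 2 * ((7 * r) * (7 * r)) / (4 * real r)\<^sup>2"
    using mult_mono[OF u] by (intro divide_right_mono mult_left_mono) auto
  \<comment> \<open>The left side is 98/16; the slightly larger 56/9 turns the final exponent 9/8 *
    56/9 into exactly 7.\<close>
  also have "\<dots> \<le> 56 / 9" using r by (simp add: power2_eq_square field_simps)
  finally have c: "(\<Sum>e\<in>pairs r. (c e)\<^sup>2) \<le> 56 / 9" .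
  have "bilin r (symmat (\<lambda>_. twopt) \<omega>) u v / (4 * real r) = (\<Sum>e\<in>pairs r. twopt (\<omega> e) * c e)" for \<omega>
    by (simp add: bilin_symmat c_def sum_divide_distrib)
  then have "exp (t * (bilin r (symmat (\<lambda>_. twopt) \<omega>) u v / (4 * real r))) =
      (\<Prod>e\<in>pairs r. exp (t * c e * twopt (\<omega> e)))" for \<omega>
    by (simp add: exp_sum[symmetric] sum_distrib_left mult_ac)
  then have "measure_pmf.expectation (edge_pmf r (\<lambda>_. 1 / 3))
      (\<lambda>\<omega>. exp (t * (bilin r (symmat (\<lambda>_. twopt) \<omega>) u v / (4 * real r)))) =
      (\<Prod>e\<in>pairs r. measure_pmf.expectation (bernoulli_pmf (1 / 3)) (\<lambda>b. exp (t * c e * twopt b)))"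
    by (simp only: expectation_prod_edge_pmf[where g = "\<lambda>e b. exp (t * c e * twopt b)"])
  also have "\<dots> \<le> (\<Prod>e\<in>pairs r. exp (9 / 8 * (t * c e)\<^sup>2))"
    by (intro prod_mono conjI twopt_mgf integral_nonneg) auto
  also have "\<dots> = exp (9 / 8 * t\<^sup>2 * (\<Sum>e\<in>pairs r. (c e)\<^sup>2))"
    by (simp add: exp_sum[symmetric] sum_distrib_left power_mult_distrib mult_ac)
  also have "\<dots> \<le> exp (9 / 8 * t\<^sup>2 * (56 / 9))"
    using c by (intro iffD2[OF exp_le_cancel_iff] mult_left_mono) auto
  finally show ?thesis by simp
qed

lemma expectation_mtrace_twopt:
  assumes r: "0 < r" and k: "0 < k"
  shows "measure_pmf.expectation (edge_pmf r (\<lambda>_. 1 / 3)) (\<lambda>\<omega>. mtrace r (mpow r (symmat (\<lambda>_. twopt) \<omega>) (2 * k)))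
    \<le> r * (12 / 5) ^ (2 * k) * (384 ^ (2 * r) * (2 * (4 * exp 7 * k) ^ k))"
proof -
  let ?E = "measure_pmf.expectation (edge_pmf r (\<lambda>_. 1 / 3))"
  let ?X = "symmat (\<lambda>_. twopt)"
  let ?B = "\<lambda>u v \<omega>. bilin r (?X \<omega>) (\<lambda>i. of_int (u i)) (\<lambda>i. of_int (v i)) / (4 * real r)"
  have sq: "sqn r (\<lambda>i. of_int (u i)) \<le> 7 * r" if "u \<in> net r" for u
  proof -
    have "real_of_int (\<Sum>i<r. (u i)\<^sup>2) \<le> real_of_int (int (7 * r))"
      using that unfolding of_int_le_iff by (simp add: net_def)
    then show ?thesis by (simp add: sqn_def)
  qed
  have "?E (\<lambda>\<omega>. mtrace r (mpow r (?X \<omega>) (2 * k))) \<le>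
      ?E (\<lambda>\<omega>. r * (12 / 5) ^ (2 * k) * (\<Sum>u\<in>net r. \<Sum>v\<in>net r. ?B u v \<omega> ^ (2 * k)))"
  proof (rule integral_mono)
    fix \<omega>
    show "mtrace r (mpow r (?X \<omega>) (2 * k)) \<le>
        r * (12 / 5) ^ (2 * k) * (\<Sum>u\<in>net r. \<Sum>v\<in>net r. ?B u v \<omega> ^ (2 * k))"
      by (rule mtrace_mpow_le_net[OF r]) (rule symmat_sym)
  qed (rule integrable_edge_pmf)+
  also have "\<dots> = r * (12 / 5) ^ (2 * k) * (\<Sum>u\<in>net r. \<Sum>v\<in>net r. ?E (\<lambda>\<omega>. ?B u v \<omega> ^ (2 * k)))"
    by (simp only: integral_mult_right_zero Bochner_Integration.integral_sum integrable_edge_pmf)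
  also have "\<dots> \<le> r * (12 / 5) ^ (2 * k) * (\<Sum>u\<in>net r. \<Sum>v\<in>net r. 2 * (4 * exp 7 * k) ^ k)"
  proof (intro mult_left_mono sum_mono)
    fix u v assume "u \<in> net r" "v \<in> net r"
    then have "?E (\<lambda>\<omega>. exp (t * ?B u v \<omega>)) \<le> exp (7 * t\<^sup>2)" for t
      by (intro twopt_bilin_mgf r sq)
    then show "?E (\<lambda>\<omega>. ?B u v \<omega> ^ (2 * k)) \<le> 2 * (4 * exp 7 * k) ^ k"
      by (intro subgaussian_even_moment integrable_edge_pmf k)
  qed simp
  also have "\<dots> = r * (12 / 5) ^ (2 * k) * ((real (card (net r)) * real (card (net r))) * (2 * (4 * exp 7 * k) ^ k))"
    by simp
  also have "\<dots> \<le> r * (12 / 5) ^ (2 * k) * ((384 ^ r * 384 ^ r) * (2 * (4 * exp 7 * k) ^ k))"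
    using mult_mono[OF card_net[of r] card_net[of r]]
    by (intro mult_left_mono mult_right_mono) auto
  finally show ?thesis by (simp only: mult_2[of r] power_add)
qed

section \<open>The spectral norm of a centred adjacency matrix\<close>

text \<open>With l = k - 1 the moment is at most p(1 - p)((1 - p)^l + p^l) in absolute value, and
  the last bracket is at most 1: no higher moment exceeds the order of the variance.\<close>

lemma centered_bernoulli_moment:
  assumes p: "0 \<le> p" "p \<le> 1" and k: "2 \<le> k"
  shows "\<bar>measure_pmf.expectation (bernoulli_pmf p) (\<lambda>v. (of_bool v - p) ^ k)\<bar> \<le> p"
proof -
  obtain l where l: "k = Suc l" "1 \<le> l" using k by (cases k) auto
  have "\<bar>measure_pmf.expectation (bernoulli_pmf p) (\<lambda>v. (of_bool v - p) ^ k)\<bar> =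
      \<bar>(1 - p) ^ k * p + (- p) ^ k * (1 - p)\<bar>" using p by simp
  also have "\<dots> \<le> (1 - p) ^ k * p + p ^ k * (1 - p)"
    using p by (intro order_trans[OF abs_triangle_ineq]) (auto simp: abs_mult power_abs)
  also have "\<dots> = p * (1 - p) * ((1 - p) ^ l + p ^ l)" by (simp add: l algebra_simps)
  also have "\<dots> \<le> p * (1 - p) * ((1 - p) ^ 1 + p ^ 1)"
    using p l by (intro mult_left_mono add_mono power_decreasing) auto
  also have "\<dots> \<le> p * 1" using p by (simp add: mult_left_le)
  finally show ?thesis by simp
qed

lemma expectation_mtrace_centered:
  assumes k: "0 < k" "real n * \<pi> + k \<le> r" and \<pi>: "\<pi> \<le> 1"
    and P: "\<And>e. e \<in> pairs n \<Longrightarrow> 0 \<le> P e \<and> P e \<le> \<pi>" "0 \<le> \<pi>"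
  shows "measure_pmf.expectation (edge_pmf n P)
      (\<lambda>\<omega>. mtrace n (mpow n (symmat (\<lambda>e v. of_bool v - P e) \<omega>) (2 * k)))
    \<le> 2 * real n * ((12 / 5) ^ (2 * k) * 384 ^ (2 * r) * (4 * exp 7 * k) ^ k)"
proof -
  have "0 \<le> real n * \<pi>" using P by simp
  with k have r: "0 < r" by linarith
  have "measure_pmf.expectation (edge_pmf n P)
      (\<lambda>\<omega>. mtrace n (mpow n (symmat (\<lambda>e v. of_bool v - P e) \<omega>) (2 * k))) \<le>
      real n / real r * measure_pmf.expectation (edge_pmf r (\<lambda>_. 1 / 3))
        (\<lambda>\<omega>. mtrace r (mpow r (symmat (\<lambda>_. twopt) \<omega>) (2 * k)))"
  proof (rule expectation_mtrace_compare[OF r _ P(2) \<pi> refl])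
    fix e assume e: "e \<in> pairs n"
    have p: "0 \<le> P e" "P e \<le> 1" using P(1)[OF e] \<pi> by auto
    show "measure_pmf.expectation (bernoulli_pmf (P e)) (\<lambda>v. of_bool v - P e) = 0"
      using p by (simp add: algebra_simps)
    show "\<bar>measure_pmf.expectation (bernoulli_pmf (P e)) (\<lambda>v. (of_bool v - P e) ^ k)\<bar> \<le> \<pi>" if "2 \<le> k" for k
      using centered_bernoulli_moment[OF p that] P(1)[OF e] by linarith
  qed (use k twopt_moment in \<open>auto simp: twopt_def\<close>)
  also have "\<dots> \<le> real n / real r * (r * (12 / 5) ^ (2 * k) * (384 ^ (2 * r) * (2 * (4 * exp 7 * k) ^ k)))"
    by (intro mult_left_mono expectation_mtrace_twopt r k) auto
  also have "\<dots> = 2 * real n * ((12 / 5) ^ (2 * k) * 384 ^ (2 * r) * (4 * exp 7 * k) ^ k)"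
    using r by simp
  finally show ?thesis .
qed

text \<open>Needed because the passage from trace to norm works only for exponents that are powers
  of two.\<close>

lemma ex_power_two_between:
  fixes x :: real
  assumes "1 \<le> x"
  obtains s :: nat where "x \<le> 2 ^ s" "2 ^ s \<le> 2 * x"
proof -
  obtain m :: nat where m: "x < 2 ^ m" using real_arch_pow[of 2 x] by auto
  define s where "s = (LEAST s. x \<le> 2 ^ s)"
  have s: "x \<le> 2 ^ s" unfolding s_def by (rule LeastI[of _ m]) (use m in simp)
  have "2 ^ s \<le> 2 * x"
  proof (cases s)
    case (Suc t)
    then have "\<not> x \<le> 2 ^ t" using not_less_Least[of t "\<lambda>s. x \<le> 2 ^ s"] by (simp add: s_def)
    then show ?thesis by (simp add: Suc)
  qed (use assms in simp)
  with s that show ?thesis by blast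
qed

text \<open>Markov's inequality for the trace moment of order 2k, with k a power of two between ln n
  and 2 ln n. The comparison dimension is at most (a + 2) k, so the squared cardinality of the net
  is itself a constant to the power k.\<close>

lemma spectral_bound:
  fixes a :: real
  assumes a: "0 < a"
  obtains C where "0 < C" "\<And>n P. 3 \<le> n \<Longrightarrow> a * ln n / n \<le> 1 \<Longrightarrow>
    (\<And>e. e \<in> pairs n \<Longrightarrow> 0 \<le> P e \<and> P e \<le> a * ln n / n) \<Longrightarrow>
    measure_pmf.prob (edge_pmf n P)
      {\<omega>. \<exists>x. \<bar>bilin n (symmat (\<lambda>e v. of_bool v - P e) \<omega>) x x\<bar> > C * sqrt (ln n) * sqn n x} \<le> 2 * real n powr (-3)"
proof -
  \<comment> \<open>\<open>G\<close> collects every base that is raised to the power k: the net loss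
    (12/5)^2, the net cardinalities, and the subgaussian moment constant. In \<open>C\<close>, the
    factor 2 comes from k <= 2 ln n and exp 4 from the Markov threshold.\<close>
  define G where "G = (12 / 5)\<^sup>2 * 384 powr (2 * (a + 2)) * (4 * exp 7)"
  define C where "C = sqrt (2 * G * exp 4)"
  have G: "G > 0" by (simp add: G_def)
  show thesis
  proof (rule that)
    show "0 < C" using G by (simp add: C_def)
    fix n :: nat and P
    assume n: "3 \<le> n" and p1: "a * ln n / n \<le> 1"
      and P: "\<And>e. e \<in> pairs n \<Longrightarrow> 0 \<le> P e \<and> P e \<le> a * ln n / n"
    have "exp 1 \<le> real n" using exp_le n by linarith
    then have ln1: "1 \<le> ln n" using n by (subst ln_ge_iff) auto
    from ex_power_two_between[OF ln1] obtain s where s: "ln n \<le> 2 ^ s" "2 ^ s \<le> 2 * ln n" .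
    define k :: nat where "k = 2 ^ s"
    define r where "r = nat \<lceil>a * ln n\<rceil> + k"
    have k: "0 < k" "ln n \<le> k" "k \<le> 2 * ln n" using s by (auto simp: k_def)
    have al: "0 \<le> a * ln n" using a ln1 by simp
    have r1: "real n * (a * ln n / n) + k \<le> r" using n al by (simp add: r_def)
    have "real r \<le> a * ln n + 1 + k" using al by (simp add: r_def)
    also have "\<dots> \<le> a * k + k + k"
      using a k ln1 by (intro add_mono mult_left_mono) auto
    finally have r2: "real r \<le> (a + 2) * k" by (simp add: algebra_simps)
    let ?W = "symmat (\<lambda>e v. of_bool v - P e)"
    let ?T = "\<lambda>\<omega>. mtrace n (mpow n (?W \<omega>) (2 * k))"
    have "384 ^ (2 * r) = 384 powr (2 * real r)" by (simp add: powr_realpow[symmetric])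
    also have "\<dots> \<le> 384 powr (2 * (a + 2) * k)" using r2 by (intro powr_mono) (auto simp: algebra_simps)
    also have "\<dots> = (384 powr (2 * (a + 2))) ^ k" by (simp add: powr_powr[symmetric] powr_realpow)
    finally have r3: "384 ^ (2 * r) \<le> (384 powr (2 * (a + 2))) ^ k" .
    have "measure_pmf.expectation (edge_pmf n P) ?T \<le>
        2 * real n * ((12 / 5) ^ (2 * k) * 384 ^ (2 * r) * (4 * exp 7 * k) ^ k)"
      by (rule expectation_mtrace_centered[OF k(1) r1 p1 P]) (use al in auto)
    also have "\<dots> \<le> 2 * real n * ((12 / 5) ^ (2 * k) * (384 powr (2 * (a + 2))) ^ k * (4 * exp 7 * k) ^ k)"
      by (intro mult_left_mono mult_right_mono r3) auto
    also have "\<dots> = 2 * real n * (G * k) ^ k"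
      unfolding power_mult[of "12 / 5"] by (simp add: G_def power_mult_distrib mult_ac)
    finally have ET: "measure_pmf.expectation (edge_pmf n P) ?T \<le> 2 * real n * (G * k) ^ k" .
    \<comment> \<open>The extra exp 4 gives a gain of exp(-4k), at most n^-4, which beats the
      prefactor n of the trace and leaves n^-3.\<close>
    define t where "t = sqrt (G * exp 4 * k)"
    have t: "t > 0" using G k by (simp add: t_def)
    have t2: "t ^ (2 * k) = (G * exp 4 * k) ^ k" using G by (simp add: t_def power_mult)
    have tC: "t \<le> C * sqrt (ln n)"
      unfolding t_def C_def real_sqrt_mult[symmetric] using k G by (intro real_sqrt_le_mono) simp
    have Tnn: "0 \<le> ?T \<omega>" for \<omega>
      by (subst mtrace_mpow_double, rule symmat_sym) (auto intro!: sum_nonneg)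
    have "{\<omega>. \<exists>x. \<bar>bilin n (?W \<omega>) x x\<bar> > C * sqrt (ln n) * sqn n x} \<subseteq> {\<omega>. t ^ (2 * k) \<le> ?T \<omega>}"
    proof safe
      fix \<omega> x assume x: "\<bar>bilin n (?W \<omega>) x x\<bar> > C * sqrt (ln n) * sqn n x"
      show "t ^ (2 * k) \<le> ?T \<omega>"
      proof (rule ccontr)
        assume "\<not> t ^ (2 * k) \<le> ?T \<omega>"
        then have "mtrace n (mpow n (?W \<omega>) (2 ^ Suc s)) \<le> t ^ (2 ^ Suc s)" by (simp add: k_def)
        then have "\<bar>bilin n (?W \<omega>) x x\<bar> \<le> t * sqn n x"
          by (intro bilin_le_of_mtrace_le symmat_sym) (use t in auto)
        also have "\<dots> \<le> C * sqrt (ln n) * sqn n x" by (intro mult_right_mono tC) simp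
        finally show False using x by simp
      qed
    qed
    then have "measure_pmf.prob (edge_pmf n P) {\<omega>. \<exists>x. \<bar>bilin n (?W \<omega>) x x\<bar> > C * sqrt (ln n) * sqn n x}
        \<le> measure_pmf.prob (edge_pmf n P) {\<omega>. t ^ (2 * k) \<le> ?T \<omega>}"
      by (intro measure_pmf.finite_measure_mono) auto
    also have "\<dots> \<le> measure_pmf.expectation (edge_pmf n P) ?T / t ^ (2 * k)"
      using integral_Markov_inequality_measure[of "measure_pmf (edge_pmf n P)" ?T UNIV "t ^ (2 * k)"] Tnn t
      by simp
    also have "\<dots> \<le> 2 * real n * (G * k) ^ k / t ^ (2 * k)"
      using ET t by (intro divide_right_mono) auto
    also have "\<dots> = 2 * real n * exp (- (4 * real k))"
    proof -
      have "t ^ (2 * k) = (G * k) ^ k * exp (4 * real k)"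
        unfolding t2 by (simp add: power_mult_distrib exp_of_nat2_mult)
      moreover have "(G * k) ^ k > 0" using G k by simp
      ultimately show ?thesis using G by (simp add: exp_minus field_simps)
    qed
    also have "\<dots> \<le> 2 * real n * exp (- 4 * ln n)" using k by (intro mult_left_mono) auto
    also have "\<dots> = 2 * (real n powr 1 * real n powr (- 4))" using n by (simp add: powr_def)
    also have "real n powr 1 * real n powr (- 4) = real n powr (- 3)" unfolding powr_add[symmetric] by simp
    finally show "measure_pmf.prob (edge_pmf n P)
      {\<omega>. \<exists>x. \<bar>bilin n (?W \<omega>) x x\<bar> > C * sqrt (ln n) * sqn n x} \<le> 2 * real n powr (- 3)" .
  qed
qed

section \<open>Dual certificates\<close>

lemma bilin_Suc:
  assumes sym: "\<And>i j. i < Suc n \<Longrightarrow> j < Suc n \<Longrightarrow> Z i j = Z j i"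
  shows "bilin (Suc n) Z x x = bilin n Z x x + 2 * x n * (\<Sum>j<n. Z n j * x j) + Z n n * (x n)\<^sup>2"
proof -
  have "(\<Sum>i<n. x i * Z i n * x n) = (\<Sum>i<n. x n * Z n i * x i)"
    by (intro sum.cong refl) (use sym[of _ n] in simp)
  then show ?thesis
    by (simp add: bilin_def sum.distrib sum_distrib_left power2_eq_square mult_ac)
qed

text \<open>Cholesky factorisation by induction: the Schur complement \<open>Z'\<close> of the last
  diagonal entry z is again positive semidefinite, because its form is the value of the larger form
  at the last coordinate -w / z. If z = 0, the last row and column vanish, and the same formulas
  hold since division by 0 yields 0.\<close>

lemma psd_n_gram:
  assumes "psd_n n Z"
  shows "\<exists>v. \<forall>i<n. \<forall>j<n. Z i j = (\<Sum>m<n. v m i * v m j)"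
  using assms
proof (induction n arbitrary: Z)
  case (Suc n)
  have sym: "\<And>i j. i < Suc n \<Longrightarrow> j < Suc n \<Longrightarrow> Z i j = Z j i"
    and nn: "\<And>x. 0 \<le> bilin (Suc n) Z x x"
    using Suc.prems by (auto simp: psd_n_def bilin_def)
  define z where "z = Z n n"
  define Z' where "Z' i j = Z i j - Z i n * Z n j / z" for i j
  have cong: "bilin n Z (x(n := t)) (x(n := t)) = bilin n Z x x"
    "(\<Sum>j<n. Z n j * (x(n := t)) j) = (\<Sum>j<n. Z n j * x j)" for x t
    by (auto simp: bilin_def intro!: sum.cong)
  have form: "bilin (Suc n) Z (x(n := t)) (x(n := t)) = bilin n Z x x + 2 * t * (\<Sum>j<n. Z n j * x j) + z * t\<^sup>2" for x t
    by (subst bilin_Suc, rule sym, assumption, assumption) (simp only: cong, simp add: z_def)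
  have z0: "0 \<le> z" using nn[of "(\<lambda>_. 0)(n := 1)"] unfolding form by (simp add: bilin_def)
  have zero: "Z i n = 0" if "z = 0" "i < n" for i
  proof (rule ccontr)
    assume ne: "Z i n \<noteq> 0"
    let ?x = "\<lambda>m. if m = i then 1 else 0 :: real"
    have 1: "bilin n Z ?x ?x = Z i i" "(\<Sum>j<n. Z n j * ?x j) = Z i n"
      using that sym[of n i]
      by (simp_all add: bilin_def if_distrib[of "\<lambda>c. _ * c"] if_distrib[of "\<lambda>c. c * _"] cong: if_cong)
    \<comment> \<open>With z = 0 the form is affine in the last coordinate; this value of it would
      make the form equal to -1.\<close>
    have "0 \<le> Z i i + 2 * (- (Z i i + 1) / (2 * Z i n)) * Z i n"
      using nn[of "?x(n := - (Z i i + 1) / (2 * Z i n))"] that(1) unfolding form 1 by simp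
    then show False using ne by (simp add: field_simps)
  qed
  have "psd_n n Z'"
    unfolding psd_n_def
  proof (intro conjI allI impI)
    fix i j assume "i < n" "j < n"
    then show "Z' i j = Z' j i" using sym[of i j] sym[of i n] sym[of j n] by (simp add: Z'_def)
  next
    fix x :: "nat \<Rightarrow> real"
    define w where "w = (\<Sum>j<n. Z n j * x j)"
    have w': "(\<Sum>i<n. x i * Z i n) = w"
      unfolding w_def by (intro sum.cong refl) (use sym[of _ n] in simp)
    have "(\<Sum>i<n. \<Sum>j<n. x i * Z' i j * x j) = bilin n Z x x - (\<Sum>i<n. \<Sum>j<n. (x i * Z i n) * (Z n j * x j)) / z"
      by (simp add: Z'_def bilin_def algebra_simps sum_subtractf sum_divide_distrib)
    also have "(\<Sum>i<n. \<Sum>j<n. (x i * Z i n) * (Z n j * x j)) = w * w"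
      unfolding sum_product[symmetric] w' by (simp add: w_def)
    also have "bilin n Z x x - w * w / z = bilin (Suc n) Z (x(n := - w / z)) (x(n := - w / z))"
      unfolding form w_def[symmetric] by (simp add: power2_eq_square field_simps)
    finally show "0 \<le> (\<Sum>i<n. \<Sum>j<n. x i * Z' i j * x j)" using nn by simp
  qed
  from Suc.IH[OF this] obtain v where v: "\<And>i j. i < n \<Longrightarrow> j < n \<Longrightarrow> Z' i j = (\<Sum>m<n. v m i * v m j)"
    by blast
  define v' where "v' m j = (if m < n then (if j < n then v m j else 0) else Z j n / sqrt z)" for m j
  have "Z i j = (\<Sum>m<Suc n. v' m i * v' m j)" if ij: "i < Suc n" "j < Suc n" for i j
  proof (cases "i < n \<and> j < n")
    case True
    then have "(\<Sum>m<Suc n. v' m i * v' m j) = (\<Sum>m<n. v m i * v m j) + Z i n * Z j n / (sqrt z * sqrt z)"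
      by (simp add: v'_def)
    also have "\<dots> = Z' i j + Z i n * Z n j / z" using True z0 sym[of j n] v[of i j] by simp
    finally show ?thesis by (simp add: Z'_def)
  next
    case False
    then have "(\<Sum>m<n. v' m i * v' m j) = 0" by (auto simp: v'_def intro!: sum.neutral)
    then have "(\<Sum>m<Suc n. v' m i * v' m j) = Z i n * Z j n / (sqrt z * sqrt z)"
      by (simp add: v'_def)
    also have "\<dots> = Z i n * Z j n / z" using z0 by simp
    also have "\<dots> = Z i j"
    proof (cases "z = 0")
      case True
      then show ?thesis using False ij zero[of i] zero[of j] sym[of i j] by (auto simp: z_def less_Suc_eq)
    next
      case nz: False
      then show ?thesis using False ij sym[of i j] by (auto simp: z_def less_Suc_eq)
    qed
    finally show ?thesis by simp
  qed
  then show ?case by blast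
qed simp

text \<open>Vertex \<open>j\<close> lies in block \<open>cl j\<close>; the value 0 marks the outliers.\<close>

locale blocks =
  fixes n r :: nat and cl :: "nat \<Rightarrow> nat"
  assumes cl_le: "j < n \<Longrightarrow> cl j \<le> r"
begin

definition blk :: "nat \<Rightarrow> nat set" where
  "blk k = {j \<in> {..<n}. cl j = k}"

definition block_matrix :: "nat \<Rightarrow> nat \<Rightarrow> real" where
  "block_matrix i j = (if i < n \<and> j < n \<and> cl i = cl j \<and> cl i \<noteq> 0 then 1 else 0)"

lemma finite_blk [simp]: "finite (blk k)"
  by (simp add: blk_def)

lemma sum_blk: "(\<Sum>j<n. F j) = (\<Sum>k\<le>r. \<Sum>j\<in>blk k. F j :: real)"
  unfolding blk_def by (rule sum.group[symmetric]) (auto simp: cl_le)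

lemma sum_if_blk: "(\<Sum>j<n. if cl j = k then F j else 0) = (\<Sum>j\<in>blk k. F j :: real)"
  unfolding blk_def by (rule sum.inter_filter[symmetric]) simp

lemma sum_const_mult:
  assumes "c 0 = 0"
  shows "(\<Sum>j<n. c (cl j) * y j) = (\<Sum>k\<in>{1..r}. c k * (\<Sum>j\<in>blk k. y j :: real))"
proof -
  have "(\<Sum>j<n. c (cl j) * y j) = (\<Sum>k\<le>r. c k * (\<Sum>j\<in>blk k. y j))"
    unfolding sum_blk sum_distrib_left by (intro sum.cong refl) (auto simp: blk_def)
  also have "\<dots> = (\<Sum>k\<in>{1..r}. c k * (\<Sum>j\<in>blk k. y j))"
    using assms by (intro sum.mono_neutral_right) (auto simp: Suc_le_eq intro: gr0I)
  finally show ?thesis .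
qed

lemma bilin_block_matrix: "bilin n block_matrix x x = (\<Sum>k\<in>{1..r}. (\<Sum>j\<in>blk k. x j)\<^sup>2)"
proof -
  let ?c = "\<lambda>k. if k = 0 then 0 else (\<Sum>j\<in>blk k. x j)"
  have "bilin n block_matrix x x = (\<Sum>i<n. ?c (cl i) * x i)"
    unfolding bilin_def
  proof (intro sum.cong refl)
    fix i assume i: "i \<in> {..<n}"
    have "(\<Sum>j<n. x i * block_matrix i j * x j) = (\<Sum>j<n. if cl j = cl i \<and> cl i \<noteq> 0 then x i * x j else 0)"
      using i by (intro sum.cong refl) (auto simp: block_matrix_def)
    also have "\<dots> = (if cl i = 0 then 0 else (\<Sum>j\<in>blk (cl i). x i * x j))"
      by (simp add: sum_if_blk)
    also have "\<dots> = ?c (cl i) * x i" by (simp add: sum_distrib_left mult.commute)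
    finally show "(\<Sum>j<n. x i * block_matrix i j * x j) = ?c (cl i) * x i" .
  qed
  also have "\<dots> = (\<Sum>k\<in>{1..r}. (\<Sum>j\<in>blk k. x j)\<^sup>2)"
    by (subst sum_const_mult) (auto simp: power2_eq_square intro!: sum.cong)
  finally show ?thesis .
qed

lemma block_matrix_feasible: "sdp_base_feasible n block_matrix"
  unfolding sdp_base_feasible_def psd_n_def
proof (intro conjI allI)
  fix x :: "nat \<Rightarrow> real"
  show "0 \<le> (\<Sum>i<n. \<Sum>j<n. x i * block_matrix i j * x j)"
    using bilin_block_matrix[of x] by (simp add: bilin_def sum_nonneg)
qed (auto simp: supported_n_def block_matrix_def)

lemma sum_block_matrix:
  "(\<Sum>i<n. \<Sum>j<n. M i j * block_matrix i j) = (\<Sum>i<n. if cl i = 0 then 0 else \<Sum>j\<in>blk (cl i). M i j)"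
proof (intro sum.cong refl)
  fix i assume i: "i \<in> {..<n}"
  have "(\<Sum>j<n. M i j * block_matrix i j) = (\<Sum>j<n. if cl j = cl i \<and> cl i \<noteq> 0 then M i j else 0)"
    using i by (intro sum.cong refl) (auto simp: block_matrix_def)
  then show "(\<Sum>j<n. M i j * block_matrix i j) = (if cl i = 0 then 0 else \<Sum>j\<in>blk (cl i). M i j)"
    by (simp add: sum_if_blk)
qed

text \<open>Weak duality: the objective equals the sum of d_i Z_ii minus (B, Z) minus (S, Z), so it
  is at most the sum of the d_i, which the block matrix attains. Uniqueness is complementary
  slackness: equality puts the Gram vectors of Z into the kernel of S, so they are constant on
  clusters and zero on outliers; then d_i > 0 forces Z_ii = 1, and B_ij > 0 kills entries between
  distinct clusters. Outlier rows vanish through the kernel, so there B may be zero.\<close>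

lemma dual_certificate:
  fixes A B :: "nat \<Rightarrow> nat \<Rightarrow> real" and d :: "nat \<Rightarrow> real" and \<eta> lam :: real
  defines "S \<equiv> \<lambda>i j. (if i = j then d i + \<eta> else 0) - B i j - A i j + lam"
  assumes ne: "\<And>k. k \<in> {1..r} \<Longrightarrow> blk k \<noteq> {}"
    and symS: "\<And>i j. i < n \<Longrightarrow> j < n \<Longrightarrow> S i j = S j i"
    and d_pos: "\<And>i. i < n \<Longrightarrow> cl i \<noteq> 0 \<Longrightarrow> 0 < d i"
    and d_zero: "\<And>i. i < n \<Longrightarrow> cl i = 0 \<Longrightarrow> d i = 0"
    and B_same: "\<And>i j. i < n \<Longrightarrow> j < n \<Longrightarrow> cl i = cl j \<Longrightarrow> B i j = 0"
    and B_nonneg: "\<And>i j. i < n \<Longrightarrow> j < n \<Longrightarrow> 0 \<le> B i j"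
    and B_pos: "\<And>i j. i < n \<Longrightarrow> j < n \<Longrightarrow> cl i \<noteq> cl j \<Longrightarrow> cl i \<noteq> 0 \<Longrightarrow> cl j \<noteq> 0 \<Longrightarrow> 0 < B i j"
    and null: "\<And>i k. i < n \<Longrightarrow> k \<in> {1..r} \<Longrightarrow> (\<Sum>j\<in>blk k. S i j) = 0"
    and pos: "\<And>y. (\<And>k. k \<in> {1..r} \<Longrightarrow> (\<Sum>j\<in>blk k. y j) = 0) \<Longrightarrow> sqn n y \<noteq> 0 \<Longrightarrow> 0 < bilin n S y y"
  shows "unique_maximizer (sdp_base_feasible n) (sdp2_objective n \<eta> lam A) block_matrix"
proof -
  have obj: "sdp2_objective n \<eta> lam A Z =
      (\<Sum>i<n. d i * Z i i) - (\<Sum>i<n. \<Sum>j<n. B i j * Z i j) - (\<Sum>i<n. \<Sum>j<n. S i j * Z i j)" for Z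
  proof -
    have 1: "(\<Sum>j<n. S i j * Z i j) =
        (d i + \<eta>) * Z i i - (\<Sum>j<n. B i j * Z i j) - (\<Sum>j<n. A i j * Z i j) + lam * (\<Sum>j<n. Z i j)"
      if "i < n" for i
    proof -
      have "(\<Sum>j<n. S i j * Z i j) = (\<Sum>j<n. (if i = j then (d i + \<eta>) * Z i j else 0) - B i j * Z i j - A i j * Z i j + lam * Z i j)"
        by (intro sum.cong refl) (auto simp: S_def algebra_simps)
      then show ?thesis using that by (simp add: sum.distrib sum_subtractf sum_distrib_left)
    qed
    have 2: "inner_n n (Id_n n) Z = (\<Sum>i<n. Z i i)"
    proof -
      have "(\<Sum>j<n. Id_n n i j * Z i j) = Z i i" if "i < n" for i
        using that by (simp add: Id_n_def if_distrib[of "\<lambda>c. c * _"] cong: if_cong conj_cong)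
      then show ?thesis by (simp add: inner_n_def)
    qed
    have 3: "inner_n n (J_n n) Z = (\<Sum>i<n. \<Sum>j<n. Z i j)"
      by (simp add: inner_n_def J_n_def)
    have "(\<Sum>i<n. \<Sum>j<n. S i j * Z i j) = (\<Sum>i<n. (d i + \<eta>) * Z i i - (\<Sum>j<n. B i j * Z i j) - (\<Sum>j<n. A i j * Z i j) + lam * (\<Sum>j<n. Z i j))"
      by (intro sum.cong refl 1) simp
    also have "\<dots> = (\<Sum>i<n. d i * Z i i) + \<eta> * (\<Sum>i<n. Z i i) - (\<Sum>i<n. \<Sum>j<n. B i j * Z i j)
        - inner_n n A Z + lam * (\<Sum>i<n. \<Sum>j<n. Z i j)"
      by (simp only: sum.distrib sum_subtractf sum_distrib_left distrib_right inner_n_def)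
    finally show ?thesis by (simp only: sdp2_objective_def 2 3)
  qed
  have obj0: "sdp2_objective n \<eta> lam A block_matrix = (\<Sum>i<n. d i)"
  proof -
    have "(\<Sum>i<n. \<Sum>j<n. S i j * block_matrix i j) = 0"
      unfolding sum_block_matrix using null cl_le by (intro sum.neutral) (auto simp: Suc_le_eq)
    moreover have "(\<Sum>i<n. \<Sum>j<n. B i j * block_matrix i j) = 0"
      by (intro sum.neutral ballI) (auto simp: block_matrix_def B_same)
    moreover have "(\<Sum>i<n. d i * block_matrix i i) = (\<Sum>i<n. d i)"
      by (intro sum.cong refl) (auto simp: block_matrix_def d_zero)
    ultimately show ?thesis by (simp add: obj)
  qed
  \<comment> \<open>Subtracting from \<open>v\<close> its average on each cluster, and nothing on
    outliers, leaves the form unchanged because S annihilates the cluster indicators. The remainder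
    \<open>y\<close> falls under \<open>pos\<close>, so a vanishing form forces y = 0.\<close>
  have quad: "0 \<le> bilin n S v v \<and> (bilin n S v v = 0 \<longrightarrow>
      (\<forall>i<n. \<forall>j<n. cl i = cl j \<longrightarrow> v i = v j) \<and> (\<forall>i<n. cl i = 0 \<longrightarrow> v i = 0))" for v
  proof -
    define c where "c k = (if k = 0 then 0 else (\<Sum>j\<in>blk k. v j) / card (blk k))" for k
    define y where "y i = v i - c (cl i)" for i
    have Sc: "(\<Sum>j<n. S i j * c (cl j)) = 0" if "i < n" for i
    proof -
      have "(\<Sum>j<n. c (cl j) * S i j) = (\<Sum>k\<in>{1..r}. c k * (\<Sum>j\<in>blk k. S i j))"
        by (rule sum_const_mult) (simp add: c_def)
      also have "\<dots> = 0" by (intro sum.neutral ballI) (simp only: null[OF that] mult_zero_right)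
      finally show ?thesis by (simp only: mult.commute)
    qed
    have right: "bilin n S x (\<lambda>j. c (cl j)) = 0" for x
    proof -
      have "bilin n S x (\<lambda>j. c (cl j)) = (\<Sum>i<n. x i * (\<Sum>j<n. S i j * c (cl j)))"
        by (simp add: bilin_def sum_distrib_left mult.assoc)
      then show ?thesis using Sc by simp
    qed
    have left: "bilin n S (\<lambda>j. c (cl j)) x = 0" for x
    proof -
      have "bilin n S (\<lambda>j. c (cl j)) x = bilin n S x (\<lambda>j. c (cl j))"
        unfolding bilin_def
        by (subst sum.swap, intro sum.cong refl, subst symS) (simp_all add: mult_ac)
      then show ?thesis using right by simp
    qed
    have "bilin n S v v = bilin n S (\<lambda>i. y i + c (cl i)) (\<lambda>i. y i + c (cl i))" by (simp add: y_def)
    also have "\<dots> = bilin n S y y" unfolding bilin_add_left bilin_add_right left right by simp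
    finally have eq: "bilin n S v v = bilin n S y y" .
    have "(\<Sum>j\<in>blk k. y j) = 0" if k: "k \<in> {1..r}" for k
    proof -
      have "(\<Sum>j\<in>blk k. y j) = (\<Sum>j\<in>blk k. v j - c k)"
        by (intro sum.cong refl) (auto simp: y_def blk_def)
      then show ?thesis using k ne[OF k] by (simp add: sum_subtractf c_def)
    qed
    note P = pos[OF this]
    show ?thesis
    proof (cases "sqn n y = 0")
      case True
      then have y0: "v i = c (cl i)" if "i < n" for i using that by (auto simp: sqn_eq_0 y_def)
      from True have z: "bilin n S y y = 0" by (auto simp: bilin_def sqn_eq_0)
      have "v i = v j" if "i < n" "j < n" "cl i = cl j" for i j
        unfolding y0[OF that(1)] y0[OF that(2)] that(3) ..
      moreover have "v i = 0" if "i < n" "cl i = 0" for i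
        unfolding y0[OF that(1)] that(2) by (simp add: c_def)
      moreover have "0 \<le> bilin n S v v" using eq z by simp
      ultimately show ?thesis by blast
    next
      case False
      then show ?thesis using P eq by auto
    qed
  qed
  show ?thesis
    unfolding unique_maximizer_def
  proof (intro conjI allI impI block_matrix_feasible)
    fix Z assume "sdp_base_feasible n Z \<and> Z \<noteq> block_matrix"
    then have psd: "psd_n n Z" and supp: "supported_n n Z" and diag: "\<And>i. i < n \<Longrightarrow> Z i i \<le> 1"
      and Znn: "\<And>i j. i < n \<Longrightarrow> j < n \<Longrightarrow> 0 \<le> Z i j" and neq: "Z \<noteq> block_matrix"
      by (auto simp: sdp_base_feasible_def)
    from psd_n_gram[OF psd] obtain v where v: "\<And>i j. i < n \<Longrightarrow> j < n \<Longrightarrow> Z i j = (\<Sum>m<n. v m i * v m j)"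
      by blast
    have SZ: "(\<Sum>i<n. \<Sum>j<n. S i j * Z i j) = (\<Sum>m<n. bilin n S (v m) (v m))"
    proof -
      have "(\<Sum>i<n. \<Sum>j<n. S i j * Z i j) = (\<Sum>i<n. \<Sum>j<n. \<Sum>m<n. v m i * S i j * v m j)"
        by (intro sum.cong refl) (auto simp: v sum_distrib_left mult_ac)
      also have "\<dots> = (\<Sum>i<n. \<Sum>m<n. \<Sum>j<n. v m i * S i j * v m j)"
        by (intro sum.cong refl sum.swap)
      also have "\<dots> = (\<Sum>m<n. \<Sum>i<n. \<Sum>j<n. v m i * S i j * v m j)" by (rule sum.swap)
      finally show ?thesis by (simp add: bilin_def)
    qed
    have SZ0: "0 \<le> (\<Sum>m<n. bilin n S (v m) (v m))" using quad by (intro sum_nonneg) auto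
    have BZ0: "0 \<le> (\<Sum>i<n. \<Sum>j<n. B i j * Z i j)" using B_nonneg Znn by (intro sum_nonneg mult_nonneg_nonneg) auto
    have d0: "0 \<le> d i" if "i < n" for i using d_pos[OF that] d_zero[OF that] by (cases "cl i = 0") auto
    have DZ0: "0 \<le> (\<Sum>i<n. d i * (1 - Z i i))" using d0 diag by (intro sum_nonneg mult_nonneg_nonneg) auto
    have DZ: "(\<Sum>i<n. d i * (1 - Z i i)) = (\<Sum>i<n. d i) - (\<Sum>i<n. d i * Z i i)"
      by (simp add: algebra_simps sum_subtractf)
    show "sdp2_objective n \<eta> lam A Z < sdp2_objective n \<eta> lam A block_matrix"
    proof (rule ccontr)
      assume "\<not> sdp2_objective n \<eta> lam A Z < sdp2_objective n \<eta> lam A block_matrix"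
      then have all0: "(\<Sum>m<n. bilin n S (v m) (v m)) = 0" "(\<Sum>i<n. \<Sum>j<n. B i j * Z i j) = 0"
          "(\<Sum>i<n. d i * (1 - Z i i)) = 0"
        using SZ0 BZ0 DZ0 unfolding obj0 obj[of Z] SZ DZ by linarith+
      have q: "bilin n S (v m) (v m) = 0" if "m < n" for m
        using all0(1) that quad by (subst (asm) sum_nonneg_eq_0_iff) auto
      have vm: "v m i = v m j" if "m < n" "i < n" "j < n" "cl i = cl j" for m i j
        using quad[of "v m"] q that by blast
      have vz: "v m i = 0" if "m < n" "i < n" "cl i = 0" for m i
        using quad[of "v m"] q that by blast
      have "Z i j = block_matrix i j" if ij: "i < n" "j < n" for i j
      proof (cases "cl i = 0 \<or> cl j = 0")
        case True
        then have "Z i j = 0" using ij vz by (auto simp: v intro!: sum.neutral)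
        then show ?thesis using True by (auto simp: block_matrix_def)
      next
        case nz: False
        show ?thesis
        proof (cases "cl i = cl j")
          case True
          have "Z i j = Z i i" using ij vm[OF _ ij(2,1)] True by (simp add: v)
          moreover have "d i * (1 - Z i i) = 0"
            using all0(3) ij d0 diag by (subst (asm) sum_nonneg_eq_0_iff) auto
          ultimately show ?thesis using d_pos[OF ij(1)] nz True ij by (auto simp: block_matrix_def)
        next
          case False
          have "(\<Sum>j<n. B i j * Z i j) = 0"
            using all0(2) ij B_nonneg Znn by (subst (asm) sum_nonneg_eq_0_iff) (auto intro!: sum_nonneg)
          then have "B i j * Z i j = 0"
            using ij B_nonneg Znn by (subst (asm) sum_nonneg_eq_0_iff) auto
          then show ?thesis using B_pos[OF ij False] nz False by (auto simp: block_matrix_def)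
        qed
      qed
      moreover have "Z i j = block_matrix i j" if "n \<le> i \<or> n \<le> j" for i j
        using supp that by (auto simp: supported_n_def block_matrix_def)
      ultimately have "Z = block_matrix" by (intro ext) (meson not_le)
      with neq show False ..
    qed
  qed
qed

end

section \<open>Construction of the certificate\<close>

lemma bilin_mat_add: "bilin n (\<lambda>i j. M i j + N i j) x y = bilin n M x y + bilin n N x y"
  by (simp add: bilin_def algebra_simps sum.distrib)

lemma bilin_mat_diff: "bilin n (\<lambda>i j. M i j - N i j) x y = bilin n M x y - bilin n N x y"
  by (simp add: bilin_def algebra_simps sum_subtractf)

lemma bilin_mat_scale: "bilin n (\<lambda>i j. c * M i j) x y = c * bilin n M x y"
  by (simp add: bilin_def sum_distrib_left mult_ac)

lemma bilin_mat_const: "bilin n (\<lambda>i j. c) x x = c * (\<Sum>i<n. x i)\<^sup>2"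
  by (simp add: bilin_def power2_eq_square sum_product sum_distrib_left mult_ac)

lemma bilin_mat_diag: "bilin n (\<lambda>i j. if i = j then m i else 0) x x = (\<Sum>i<n. m i * (x i)\<^sup>2)"
proof -
  have "(\<Sum>j<n. x i * (if i = j then m i else 0) * x j) = m i * (x i)\<^sup>2" if "i < n" for i
  proof -
    have "(\<Sum>j<n. x i * (if i = j then m i else 0) * x j) = (\<Sum>j<n. if i = j then m i * (x i)\<^sup>2 else 0)"
      by (intro sum.cong refl) (simp add: power2_eq_square)
    then show ?thesis using that by simp
  qed
  then show ?thesis by (simp add: bilin_def)
qed

lemma bilin_cong:
  assumes "\<And>i j. i < n \<Longrightarrow> j < n \<Longrightarrow> M i j = N i j"
  shows "bilin n M x y = bilin n N x y"
  unfolding bilin_def by (intro sum.cong refl) (simp add: assms)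

context blocks
begin

definition mean_matrix :: "real \<Rightarrow> real \<Rightarrow> nat \<Rightarrow> nat \<Rightarrow> real" where
  "mean_matrix p q i j = (if i = j then 0 else if cl i = cl j \<and> cl i \<noteq> 0 then p else q)"

text \<open>For such \<open>y\<close> the block part of the mean vanishes and the missing diagonal
  only lowers the form. The constant part survives since outlier coordinates are free; it is later
  dominated by \<open>lam\<close> times the all-ones matrix.\<close>

lemma bilin_mean_matrix_le:
  assumes "0 \<le> p" "0 \<le> q" and y: "\<And>k. k \<in> {1..r} \<Longrightarrow> (\<Sum>j\<in>blk k. y j) = 0"
  shows "bilin n (mean_matrix p q) y y \<le> q * (\<Sum>i<n. y i)\<^sup>2"
proof -
  let ?m = "\<lambda>i. if cl i \<noteq> 0 then p else q"
  have "bilin n (mean_matrix p q) y y =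
      bilin n (\<lambda>i j. (q + (p - q) * block_matrix i j) - (if i = j then ?m i else 0)) y y"
    by (rule bilin_cong) (auto simp: mean_matrix_def block_matrix_def)
  also have "\<dots> = q * (\<Sum>i<n. y i)\<^sup>2 + (p - q) * bilin n block_matrix y y - (\<Sum>i<n. ?m i * (y i)\<^sup>2)"
    unfolding bilin_mat_diff bilin_mat_add bilin_mat_scale bilin_mat_const bilin_mat_diag ..
  also have "bilin n block_matrix y y = 0" unfolding bilin_block_matrix by (simp add: y)
  also have "q * (\<Sum>i<n. y i)\<^sup>2 + (p - q) * 0 - (\<Sum>i<n. ?m i * (y i)\<^sup>2) \<le> q * (\<Sum>i<n. y i)\<^sup>2"
    using assms(1,2) by (simp add: sum_nonneg)
  finally show ?thesis .
qed

text \<open>The hypotheses match the parts of the certificate: \<open>deg\<close> is d > 0,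
  \<open>cross\<close> is B > 0 between clusters, \<open>out\<close> is B >= 0 between an outlier i
  and a cluster k, where the entry is \<open>lam\<close> - e(i, C_k)/K_k, and \<open>spec\<close>
  with t < \<eta> and q <= \<open>lam\<close> gives positivity of S. Entries of B between two
  outliers are 0.\<close>

lemma deterministic_recovery:
  fixes A :: "nat \<Rightarrow> nat \<Rightarrow> real" and p q t \<eta> lam :: real
  defines "e \<equiv> \<lambda>i k. \<Sum>j\<in>blk k. A i j" and "N \<equiv> \<lambda>k. real (card (blk k))"
  assumes ne: "\<And>k. k \<in> {1..r} \<Longrightarrow> blk k \<noteq> {}"
    and symA: "\<And>i j. i < n \<Longrightarrow> j < n \<Longrightarrow> A i j = A j i"
    and spec: "\<And>x. bilin n (\<lambda>i j. A i j - mean_matrix p q i j) x x \<le> t * sqn n x"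
    and pq: "t < \<eta>" "0 \<le> p" "0 \<le> q" "q \<le> lam"
    and deg: "\<And>i. i < n \<Longrightarrow> cl i \<noteq> 0 \<Longrightarrow> \<eta> + lam * N (cl i) < e i (cl i)"
    and out: "\<And>i k. i < n \<Longrightarrow> cl i = 0 \<Longrightarrow> k \<in> {1..r} \<Longrightarrow> e i k \<le> lam * N k"
    and cross: "\<And>i j. i < n \<Longrightarrow> j < n \<Longrightarrow> cl i \<noteq> 0 \<Longrightarrow> cl j \<noteq> 0 \<Longrightarrow> cl i \<noteq> cl j \<Longrightarrow>
      e i (cl j) / N (cl j) + e j (cl i) / N (cl i) < lam + (\<Sum>l\<in>blk (cl i). e l (cl j)) / (N (cl i) * N (cl j))"
  shows "unique_maximizer (sdp_base_feasible n) (sdp2_objective n \<eta> lam A) block_matrix"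
proof -
  define g where "g k l = (\<Sum>i\<in>blk k. e i l) / (N k * N l)" for k l
  \<comment> \<open>Splitting \<open>B\<close> as \<open>u i (cl j) + u j (cl i)\<close> makes its quadratic form vanish on vectors that sum to 0 on each block.\<close>
  define u where "u i k = (if k = 0 \<or> k = cl i then 0 else if cl i = 0 then lam - e i k / N k
    else lam / 2 + g (cl i) k / 2 - e i k / N k)" for i k
  define B where "B i j = u i (cl j) + u j (cl i)" for i j
  define d where "d i = (if cl i = 0 then 0 else e i (cl i) - \<eta> - lam * N (cl i))" for i
  have Npos: "0 < N k" if "k \<in> {1..r}" for k using ne[OF that] by (simp add: N_def card_gt_0_iff)
  have cl1: "cl i \<in> {1..r}" if "i < n" "cl i \<noteq> 0" for i using cl_le[OF that(1)] that(2) by simp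
  have blkD: "j < n" "cl j = k" if "j \<in> blk k" for j k using that by (auto simp: blk_def)
  have g_sym: "g k l = g l k" for k l
  proof -
    have "(\<Sum>i\<in>blk k. e i l) = (\<Sum>i\<in>blk l. e i k)"
      unfolding e_def by (subst sum.swap, intro sum.cong refl, subst symA) (auto dest: blkD)
    then show ?thesis by (simp add: g_def mult.commute)
  qed
  have B_cross: "B i j = lam + g (cl i) (cl j) - e i (cl j) / N (cl j) - e j (cl i) / N (cl i)"
    if "cl i \<noteq> 0" "cl j \<noteq> 0" "cl i \<noteq> cl j" for i j
    using that g_sym[of "cl j" "cl i"] by (simp add: B_def u_def)
  have B_cross_pos: "0 < B i j" if "i < n" "j < n" "cl i \<noteq> 0" "cl j \<noteq> 0" "cl i \<noteq> cl j" for i j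
    using cross[OF that] unfolding B_cross[OF that(3,4,5)] g_def by linarith
  have u_out: "0 \<le> u i k" if "i < n" "cl i = 0" "k \<le> r" for i k
  proof (cases "k = 0")
    case False
    then have k: "k \<in> {1..r}" using that by simp
    show ?thesis using out[OF that(1,2) k] Npos[OF k] that False by (simp add: u_def field_simps)
  qed (simp add: u_def)
  have u0: "u i 0 = 0" for i by (simp add: u_def)
  have B_nonneg: "0 \<le> B i j" if "i < n" "j < n" for i j
  proof (cases "cl i = cl j \<or> cl i = 0 \<or> cl j = 0")
    case True
    then consider "cl i = cl j" | "cl i = 0" | "cl j = 0" by (elim disjE)
    then show ?thesis
    proof cases
      case 1 then show ?thesis by (simp add: B_def u_def)
    next
      case 2 then show ?thesis using u_out[OF that(1) 2 cl_le[OF that(2)]] by (simp add: B_def u0)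
    next
      case 3 then show ?thesis using u_out[OF that(2) 3 cl_le[OF that(1)]] by (simp add: B_def u0)
    qed
  next
    case False then show ?thesis using B_cross_pos[OF that] by simp
  qed
  let ?S = "\<lambda>i j. (if i = j then d i + \<eta> else 0) - B i j - A i j + lam"
  have null: "(\<Sum>j\<in>blk k. ?S i j) = 0" if i: "i < n" and k: "k \<in> {1..r}" for i k
  proof -
    have D: "(\<Sum>j\<in>blk k. if i = j then d i + \<eta> else 0) = (if cl i = k then d i + \<eta> else 0)"
      using i by (simp add: blk_def)
    have "(\<Sum>j\<in>blk k. B i j) = (\<Sum>j\<in>blk k. u i k + u j (cl i))"
      by (intro sum.cong refl) (simp add: B_def blkD)
    also have "\<dots> = N k * u i k + (\<Sum>j\<in>blk k. u j (cl i))" by (simp add: sum.distrib N_def)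
    finally have B: "(\<Sum>j\<in>blk k. B i j) = N k * u i k + (\<Sum>j\<in>blk k. u j (cl i))" .
    have S: "(\<Sum>j\<in>blk k. ?S i j) = (if cl i = k then d i + \<eta> else 0)
        - (N k * u i k + (\<Sum>j\<in>blk k. u j (cl i))) - e i k + lam * N k"
      unfolding sum.distrib sum_subtractf D B by (simp add: e_def N_def)
    show ?thesis
    proof (cases "cl i = k")
      case True
      then have "(\<Sum>j\<in>blk k. u j (cl i)) = 0" by (intro sum.neutral ballI) (simp add: u_def blkD)
      then show ?thesis unfolding S using True k by (simp add: u_def d_def)
    next
      case ik: False
      show ?thesis
      proof (cases "cl i = 0")
        case True
        then show ?thesis unfolding S using ik k Npos[OF k] by (simp add: u_def field_simps)
      next
        case False
        \<comment> \<open>Summed over block k, the halves of \<open>lam\<close> and of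
          \<open>g\<close> recombine, and the total \<open>g\<close> cancels against the sum of e(j,
          C_l)/K_l over the block. The row sum of B is therefore \<open>lam\<close> K_k - e(i, C_k),
          as annihilation requires.\<close>
        let ?l = "cl i"
        have l: "0 < N ?l" using cl1[OF i False] Npos by simp
        have "(\<Sum>j\<in>blk k. u j ?l) = (\<Sum>j\<in>blk k. lam / 2 + g k ?l / 2 - e j ?l / N ?l)"
          using False ik k by (intro sum.cong refl) (auto simp: u_def dest: blkD)
        also have "\<dots> = N k * (lam / 2 + g k ?l / 2) - (\<Sum>j\<in>blk k. e j ?l) / N ?l"
          by (simp add: sum_subtractf sum_divide_distrib N_def algebra_simps)
        also have "(\<Sum>j\<in>blk k. e j ?l) / N ?l = N k * g k ?l"
          using l Npos[OF k] by (simp add: g_def)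
        finally have "(\<Sum>j\<in>blk k. u j ?l) = N k * (lam / 2 + g k ?l / 2) - N k * g k ?l" .
        moreover have "N k * u i k = N k * (lam / 2 + g k ?l / 2) - e i k"
          using False ik k Npos[OF k] g_sym[of k ?l] by (simp add: u_def algebra_simps)
        ultimately have "N k * u i k + (\<Sum>j\<in>blk k. u j ?l) = lam * N k - e i k"
          by (simp add: algebra_simps)
        then show ?thesis unfolding S using ik by simp
      qed
    qed
  qed
  have pos: "0 < bilin n ?S y y"
    if y: "\<And>k. k \<in> {1..r} \<Longrightarrow> (\<Sum>j\<in>blk k. y j) = 0" and y0: "sqn n y \<noteq> 0" for y
  proof -
    have uz: "(\<Sum>j<n. u i (cl j) * y j) = 0" for i
      using sum_const_mult[of "u i" y] y u0 by simp
    have "bilin n (\<lambda>i j. u i (cl j)) y y = (\<Sum>i<n. y i * (\<Sum>j<n. u i (cl j) * y j))"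
      by (simp add: bilin_def sum_distrib_left mult.assoc)
    then have b1: "bilin n (\<lambda>i j. u i (cl j)) y y = 0" using uz by simp
    have "bilin n (\<lambda>i j. u j (cl i)) y y = bilin n (\<lambda>i j. u i (cl j)) y y"
      unfolding bilin_def by (subst sum.swap) (simp add: mult_ac)
    then have bB: "bilin n B y y = 0"
      unfolding B_def bilin_mat_add b1 by simp
    have "bilin n A y y = bilin n (\<lambda>i j. A i j - mean_matrix p q i j) y y + bilin n (mean_matrix p q) y y"
      unfolding bilin_mat_diff by simp
    also have "\<dots> \<le> t * sqn n y + q * (\<Sum>i<n. y i)\<^sup>2"
      by (intro add_mono spec bilin_mean_matrix_le pq y)
    finally have bA: "bilin n A y y \<le> t * sqn n y + q * (\<Sum>i<n. y i)\<^sup>2" .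
    have bS: "bilin n ?S y y = (\<Sum>i<n. (d i + \<eta>) * (y i)\<^sup>2) - bilin n B y y - bilin n A y y + lam * (\<Sum>i<n. y i)\<^sup>2"
      unfolding bilin_mat_add bilin_mat_diff bilin_mat_const bilin_mat_diag ..
    have d0: "0 \<le> d i" if "i < n" for i using deg[OF that] by (cases "cl i = 0") (auto simp: d_def)
    have "\<eta> * sqn n y = (\<Sum>i<n. \<eta> * (y i)\<^sup>2)" by (simp add: sqn_def sum_distrib_left)
    also have "\<dots> \<le> (\<Sum>i<n. (d i + \<eta>) * (y i)\<^sup>2)"
      using d0 by (intro sum_mono mult_right_mono) auto
    finally have e: "\<eta> * sqn n y \<le> (\<Sum>i<n. (d i + \<eta>) * (y i)\<^sup>2)" .
    have "q * (\<Sum>i<n. y i)\<^sup>2 \<le> lam * (\<Sum>i<n. y i)\<^sup>2" using pq by (intro mult_right_mono) auto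
    moreover have "t * sqn n y < \<eta> * sqn n y"
      using pq y0 by (intro mult_strict_right_mono) (auto simp: less_le)
    ultimately show ?thesis using bS bB bA e by linarith
  qed
  show ?thesis
  proof (rule dual_certificate[where d = d and B = B])
    show "?S i j = ?S j i" if "i < n" "j < n" for i j
      using symA[OF that] by (auto simp: B_def)
    show "0 < d i" if "i < n" "cl i \<noteq> 0" for i using deg[OF that] that by (simp add: d_def)
    show "B i j = 0" if "cl i = cl j" for i j using that by (simp add: B_def u_def)
  qed (use ne B_nonneg B_cross_pos null pos in \<open>auto simp: d_def\<close>)
qed

end

section \<open>Edge densities between clusters from the spectral bound\<close>

lemma bilin_indicator:
  assumes "S \<subseteq> {..<n}" "T \<subseteq> {..<n}"
  shows "bilin n M (indicator S) (indicator T) = (\<Sum>i\<in>S. \<Sum>j\<in>T. M i j)"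
proof -
  have *: "(\<Sum>j<n. f j * indicator T j) = (\<Sum>j\<in>T. f j)" if "T \<subseteq> {..<n}" for f :: "nat \<Rightarrow> real" and T
    using that by (intro sum.mono_neutral_cong_right) (auto simp: indicator_def)
  have "bilin n M (indicator S) (indicator T) = (\<Sum>i<n. (\<Sum>j<n. M i j * indicator T j) * indicator S i)"
    unfolding bilin_def sum_distrib_right by (intro sum.cong refl) (simp only: mult_ac)
  then show ?thesis by (simp only: *[OF assms(1)] *[OF assms(2)])
qed

lemma sqn_indicator_le: "sqn n (indicator S) \<le> n"
proof -
  have "sqn n (indicator S) \<le> (\<Sum>i<n. 1)" unfolding sqn_def by (intro sum_mono) (auto simp: indicator_def)
  then show ?thesis by simp
qed

text \<open>Four times the bilinear value is the form at x + y minus the form at x - y; the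
  parallelogram law adds up the two error terms.\<close>

lemma bilin_polarization_ge:
  assumes sym: "\<And>i j. i < n \<Longrightarrow> j < n \<Longrightarrow> W i j = W j i"
    and W: "\<And>x. \<bar>bilin n W x x\<bar> \<le> t * sqn n x"
  shows "- (t * (sqn n x + sqn n y)) / 2 \<le> bilin n W x y"
proof -
  have swap: "bilin n W y x = bilin n W x y"
    unfolding bilin_def by (subst sum.swap, intro sum.cong refl, subst sym) (auto simp: mult_ac)
  have neg: "bilin n W (\<lambda>i. - y i) z = - bilin n W y z" "bilin n W z (\<lambda>i. - y i) = - bilin n W z y" for y z
    by (simp_all add: bilin_def sum_negf)
  have "bilin n W (\<lambda>i. x i + y i) (\<lambda>i. x i + y i) = bilin n W x x + 2 * bilin n W x y + bilin n W y y"
    unfolding bilin_add_left bilin_add_right swap by simp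
  moreover have "bilin n W (\<lambda>i. x i + - y i) (\<lambda>i. x i + - y i) = bilin n W x x - 2 * bilin n W x y + bilin n W y y"
    unfolding bilin_add_left bilin_add_right neg swap by simp
  moreover have "t * sqn n (\<lambda>i. x i + y i) + t * sqn n (\<lambda>i. x i + - y i) = 2 * (t * (sqn n x + sqn n y))"
  proof -
    have "sqn n (\<lambda>i. x i + y i) + sqn n (\<lambda>i. x i + - y i) = (\<Sum>i<n. 2 * ((x i)\<^sup>2 + (y i)\<^sup>2))"
      unfolding sqn_def sum.distrib[symmetric]
      by (intro sum.cong refl) (simp add: power2_eq_square algebra_simps)
    also have "\<dots> = 2 * (sqn n x + sqn n y)"
      by (simp only: sqn_def sum.distrib sum_distrib_left[symmetric])
    finally have "t * (sqn n (\<lambda>i. x i + y i) + sqn n (\<lambda>i. x i + - y i)) = t * (2 * (sqn n x + sqn n y))"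
      by (simp only:)
    then show ?thesis by (simp only: distrib_left mult.left_commute[of t 2])
  qed
  ultimately show ?thesis
    using W[of "\<lambda>i. x i + y i"] W[of "\<lambda>i. x i + - y i"] by linarith
qed

context blocks
begin

text \<open>Here \<open>x\<close> stands for log n / n. For cluster indices k < l the two degree
  terms total at most (2b + \<psi>1 + \<psi>2 - 2\<epsilon>) x, while the density between the
  clusters exceeds (b - 2\<epsilon>) x, so the cross condition holds strictly. The \<epsilon> in
  \<open>deg\<close> pays for \<eta>.\<close>

lemma recovery_of_degree_bounds:
  fixes A :: "nat \<Rightarrow> nat \<Rightarrow> real" and b \<psi>1 \<psi>2 \<epsilon> x \<kappa> t \<eta> p :: real
  defines "e \<equiv> \<lambda>i k. \<Sum>j\<in>blk k. A i j" and "N \<equiv> \<lambda>k. real (card (blk k))"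
  assumes n: "0 < n" and pos: "0 < \<epsilon>" "0 < \<kappa>" "0 < x" "0 \<le> p" "0 \<le> b" "0 \<le> \<psi>1" "0 \<le> \<psi>2"
    and size: "\<And>k. k \<in> {1..r} \<Longrightarrow> \<kappa> * n \<le> N k"
    and symA: "\<And>i j. i < n \<Longrightarrow> j < n \<Longrightarrow> A i j = A j i"
    and spec: "\<And>y. \<bar>bilin n (\<lambda>i j. A i j - mean_matrix p (b * x) i j) y y\<bar> \<le> t * sqn n y"
    and t: "t < \<eta>" "\<eta> < \<epsilon> * x * (\<kappa> * n)" "t * n < 2 * \<epsilon> * x * (\<kappa> * n)\<^sup>2"
    and deg: "\<And>i. i < n \<Longrightarrow> cl i \<noteq> 0 \<Longrightarrow> (b + \<psi>1 + \<psi>2 + \<epsilon>) * x * N (cl i) \<le> e i (cl i)"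
    and out: "\<And>i k. i < n \<Longrightarrow> k \<in> {1..r} \<Longrightarrow> cl i \<noteq> k \<Longrightarrow> e i k \<le> (b + \<psi>1 + \<psi>2) * x * N k"
    and cross1: "\<And>i k. 2 \<le> r \<Longrightarrow> i < n \<Longrightarrow> k \<in> {1..r} \<Longrightarrow> cl i \<noteq> k \<Longrightarrow> e i k \<le> (b + \<psi>1 - \<epsilon>) * x * N k"
    and cross2: "\<And>i k. i < n \<Longrightarrow> k \<in> {1..<r} \<Longrightarrow> cl i \<noteq> k \<Longrightarrow> e i k \<le> (b + \<psi>2 - \<epsilon>) * x * N k"
  shows "unique_maximizer (sdp_base_feasible n) (sdp2_objective n \<eta> ((b + \<psi>1 + \<psi>2) * x) A) block_matrix"
proof -
  let ?W = "\<lambda>i j. A i j - mean_matrix p (b * x) i j"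
  have symW: "?W i j = ?W j i" if "i < n" "j < n" for i j
    using symA[OF that] by (auto simp: mean_matrix_def)
  have kn: "0 < \<kappa> * n" using pos n by simp
  have Npos: "0 < N k" if "k \<in> {1..r}" for k using size[OF that] kn by linarith
  have sub: "blk k \<subseteq> {..<n}" for k by (auto simp: blk_def)
  have t0: "0 \<le> t"
  proof -
    have "0 \<le> t * sqn n (\<lambda>_. 1)" using spec[of "\<lambda>_. 1"] by linarith
    then show ?thesis using n by (simp add: sqn_def zero_le_mult_iff)
  qed
  \<comment> \<open>The spectral bound on indicator vectors gives an error of at most t n, which the
    last inequality in \<open>t\<close> makes smaller than 2\<epsilon>x times the product of the
    cluster sizes.\<close>
  have between: "(b * x - 2 * \<epsilon> * x) * (N k * N l) < (\<Sum>i\<in>blk k. e i l)"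
    if k: "k \<in> {1..r}" and l: "l \<in> {1..r}" and kl: "k \<noteq> l" for k l
  proof -
    have "- (t * (sqn n (indicator (blk k)) + sqn n (indicator (blk l)))) / 2
        \<le> bilin n ?W (indicator (blk k)) (indicator (blk l))"
      by (rule bilin_polarization_ge[OF symW spec])
    also have "\<dots> = (\<Sum>i\<in>blk k. \<Sum>j\<in>blk l. A i j) - (\<Sum>i\<in>blk k. \<Sum>j\<in>blk l. mean_matrix p (b * x) i j)"
      unfolding bilin_indicator[OF sub sub] by (simp add: sum_subtractf)
    also have "(\<Sum>i\<in>blk k. \<Sum>j\<in>blk l. mean_matrix p (b * x) i j) = (\<Sum>i\<in>blk k. \<Sum>j\<in>blk l. b * x)"
      using kl by (intro sum.cong refl) (auto simp: mean_matrix_def blk_def)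
    also have "\<dots> = b * x * (N k * N l)" by (simp add: N_def)
    finally have 1: "- (t * (sqn n (indicator (blk k)) + sqn n (indicator (blk l)))) / 2
        \<le> (\<Sum>i\<in>blk k. e i l) - b * x * (N k * N l)" by (simp add: e_def)
    have "t * (sqn n (indicator (blk k)) + sqn n (indicator (blk l))) \<le> t * (n + n)"
      using sqn_indicator_le[of n "blk k"] sqn_indicator_le[of n "blk l"] by (intro mult_left_mono t0) auto
    then have 2: "- (t * n) \<le> - (t * (sqn n (indicator (blk k)) + sqn n (indicator (blk l)))) / 2"
      by (simp add: algebra_simps)
    have "(\<kappa> * n) * (\<kappa> * n) \<le> N k * N l"
      using size[OF k] size[OF l] kn by (intro mult_mono) auto
    then have "2 * \<epsilon> * x * (\<kappa> * n)\<^sup>2 \<le> 2 * \<epsilon> * x * (N k * N l)"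
      using pos by (intro mult_left_mono) (auto simp: power2_eq_square)
    with 1 2 t(3) have "b * x * (N k * N l) - 2 * \<epsilon> * x * (N k * N l) < (\<Sum>i\<in>blk k. e i l)" by linarith
    then show ?thesis by (simp only: left_diff_distrib)
  qed
  \<comment> \<open>The order k < l decides which degree gets the budget \<psi>2. Leaving
    \<open>s\<close> arbitrary lets the same edge count serve when i and j exchange roles.\<close>
  have key: "e i l / N l + e j k / N k < (b + \<psi>1 + \<psi>2) * x + s / (N k * N l)"
    if i: "i < n" "cl i = k" and j: "j < n" "cl j = l" and k: "k \<in> {1..r}" and l: "l \<in> {1..r}" and kl: "k < l"
      and s: "(b * x - 2 * \<epsilon> * x) * (N k * N l) < s" for i j k l s
  proof -
    have "e i l / N l \<le> (b + \<psi>1 - \<epsilon>) * x"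
      using cross1[of i l] i k l kl Npos[OF l] by (simp add: pos_divide_le_eq)
    moreover have "e j k / N k \<le> (b + \<psi>2 - \<epsilon>) * x"
      using cross2[of j k] j k l kl Npos[OF k] by (simp add: pos_divide_le_eq)
    moreover have "b * x - 2 * \<epsilon> * x < s / (N k * N l)"
      using s Npos[OF k] Npos[OF l] by (simp add: pos_less_divide_eq)
    ultimately show ?thesis by (simp add: algebra_simps)
  qed
  show ?thesis
  proof (rule deterministic_recovery[where p = p and q = "b * x" and t = t])
    show "blk k \<noteq> {}" if "k \<in> {1..r}" for k using Npos[OF that] by (auto simp: N_def)
    show "bilin n (\<lambda>i j. A i j - mean_matrix p (b * x) i j) y y \<le> t * sqn n y" for y
      using spec[of y] by linarith
    show "\<eta> + (b + \<psi>1 + \<psi>2) * x * real (card (blk (cl i))) < (\<Sum>j\<in>blk (cl i). A i j)"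
      if "i < n" "cl i \<noteq> 0" for i
    proof -
      have "cl i \<in> {1..r}" using cl_le that by auto
      then have "\<epsilon> * x * (\<kappa> * n) \<le> \<epsilon> * x * N (cl i)" using pos by (intro mult_left_mono size) auto
      then show ?thesis using deg[OF that] t(2) by (simp add: e_def N_def algebra_simps)
    qed
    show "b * x \<le> (b + \<psi>1 + \<psi>2) * x" using pos by (intro mult_right_mono) auto
    show "(\<Sum>j\<in>blk k. A i j) \<le> (b + \<psi>1 + \<psi>2) * x * real (card (blk k))"
      if "i < n" "cl i = 0" "k \<in> {1..r}" for i k
      using out[of i k] that by (simp add: e_def N_def)
    show "(\<Sum>j'\<in>blk (cl j). A i j') / real (card (blk (cl j))) + (\<Sum>j'\<in>blk (cl i). A j j') / real (card (blk (cl i)))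
        < (b + \<psi>1 + \<psi>2) * x + (\<Sum>l\<in>blk (cl i). \<Sum>j\<in>blk (cl j). A l j) / (real (card (blk (cl i))) * real (card (blk (cl j))))"
      if "i < n" "j < n" "cl i \<noteq> 0" "cl j \<noteq> 0" "cl i \<noteq> cl j" for i j
    proof -
      have k: "cl i \<in> {1..r}" and l: "cl j \<in> {1..r}" using cl_le that by auto
      have s: "(b * x - 2 * \<epsilon> * x) * (N (cl i) * N (cl j)) < (\<Sum>l\<in>blk (cl i). e l (cl j))"
        by (rule between) (use k l that in auto)
      have "e i (cl j) / N (cl j) + e j (cl i) / N (cl i) <
          (b + \<psi>1 + \<psi>2) * x + (\<Sum>l\<in>blk (cl i). e l (cl j)) / (N (cl i) * N (cl j))"
      proof (cases "cl i < cl j")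
        case True
        show ?thesis by (rule key) (use that k l s True in auto)
      next
        case False
        then have "cl j < cl i" using that by simp
        have "e j (cl i) / N (cl i) + e i (cl j) / N (cl j) <
            (b + \<psi>1 + \<psi>2) * x + (\<Sum>l\<in>blk (cl i). e l (cl j)) / (N (cl j) * N (cl i))"
          by (rule key) (use that k l s \<open>cl j < cl i\<close> in \<open>auto simp: mult.commute\<close>)
        then show ?thesis by (simp add: mult.commute add.commute)
      qed
      then show ?thesis by (simp add: e_def N_def)
    qed
  qed (use t pos in \<open>auto intro: symA\<close>)
qed

end

section \<open>Chernoff bounds for degrees\<close>

text \<open>A row sum is a sum over independent edges with coefficients \<open>c\<close> in {0, 1},
  and 1 + (exp \<theta> - 1) p <= exp((exp \<theta> - 1) p) replaces each Bernoulli variable by a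
  Poisson one. If i lies in T, its diagonal entry is 0, hence the cardinality of
  \<open>T - {i}\<close>.\<close>

lemma expectation_exp_row_sum:
  assumes i: "i < n" and T: "T \<subseteq> {..<n}" and P: "\<And>e. e \<in> pairs n \<Longrightarrow> 0 \<le> P e \<and> P e \<le> 1"
    and eq: "\<And>j. j \<in> T \<Longrightarrow> j \<noteq> i \<Longrightarrow> P (min i j, max i j) = \<pi>"
  shows "measure_pmf.expectation (edge_pmf n P) (\<lambda>\<omega>. exp (\<theta> * (\<Sum>j\<in>T. symmat (\<lambda>_. of_bool) \<omega> i j)))
    \<le> exp ((exp \<theta> - 1) * (\<pi> * card (T - {i})))"
proof -
  define c :: "nat \<times> nat \<Rightarrow> real" where
    "c e = indicator {i} (fst e) * indicator T (snd e) + indicator {i} (snd e) * indicator T (fst e)" for e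
  have row: "(\<Sum>j\<in>T. symmat f \<omega> i j) = (\<Sum>e\<in>pairs n. f e (\<omega> e) * c e)" for f \<omega>
    using bilin_indicator[of "{i}" n T "symmat f \<omega>"] i T by (simp add: bilin_symmat c_def)
  have c01: "c e = 0 \<or> c e = 1" if "e \<in> pairs n" for e
    using that by (auto simp: c_def pairs_def indicator_def)
  \<comment> \<open>The mean of the row sum comes from the identity \<open>row\<close> itself,
    applied to the deterministic matrix with entries P.\<close>
  have "(\<Sum>e\<in>pairs n. P e * c e) = (\<Sum>j\<in>T. symmat (\<lambda>e _. P e) (\<lambda>_. False) i j)"
    unfolding row ..
  also have "\<dots> = (\<Sum>j\<in>T - {i}. symmat (\<lambda>e _. P e) (\<lambda>_. False) i j)"
    using T finite_subset[OF T] by (intro sum.mono_neutral_right) (auto simp: symmat_def)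
  also have "\<dots> = (\<Sum>j\<in>T - {i}. \<pi>)"
  proof (intro sum.cong refl)
    fix j assume "j \<in> T - {i}"
    then show "symmat (\<lambda>e _. P e) (\<lambda>_. False) i j = \<pi>"
      using eq[of j] by (auto simp: symmat_def min_def max_def split: if_splits)
  qed
  finally have sumP: "(\<Sum>e\<in>pairs n. P e * c e) = \<pi> * card (T - {i})" by simp
  have "exp (\<theta> * (\<Sum>j\<in>T. symmat (\<lambda>_. of_bool) \<omega> i j)) = (\<Prod>e\<in>pairs n. exp (\<theta> * c e * of_bool (\<omega> e)))" for \<omega>
    by (simp only: row sum_distrib_left exp_sum[OF finite_pairs] mult_ac)
  then have "measure_pmf.expectation (edge_pmf n P) (\<lambda>\<omega>. exp (\<theta> * (\<Sum>j\<in>T. symmat (\<lambda>_. of_bool) \<omega> i j))) =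
      (\<Prod>e\<in>pairs n. measure_pmf.expectation (bernoulli_pmf (P e)) (\<lambda>v. exp (\<theta> * c e * of_bool v)))"
    by (simp only: expectation_prod_edge_pmf[where g = "\<lambda>e v. exp (\<theta> * c e * of_bool v)"])
  also have "\<dots> \<le> (\<Prod>e\<in>pairs n. exp ((exp \<theta> - 1) * (P e * c e)))"
  proof (intro prod_mono conjI)
    fix e assume e: "e \<in> pairs n"
    show "0 \<le> measure_pmf.expectation (bernoulli_pmf (P e)) (\<lambda>v. exp (\<theta> * c e * of_bool v))"
      by (intro Bochner_Integration.integral_nonneg) simp
    have "measure_pmf.expectation (bernoulli_pmf (P e)) (\<lambda>v. exp (\<theta> * c e * of_bool v)) =
        1 + (exp \<theta> - 1) * (P e * c e)"
      using c01[OF e] P[OF e] by (auto simp: algebra_simps)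
    also have "\<dots> \<le> exp ((exp \<theta> - 1) * (P e * c e))" by (rule exp_ge_add_one_self)
    finally show "measure_pmf.expectation (bernoulli_pmf (P e)) (\<lambda>v. exp (\<theta> * c e * of_bool v))
        \<le> exp ((exp \<theta> - 1) * (P e * c e))" .
  qed
  also have "\<dots> = exp ((exp \<theta> - 1) * (\<pi> * card (T - {i})))"
    by (simp add: exp_sum[symmetric] sum_distrib_left[symmetric] sumP)
  finally show ?thesis .
qed

text \<open>The sign of \<theta> is left open: a positive value gives the upper tail, a negative one
  the lower tail.\<close>

lemma chernoff_row_sum:
  assumes i: "i < n" and T: "T \<subseteq> {..<n}" and P: "\<And>e. e \<in> pairs n \<Longrightarrow> 0 \<le> P e \<and> P e \<le> 1"
    and eq: "\<And>j. j \<in> T \<Longrightarrow> j \<noteq> i \<Longrightarrow> P (min i j, max i j) = \<pi>"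
  shows "measure_pmf.prob (edge_pmf n P) {\<omega>. \<theta> * x \<le> \<theta> * (\<Sum>j\<in>T. symmat (\<lambda>_. of_bool) \<omega> i j)}
    \<le> exp ((exp \<theta> - 1) * (\<pi> * card (T - {i})) - \<theta> * x)"
proof -
  let ?X = "\<lambda>\<omega>. exp (\<theta> * (\<Sum>j\<in>T. symmat (\<lambda>_. of_bool) \<omega> i j))"
  have "measure_pmf.prob (edge_pmf n P) {\<omega> \<in> space (measure_pmf (edge_pmf n P)). exp (\<theta> * x) \<le> ?X \<omega>}
      \<le> measure_pmf.expectation (edge_pmf n P) ?X / exp (\<theta> * x)"
    by (rule integral_Markov_inequality_measure[where A = UNIV]) auto
  also have "\<dots> \<le> exp ((exp \<theta> - 1) * (\<pi> * card (T - {i}))) / exp (\<theta> * x)"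
    by (rule divide_right_mono, rule expectation_exp_row_sum[OF i T], rule P, assumption, rule eq) auto
  finally show ?thesis by (simp add: exp_diff)
qed

text \<open>In this form the rate is recognisable as the relative entropy of Poisson(d) with respect
  to Poisson(\<mu>).\<close>

lemma rate_I_alt:
  assumes "0 < \<mu>" "0 < d"
  shows "rate_I \<mu> d = \<mu> - d + d * ln (d / \<mu>)"
  using assms by (simp add: rate_I_def ln_div ln_mult algebra_simps)

text \<open>The tilt ln(\<beta> / b) minimises (exp \<theta> - 1) b - \<theta> \<beta>, and the
  minimum is minus the rate.\<close>

lemma row_sum_upper_tail:
  assumes i: "i < n" "i \<notin> T" and T: "T \<subseteq> {..<n}" and P: "\<And>e. e \<in> pairs n \<Longrightarrow> 0 \<le> P e \<and> P e \<le> 1"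
    and eq: "\<And>j. j \<in> T \<Longrightarrow> P (min i j, max i j) = b * s" and b: "0 < b" "b < \<beta>"
  shows "measure_pmf.prob (edge_pmf n P) {\<omega>. \<beta> * s * card T < (\<Sum>j\<in>T. symmat (\<lambda>_. of_bool) \<omega> i j)}
    \<le> exp (- (s * card T * rate_I b \<beta>))"
proof -
  let ?\<theta> = "ln (\<beta> / b)"
  have \<theta>: "0 \<le> ?\<theta>" "exp ?\<theta> = \<beta> / b" using b by auto
  have "measure_pmf.prob (edge_pmf n P) {\<omega>. \<beta> * s * card T < (\<Sum>j\<in>T. symmat (\<lambda>_. of_bool) \<omega> i j)}
      \<le> measure_pmf.prob (edge_pmf n P) {\<omega>. ?\<theta> * (\<beta> * s * card T) \<le> ?\<theta> * (\<Sum>j\<in>T. symmat (\<lambda>_. of_bool) \<omega> i j)}"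
    using \<theta> by (intro measure_pmf.finite_measure_mono) (auto intro!: mult_left_mono)
  also have "\<dots> \<le> exp ((exp ?\<theta> - 1) * (b * s * card (T - {i})) - ?\<theta> * (\<beta> * s * card T))"
    by (rule chernoff_row_sum[OF i(1) T], rule P, assumption, rule eq, assumption)
  also have "(exp ?\<theta> - 1) * (b * s * card (T - {i})) - ?\<theta> * (\<beta> * s * card T) = - (s * card T * rate_I b \<beta>)"
    using b i(2) by (simp add: \<theta>(2) rate_I_alt field_simps)
  finally show ?thesis .
qed

text \<open>The vertex belongs to its own cluster, so the mean involves one edge fewer than
  \<open>card T\<close>. This costs (a - \<beta>) s in the exponent, covered by the factor
  \<open>exp (a * s)\<close>.\<close>

lemma row_sum_lower_tail:
  assumes i: "i < n" "i \<in> T" and T: "T \<subseteq> {..<n}" and P: "\<And>e. e \<in> pairs n \<Longrightarrow> 0 \<le> P e \<and> P e \<le> 1"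
    and eq: "\<And>j. j \<in> T \<Longrightarrow> P (min i j, max i j) = a * s" and a: "0 < \<beta>" "\<beta> < a" and s: "0 \<le> s"
  shows "measure_pmf.prob (edge_pmf n P) {\<omega>. (\<Sum>j\<in>T. symmat (\<lambda>_. of_bool) \<omega> i j) < \<beta> * s * card T}
    \<le> exp (a * s) * exp (- (s * card T * rate_I a \<beta>))"
proof -
  let ?\<theta> = "ln (\<beta> / a)"
  have \<theta>: "?\<theta> \<le> 0" "exp ?\<theta> = \<beta> / a" using a by auto
  have "measure_pmf.prob (edge_pmf n P) {\<omega>. (\<Sum>j\<in>T. symmat (\<lambda>_. of_bool) \<omega> i j) < \<beta> * s * card T}
      \<le> measure_pmf.prob (edge_pmf n P) {\<omega>. ?\<theta> * (\<beta> * s * card T) \<le> ?\<theta> * (\<Sum>j\<in>T. symmat (\<lambda>_. of_bool) \<omega> i j)}"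
    using \<theta> by (intro measure_pmf.finite_measure_mono) (auto intro!: mult_left_mono_neg)
  also have "\<dots> \<le> exp ((exp ?\<theta> - 1) * (a * s * card (T - {i})) - ?\<theta> * (\<beta> * s * card T))"
    by (rule chernoff_row_sum[OF i(1) T], rule P, assumption, rule eq, assumption)
  also have "(exp ?\<theta> - 1) * (a * s * card (T - {i})) - ?\<theta> * (\<beta> * s * card T) \<le> a * s + - (s * card T * rate_I a \<beta>)"
  proof -
    have "card T \<noteq> 0" using i finite_subset[OF T] by auto
    then obtain m where m: "card T = Suc m" by (cases "card T") auto
    then have m': "card (T - {i}) = m" using i by simp
    have "(exp ?\<theta> - 1) * (a * s * card (T - {i})) - ?\<theta> * (\<beta> * s * card T) =
        (a - \<beta>) * s - s * card T * rate_I a \<beta>"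
      unfolding m m' using a by (simp add: \<theta>(2) rate_I_alt field_simps)
    moreover have "(a - \<beta>) * s \<le> a * s" using a s by (intro mult_right_mono) auto
    ultimately show ?thesis by linarith
  qed
  finally show ?thesis by (simp add: exp_add[symmetric])
qed

section \<open>From planted clusters to block labels\<close>

definition cluster_index :: "nat \<Rightarrow> (nat \<Rightarrow> nat set) \<Rightarrow> nat \<Rightarrow> nat" where
  "cluster_index r C i = (if \<exists>k\<in>{1..r}. i \<in> C k then SOME k. k \<in> {1..r} \<and> i \<in> C k else 0)"

lemma cluster_index_member:
  assumes "\<exists>k\<in>{1..r}. i \<in> C k"
  shows "cluster_index r C i \<in> {1..r} \<and> i \<in> C (cluster_index r C i)"
proof -
  from assms have "\<exists>k. k \<in> {1..r} \<and> i \<in> C k" by blast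
  from someI_ex[OF this] show ?thesis using assms by (simp only: cluster_index_def if_True)
qed

lemma cluster_index_nonzero:
  assumes "cluster_index r C i \<noteq> 0"
  shows "cluster_index r C i \<in> {1..r} \<and> i \<in> C (cluster_index r C i)"
  using assms by (intro cluster_index_member) (auto simp: cluster_index_def split: if_splits)

text \<open>Disjointness of the clusters makes the choice by \<open>SOME\<close>
  unambiguous.\<close>

lemma cluster_index_eq:
  assumes "valid_clusters n r K C" "k \<in> {1..r}" "i \<in> C k"
  shows "cluster_index r C i = k"
  using cluster_index_member[of r i C] assms unfolding valid_clusters_def by blast

lemma blocks_cluster_index: "blocks n r (cluster_index r C)"
proof
  show "cluster_index r C j \<le> r" for j
    using cluster_index_nonzero[of r C j] by (cases "cluster_index r C j = 0") auto
qed

lemma blk_cluster_index: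
  assumes "valid_clusters n r K C" "k \<in> {1..r}"
  shows "blocks.blk n (cluster_index r C) k = C k"
proof -
  have "C k \<subseteq> {..<n}" using assms by (auto simp: valid_clusters_def)
  moreover have "i \<in> C k" if "cluster_index r C i = k" for i
    using cluster_index_nonzero[of r C i] that assms(2) by auto
  ultimately show ?thesis
    unfolding blocks.blk_def[OF blocks_cluster_index]
    using cluster_index_eq[OF assms] by auto
qed

lemma same_cluster_iff:
  assumes "valid_clusters n r K C"
  shows "same_cluster r C i j \<longleftrightarrow> cluster_index r C i = cluster_index r C j \<and> cluster_index r C i \<noteq> 0"
proof
  assume "same_cluster r C i j"
  then obtain k where k: "k \<in> {1..r}" "i \<in> C k" "j \<in> C k" by (auto simp: same_cluster_def)
  then show "cluster_index r C i = cluster_index r C j \<and> cluster_index r C i \<noteq> 0"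
    using cluster_index_eq[OF assms k(1,2)] cluster_index_eq[OF assms k(1,3)] by auto
next
  assume *: "cluster_index r C i = cluster_index r C j \<and> cluster_index r C i \<noteq> 0"
  then show "same_cluster r C i j"
    using cluster_index_nonzero[of r C i] cluster_index_nonzero[of r C j]
    unfolding same_cluster_def by (intro bexI[of _ "cluster_index r C i"]) auto
qed

lemma cluster_matrix_eq_block_matrix:
  assumes valid: "valid_clusters n r K C"
  shows "cluster_matrix r C = blocks.block_matrix n (cluster_index r C)"
proof (intro ext)
  fix i j
  have bm: "blocks.block_matrix n (cluster_index r C) i j =
      (if i < n \<and> j < n \<and> same_cluster r C i j then 1 else 0)"
    unfolding blocks.block_matrix_def[OF blocks_cluster_index] same_cluster_iff[OF valid] by simp
  show "cluster_matrix r C i j = blocks.block_matrix n (cluster_index r C) i j"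
  proof (cases "same_cluster r C i j")
    case True
    then obtain k where k: "k \<in> {1..r}" "i \<in> C k" "j \<in> C k" by (auto simp: same_cluster_def)
    have ij: "i < n" "j < n" using valid k by (auto simp: valid_clusters_def)
    have "cluster_matrix r C i j = (\<Sum>l\<in>{1..r}. if l = k then 1 else 0)"
      unfolding cluster_matrix_def
    proof (intro sum.cong refl)
      fix l assume "l \<in> {1..r}"
      then have "i \<in> C l \<longleftrightarrow> l = k" "j \<in> C l \<longleftrightarrow> l = k"
        using cluster_index_eq[OF valid] k by metis+
      then show "indicator (C l) i * indicator (C l) j = (if l = k then 1 else 0 :: real)" by (simp add: indicator_def)
    qed
    also have "\<dots> = 1" using k by simp
    finally show ?thesis using True ij by (simp add: bm)
  next
    case False
    then have "cluster_matrix r C i j = 0"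
      unfolding cluster_matrix_def same_cluster_def by (intro sum.neutral) (auto simp: indicator_def)
    then show ?thesis using False by (simp add: bm)
  qed
qed

lemma sbm_adj_eq:
  "sbm_adj n r C p q = map_pmf (symmat (\<lambda>_. of_bool)) (edge_pmf n (\<lambda>(i, j). if same_cluster r C i j then p else q))"
proof -
  have "(\<lambda>e i j. if i < j then (if e (i, j) then 1 else 0) else if j < i then (if e (j, i) then 1 else 0) else 0) =
      symmat (\<lambda>_. of_bool)"
    by (auto simp: symmat_def fun_eq_iff)
  moreover have "(\<lambda>(i, j). bernoulli_pmf (if same_cluster r C i j then p else q)) =
      (\<lambda>e. bernoulli_pmf ((\<lambda>(i, j). if same_cluster r C i j then p else q) e))"
    by (auto simp: fun_eq_iff)
  ultimately show ?thesis unfolding sbm_adj_def edge_pmf_def pairs_def by simp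
qed

text \<open>A union bound for fixed n, in which \<open>u\<close> is the spectral failure probability
  and \<open>v\<close> bounds a single degree tail. For r >= 2 the threshold \<open>\<beta>\<close>
  serves clusters and outliers at once; for r = 1 only outliers lie outside the cluster, and the
  weaker requirement with \<psi>1 + \<psi>2 suffices.\<close>

lemma sbm_recovery:
  fixes a b \<psi>1 \<psi>2 \<epsilon> \<kappa> t \<eta> u v s \<beta> :: real and n r :: nat and K :: "nat \<Rightarrow> nat" and C :: "nat \<Rightarrow> nat set"
  defines "s \<equiv> ln n / n"
  defines "P \<equiv> \<lambda>(i, j). if same_cluster r C i j then a * s else b * s"
  defines "\<beta> \<equiv> if 2 \<le> r then b + \<psi>1 - \<epsilon> else b + \<psi>1 + \<psi>2"
  assumes valid: "valid_clusters n r K C" and n: "3 \<le> n"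
    and ab: "0 < b" "b < a" "a * s \<le> 1"
    and \<epsilon>: "0 < \<epsilon>" "\<epsilon> < \<psi>1" "\<epsilon> < \<psi>2" "b + \<psi>1 + \<psi>2 + \<epsilon> < a"
    and size: "0 < \<kappa>" "\<And>k. k \<in> {1..r} \<Longrightarrow> \<kappa> * n \<le> K k"
    and spec: "measure_pmf.prob (edge_pmf n P)
      {\<omega>. \<exists>x. \<bar>bilin n (symmat (\<lambda>e v. of_bool v - P e) \<omega>) x x\<bar> > t * sqn n x} \<le> u"
    and t: "t < \<eta>" "\<eta> < \<epsilon> * s * (\<kappa> * n)" "t * n < 2 * \<epsilon> * s * (\<kappa> * n)\<^sup>2"
    and tail1: "\<And>k. k \<in> {1..r} \<Longrightarrow> exp (- (s * K k * rate_I a (b + \<psi>1 + \<psi>2 + \<epsilon>))) \<le> v"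
    and tail2: "\<And>k. k \<in> {1..r} \<Longrightarrow> K k < n \<Longrightarrow> exp (- (s * K k * rate_I b \<beta>)) \<le> v"
    and tail3: "\<And>k. k \<in> {1..<r} \<Longrightarrow> exp (- (s * K k * rate_I b (b + \<psi>2 - \<epsilon>))) \<le> v"
  shows "1 - (u + n * r * (3 * v)) \<le> measure_pmf.prob (sbm_adj n r C (a * ln n / n) (b * ln n / n))
      {A. unique_maximizer (sdp_base_feasible n) (sdp2_objective n \<eta> ((b + \<psi>1 + \<psi>2) * ln n / n) A) (cluster_matrix r C)}"
proof -
  let ?cl = "cluster_index r C"
  interpret blocks n r ?cl by (rule blocks_cluster_index)
  let ?A = "symmat (\<lambda>_. of_bool)" and ?W = "symmat (\<lambda>e v. of_bool v - P e)"
  define e where "e \<omega> i k = (\<Sum>j\<in>C k. ?A \<omega> i j)" for \<omega> i k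
  have s: "0 < s" using n by (simp add: s_def)
  have P: "0 \<le> P e \<and> P e \<le> 1" for e
  proof -
    have "b * s \<le> a * s" using ab s by (intro mult_right_mono) auto
    then have "b * s \<le> 1" using ab(3) by linarith
    then show ?thesis using ab s by (auto simp: P_def split: prod.split)
  qed
  have sub: "C k \<subseteq> {..<n}" and cardC: "card (C k) = K k" if "k \<in> {1..r}" for k
    using valid that by (auto simp: valid_clusters_def)
  have blkC: "blk k = C k" if "k \<in> {1..r}" for k by (rule blk_cluster_index[OF valid that])
  have clD: "i \<in> C k \<longleftrightarrow> ?cl i = k" if "k \<in> {1..r}" for i k
  proof
    show "?cl i = k" if "i \<in> C k" by (rule cluster_index_eq[OF valid \<open>k \<in> {1..r}\<close> that])
    assume "?cl i = k"
    then show "i \<in> C k" using cluster_index_nonzero[of r C i] that by auto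
  qed
  have sameP: "P (min i j, max i j) = (if ?cl i = ?cl j \<and> ?cl i \<noteq> 0 then a * s else b * s)" for i j
    unfolding P_def case_prod_conv same_cluster_iff[OF valid] by (cases "i \<le> j") (auto simp: min_def max_def)
  have W: "(\<lambda>i j. ?A \<omega> i j - mean_matrix (a * s) (b * s) i j) = ?W \<omega>" for \<omega>
  proof (intro ext)
    fix i j
    show "?A \<omega> i j - mean_matrix (a * s) (b * s) i j = ?W \<omega> i j"
    proof (cases i j rule: linorder_cases)
      case less
      then show ?thesis using sameP[of i j] by (simp add: symmat_def mean_matrix_def)
    next
      case greater
      then show ?thesis using sameP[of i j] by (simp add: symmat_def mean_matrix_def)
    qed (simp add: symmat_def mean_matrix_def)
  qed
  define F where "F i k = {\<omega>. (i \<in> C k \<and> e \<omega> i k < (b + \<psi>1 + \<psi>2 + \<epsilon>) * s * K k) \<or>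
    (i \<notin> C k \<and> \<beta> * s * K k < e \<omega> i k) \<or> (i \<notin> C k \<and> k < r \<and> (b + \<psi>2 - \<epsilon>) * s * K k < e \<omega> i k)}" for i k
  define F0 where "F0 = {\<omega>. \<exists>x. \<bar>bilin n (?W \<omega>) x x\<bar> > t * sqn n x}"
  have \<beta>: "b < \<beta>" "\<beta> \<le> b + \<psi>1 + \<psi>2" using \<epsilon> by (auto simp: \<beta>_def)
  have v0: "0 \<le> v" if "k \<in> {1..r}" for k using tail1[OF that] by (rule order_trans[OF exp_ge_zero])
  have probF: "measure_pmf.prob (edge_pmf n P) (F i k) \<le> 3 * v" if i: "i < n" and k: "k \<in> {1..r}" for i k
  proof (cases "i \<in> C k")
    case True
    then have "F i k = {\<omega>. (\<Sum>j\<in>C k. ?A \<omega> i j) < (b + \<psi>1 + \<psi>2 + \<epsilon>) * s * card (C k)}"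
      by (auto simp: F_def e_def cardC[OF k])
    also have "measure_pmf.prob (edge_pmf n P) \<dots> \<le> exp (a * s) * exp (- (s * card (C k) * rate_I a (b + \<psi>1 + \<psi>2 + \<epsilon>)))"
    proof (rule row_sum_lower_tail[OF i True sub[OF k] P])
      show "P (min i j, max i j) = a * s" if "j \<in> C k" for j
        using that True k clD[OF k] by (simp add: sameP)
    qed (use ab \<epsilon> s in auto)
    \<comment> \<open>Since a s <= 1, the missing diagonal edge costs at most exp 1, below 3. In the
      other case two upper tails give 2v, so 3v covers both.\<close>
    also have "\<dots> \<le> 3 * v"
    proof (rule mult_mono)
      have "exp (a * s) \<le> exp 1" using ab by simp
      then show "exp (a * s) \<le> 3" using exp_le by linarith
    qed (use tail1[OF k] cardC[OF k] in auto)
    finally show ?thesis .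
  next
    case False
    \<comment> \<open>A vertex outside C_k exists, so K_k < n and \<open>tail2\<close> is
      available.\<close>
    have "C k \<subset> {..<n}" using False i sub[OF k] by auto
    then have "K k < n" using psubset_card_mono[of "{..<n}" "C k"] cardC[OF k] by simp
    note tail2' = tail2[OF k this]
    have eq: "P (min i j, max i j) = b * s" if "j \<in> C k" for j
      using that False k clD[OF k] by (auto simp: sameP)
    have 1: "measure_pmf.prob (edge_pmf n P) {\<omega>. \<beta> * s * card (C k) < (\<Sum>j\<in>C k. ?A \<omega> i j)}
        \<le> exp (- (s * card (C k) * rate_I b \<beta>))"
      by (rule row_sum_upper_tail[OF i False sub[OF k]], rule P, rule eq, assumption, rule ab(1), rule \<beta>(1))
    have 2: "measure_pmf.prob (edge_pmf n P) {\<omega>. (b + \<psi>2 - \<epsilon>) * s * card (C k) < (\<Sum>j\<in>C k. ?A \<omega> i j)}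
        \<le> exp (- (s * card (C k) * rate_I b (b + \<psi>2 - \<epsilon>)))"
      by (rule row_sum_upper_tail[OF i False sub[OF k]], rule P, rule eq, assumption, rule ab(1)) (use \<epsilon> in auto)
    let ?F2 = "{\<omega>. \<beta> * s * card (C k) < (\<Sum>j\<in>C k. ?A \<omega> i j)}"
    let ?F3 = "{\<omega>. k < r \<and> (b + \<psi>2 - \<epsilon>) * s * card (C k) < (\<Sum>j\<in>C k. ?A \<omega> i j)}"
    have 3: "measure_pmf.prob (edge_pmf n P) ?F3 \<le> v"
    proof (cases "k < r")
      case True
      then show ?thesis using 2 tail3[of k] k cardC[OF k] by simp
    next
      case False
      then show ?thesis using v0[OF k] by simp
    qed
    have "F i k = ?F2 \<union> ?F3" using False by (auto simp: F_def e_def cardC[OF k])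
    then have "measure_pmf.prob (edge_pmf n P) (F i k) \<le>
        measure_pmf.prob (edge_pmf n P) ?F2 + measure_pmf.prob (edge_pmf n P) ?F3"
      by (simp add: measure_Un_le)
    also have "\<dots> \<le> v + v" using 1 3 tail2' cardC[OF k] by (intro add_mono) auto
    finally show ?thesis using v0[OF k] by simp
  qed
  define bad where "bad = F0 \<union> (\<Union>(i, k)\<in>{..<n} \<times> {1..r}. F i k)"
  have "measure_pmf.prob (edge_pmf n P) bad \<le>
      measure_pmf.prob (edge_pmf n P) F0 + measure_pmf.prob (edge_pmf n P) (\<Union>(i, k)\<in>{..<n} \<times> {1..r}. F i k)"
    unfolding bad_def by (rule measure_Un_le) auto
  also have "\<dots> \<le> u + (\<Sum>(i, k)\<in>{..<n} \<times> {1..r}. measure_pmf.prob (edge_pmf n P) (F i k))"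
    using spec unfolding F0_def[symmetric] case_prod_unfold
    by (intro add_mono measure_UNION_le) auto
  also have "\<dots> \<le> u + (\<Sum>(i, k)\<in>{..<n} \<times> {1..r}. 3 * v)"
    using probF by (intro add_left_mono sum_mono) auto
  also have "\<dots> = u + n * r * (3 * v)" by (simp add: card_cartesian_product)
  finally have bad: "measure_pmf.prob (edge_pmf n P) bad \<le> u + n * r * (3 * v)" .
  have good: "unique_maximizer (sdp_base_feasible n) (sdp2_objective n \<eta> ((b + \<psi>1 + \<psi>2) * s) (?A \<omega>)) block_matrix"
    if \<omega>: "\<omega> \<notin> bad" for \<omega>
  proof -
    have nF: "\<omega> \<notin> F i k" if "i < n" "k \<in> {1..r}" for i k using \<omega> that by (auto simp: bad_def)
    have in_range: "?cl i \<in> {1..r}" if "?cl i \<noteq> 0" for i using cluster_index_nonzero[OF that] by simp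
    show ?thesis
    proof (rule recovery_of_degree_bounds[where \<epsilon> = \<epsilon> and \<kappa> = \<kappa> and t = t and p = "a * s"])
      show "\<bar>bilin n (\<lambda>i j. ?A \<omega> i j - mean_matrix (a * s) (b * s) i j) y y\<bar> \<le> t * sqn n y" for y
        using \<omega> unfolding W bad_def F0_def by (auto simp: not_less)
      show "\<kappa> * n \<le> card (blk k)" if "k \<in> {1..r}" for k
        using size(2)[OF that] by (simp add: blkC[OF that] cardC[OF that])
      show "(b + \<psi>1 + \<psi>2 + \<epsilon>) * s * card (blk (?cl i)) \<le> (\<Sum>j\<in>blk (?cl i). ?A \<omega> i j)"
        if i: "i < n" "?cl i \<noteq> 0" for i
        using nF[OF i(1) in_range[OF i(2)]] clD[OF in_range[OF i(2)], of i]
        by (simp add: F_def e_def blkC[OF in_range[OF i(2)]] cardC[OF in_range[OF i(2)]] not_less)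
      have up: "(\<Sum>j\<in>blk k. ?A \<omega> i j) \<le> \<beta> * s * card (blk k)"
        if "i < n" "k \<in> {1..r}" "?cl i \<noteq> k" for i k
        using nF[OF that(1,2)] clD[OF that(2), of i] that(3)
        by (simp add: F_def e_def blkC[OF that(2)] cardC[OF that(2)] not_less)
      show "(\<Sum>j\<in>blk k. ?A \<omega> i j) \<le> (b + \<psi>1 + \<psi>2) * s * card (blk k)"
        if "i < n" "k \<in> {1..r}" "?cl i \<noteq> k" for i k
      proof -
        have "\<beta> * s * card (blk k) \<le> (b + \<psi>1 + \<psi>2) * s * card (blk k)"
          using \<beta> s by (intro mult_right_mono) auto
        with up[OF that] show ?thesis by linarith
      qed
      show "(\<Sum>j\<in>blk k. ?A \<omega> i j) \<le> (b + \<psi>1 - \<epsilon>) * s * card (blk k)"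
        if "2 \<le> r" "i < n" "k \<in> {1..r}" "?cl i \<noteq> k" for i k
        using up[OF that(2-4)] that(1) by (simp add: \<beta>_def)
      show "(\<Sum>j\<in>blk k. ?A \<omega> i j) \<le> (b + \<psi>2 - \<epsilon>) * s * card (blk k)"
        if "i < n" "k \<in> {1..<r}" "?cl i \<noteq> k" for i k
      proof -
        have k: "k \<in> {1..r}" "k < r" using that by auto
        show ?thesis using nF[OF that(1) k(1)] clD[OF k(1), of i] that(3) k(2)
          by (simp add: F_def e_def blkC[OF k(1)] cardC[OF k(1)] not_less)
      qed
    qed (use n ab \<epsilon> s size t in \<open>auto intro: symmat_sym\<close>)
  qed
  have "1 - (u + n * r * (3 * v)) \<le> 1 - measure_pmf.prob (edge_pmf n P) bad" using bad by simp
  also have "\<dots> = measure_pmf.prob (edge_pmf n P) (- bad)"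
    using measure_pmf.prob_compl[of bad "edge_pmf n P"] by (simp add: Compl_eq_Diff_UNIV)
  also have "\<dots> \<le> measure_pmf.prob (edge_pmf n P) {\<omega>. unique_maximizer (sdp_base_feasible n)
      (sdp2_objective n \<eta> ((b + \<psi>1 + \<psi>2) * s) (?A \<omega>)) block_matrix}"
    using good by (intro measure_pmf.finite_measure_mono) auto
  also have "\<dots> = measure_pmf.prob (sbm_adj n r C (a * s) (b * s))
      {A. unique_maximizer (sdp_base_feasible n) (sdp2_objective n \<eta> ((b + \<psi>1 + \<psi>2) * s) A) block_matrix}"
    unfolding sbm_adj_eq P_def by (simp add: vimage_def)
  finally show ?thesis unfolding cluster_matrix_eq_block_matrix[OF valid] by (simp add: s_def)
qed

section \<open>Choice of constants\<close>

lemma unique_maximizer_sdp1_of_sdp2: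
  assumes valid: "valid_clusters n r K C"
    and uniq: "unique_maximizer (sdp_base_feasible n) (sdp2_objective n \<eta> lam A) (cluster_matrix r C)"
  shows "unique_maximizer (sdp1_feasible n r K) (\<lambda>Z. inner_n n A Z) (cluster_matrix r C)"
proof -
  let ?Z = "cluster_matrix r C"
  have ind: "(\<Sum>i<n. indicator (C k) i) = real (K k)" if "k \<in> {1..r}" for k
  proof -
    have "C k \<subseteq> {..<n}" "card (C k) = K k" using valid that by (auto simp: valid_clusters_def)
    then have "(\<Sum>i<n. indicator (C k) i) = (\<Sum>i\<in>C k. 1 :: real)"
      by (intro sum.mono_neutral_cong_right) (auto simp: indicator_def)
    then show ?thesis using \<open>card (C k) = K k\<close> by simp
  qed
  have "inner_n n (Id_n n) ?Z = (\<Sum>i<n. ?Z i i)"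
  proof -
    have "(\<Sum>j<n. Id_n n i j * ?Z i j) = ?Z i i" if "i < n" for i
      using that by (simp add: Id_n_def if_distrib[of "\<lambda>c. c * _"] cong: if_cong conj_cong)
    then show ?thesis by (simp add: inner_n_def)
  qed
  also have "\<dots> = (\<Sum>k\<in>{1..r}. \<Sum>i<n. indicator (C k) i * indicator (C k) i)"
    unfolding cluster_matrix_def by (rule sum.swap)
  also have "\<dots> = (\<Sum>k\<in>{1..r}. real (K k))"
    by (intro sum.cong refl) (simp only: indicator_inter_arith[symmetric] Int_absorb ind)
  finally have trace: "inner_n n (Id_n n) ?Z = real (\<Sum>k\<in>{1..r}. K k)" by simp
  have "inner_n n (J_n n) ?Z = (\<Sum>i<n. \<Sum>j<n. \<Sum>k\<in>{1..r}. indicator (C k) i * indicator (C k) j)"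
    by (simp add: inner_n_def J_n_def cluster_matrix_def)
  also have "\<dots> = (\<Sum>i<n. \<Sum>k\<in>{1..r}. \<Sum>j<n. indicator (C k) i * indicator (C k) j)"
    by (intro sum.cong refl sum.swap)
  also have "\<dots> = (\<Sum>k\<in>{1..r}. \<Sum>i<n. \<Sum>j<n. indicator (C k) i * indicator (C k) j)"
    by (rule sum.swap)
  also have "\<dots> = (\<Sum>k\<in>{1..r}. real (K k) * real (K k))"
    by (intro sum.cong refl) (simp only: sum_product[symmetric] ind)
  finally have total: "inner_n n (J_n n) ?Z = real (\<Sum>k\<in>{1..r}. (K k)\<^sup>2)" by (simp add: power2_eq_square)
  show ?thesis
    unfolding unique_maximizer_def
  proof (intro conjI allI impI)
    show "sdp1_feasible n r K ?Z"
      using uniq trace total by (simp add: sdp1_feasible_def unique_maximizer_def)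
    fix Z assume Z: "sdp1_feasible n r K Z \<and> Z \<noteq> ?Z"
    then have "sdp2_objective n \<eta> lam A Z < sdp2_objective n \<eta> lam A ?Z"
      using uniq by (simp add: sdp1_feasible_def unique_maximizer_def)
    then show "inner_n n A Z < inner_n n A ?Z"
      using Z trace total by (simp add: sdp2_objective_def sdp1_feasible_def)
  qed
qed

text \<open>Continuity in the threshold: the strict rate conditions survive moving it by a small
  \<epsilon>, up (\<sigma> = 1) or down (\<sigma> = -1).\<close>

lemma rate_I_perturb:
  assumes "0 < \<mu>" "0 < d" "c < rate_I \<mu> d"
  shows "eventually (\<lambda>\<epsilon>. c < rate_I \<mu> (d + \<sigma> * \<epsilon>)) (at_right 0)"
proof -
  have "isCont (rate_I \<mu>) d"
    unfolding rate_I_def using assms by (intro continuous_intros) auto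
  moreover have "((\<lambda>\<epsilon>. d + \<sigma> * \<epsilon>) \<longlongrightarrow> d + \<sigma> * 0) (at_right 0)"
    by (intro tendsto_intros)
  ultimately have "((\<lambda>\<epsilon>. rate_I \<mu> (d + \<sigma> * \<epsilon>)) \<longlongrightarrow> rate_I \<mu> d) (at_right 0)"
    by (intro isCont_tendsto_compose[of d "rate_I \<mu>"]) auto
  then show ?thesis using assms(3) by (rule order_tendstoD(1))
qed

text \<open>Half of the margin 2\<delta> absorbs the loss of one vertex from rounding the cluster
  size, which is why I <= \<delta>n is assumed. The exponent beyond -1 is what survives the union
  over n vertices.\<close>

lemma exp_rate_decay:
  fixes n :: nat and \<rho> I \<delta> K :: real
  assumes n: "1 \<le> n" and I: "0 \<le> I" "1 + 2 * \<delta> \<le> \<rho> * I" "I \<le> \<delta> * n" and K: "\<rho> * n - 1 \<le> K"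
  shows "exp (- (ln n / n * K * I)) \<le> real n powr (- 1 - \<delta>)"
proof -
  have "(1 + \<delta>) * n \<le> (1 + 2 * \<delta>) * n - \<delta> * n" by (simp add: algebra_simps)
  also have "\<dots> \<le> \<rho> * I * n - I" using I by (intro diff_mono mult_right_mono) auto
  also have "\<dots> = (\<rho> * n - 1) * I" by (simp add: algebra_simps)
  also have "\<dots> \<le> K * I" using I K by (intro mult_right_mono) auto
  finally have "ln n / n * ((1 + \<delta>) * n) \<le> ln n / n * (K * I)"
    using n by (intro mult_left_mono) auto
  moreover have "ln n / n * ((1 + \<delta>) * n) = (1 + \<delta>) * ln n" using n by simp
  ultimately have "(1 + \<delta>) * ln n \<le> ln n / n * K * I" by (simp only: mult.assoc)
  then show ?thesis using n by (simp add: powr_def algebra_simps)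
qed

lemma cluster_size_ge: "0 \<le> \<rho> k \<Longrightarrow> \<rho> k * n - 1 \<le> real (cluster_size \<rho> n k)"
  by (simp add: cluster_size_def)

lemma sdp2_recovery:
  fixes r :: nat and a b \<psi>1 \<psi>2 :: real and \<rho> :: "nat \<Rightarrow> real"
  assumes r_pos: "1 \<le> r"
    and ab: "0 < b" "b < a"
    and rho_mono: "\<forall>k\<in>{1..<r}. \<rho> (Suc k) \<le> \<rho> k"
    and rho_pos: "0 < \<rho> r"
    and psi: "0 < \<psi>1" "0 < \<psi>2" "b + \<psi>1 + \<psi>2 < a"
    and cond1: "rate_I a (b + \<psi>1 + \<psi>2) > 1 / \<rho> r"
    and cond2: "2 \<le> r \<longrightarrow> rate_I b (b + \<psi>1) > 1 / \<rho> r"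
    and cond3: "2 \<le> r \<longrightarrow> rate_I b (b + \<psi>2) > 1 / \<rho> (r - 1)"
    and cond4: "(r = 1 \<and> (\<Sum>k\<in>{1..r}. \<rho> k) < 1) \<longrightarrow> rate_I b (b + \<psi>1 + \<psi>2) > 1 / \<rho> r"
  shows "\<exists>C0. \<forall>Cc\<ge>C0. \<exists>c>0. \<exists>N. \<forall>n\<ge>N. \<forall>C. valid_clusters n r (cluster_size \<rho> n) C \<longrightarrow>
        measure_pmf.prob
          (sbm_adj n r C (a * ln n / n) (b * ln n / n))
          {A. unique_maximizer (sdp_base_feasible n)
                (sdp2_objective n (Cc * sqrt (ln n)) ((b + \<psi>1 + \<psi>2) * ln n / n) A)
                (cluster_matrix r C)}
        \<ge> 1 - real n powr (- c)"
proof -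
  let ?\<psi> = "b + \<psi>1 + \<psi>2"
  have a0: "0 < a" using ab by simp
  obtain Cs where Cs: "0 < Cs" and spectral: "\<And>n P. 3 \<le> n \<Longrightarrow> a * ln n / n \<le> 1 \<Longrightarrow>
    (\<And>e. e \<in> pairs n \<Longrightarrow> 0 \<le> P e \<and> P e \<le> a * ln n / n) \<Longrightarrow>
    measure_pmf.prob (edge_pmf n P)
      {\<omega>. \<exists>x. \<bar>bilin n (symmat (\<lambda>e v. of_bool v - P e) \<omega>) x x\<bar> > Cs * sqrt (ln n) * sqn n x} \<le> 2 * real n powr (-3)"
    by (rule spectral_bound[OF a0]) blast
  have rho_le: "\<rho> m \<le> \<rho> k" if "1 \<le> k" "k \<le> m" "m \<le> r" for k m
    using that(2,3)
  proof (induction m rule: dec_induct)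
    case (step m)
    then have "m \<in> {1..<r}" "\<rho> m \<le> \<rho> k" using that(1) by simp_all
    with rho_mono show ?case by (meson order_trans)
  qed simp
  have rho_pos': "0 < \<rho> k" if "k \<in> {1..r}" for k using rho_le[of k r] that rho_pos by auto
  obtain \<epsilon> where \<epsilon>: "0 < \<epsilon>" "\<epsilon> < \<psi>1" "\<epsilon> < \<psi>2" "?\<psi> + \<epsilon> < a"
    and r1: "1 / \<rho> r < rate_I a (?\<psi> + \<epsilon>)"
    and r2: "2 \<le> r \<Longrightarrow> 1 / \<rho> r < rate_I b (b + \<psi>1 - \<epsilon>)"
    and r3: "2 \<le> r \<Longrightarrow> 1 / \<rho> (r - 1) < rate_I b (b + \<psi>2 - \<epsilon>)"
  proof -
    have "eventually (\<lambda>\<epsilon>. 1 / \<rho> r < rate_I a (?\<psi> + 1 * \<epsilon>)) (at_right 0)"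
      using ab psi cond1 by (intro rate_I_perturb) auto
    moreover have "eventually (\<lambda>\<epsilon>. 2 \<le> r \<longrightarrow> 1 / \<rho> r < rate_I b (b + \<psi>1 + -1 * \<epsilon>)) (at_right 0)"
      using rate_I_perturb[of b "b + \<psi>1" "1 / \<rho> r" "-1"] ab psi cond2 by (cases "2 \<le> r") auto
    moreover have "eventually (\<lambda>\<epsilon>. 2 \<le> r \<longrightarrow> 1 / \<rho> (r - 1) < rate_I b (b + \<psi>2 + -1 * \<epsilon>)) (at_right 0)"
      using rate_I_perturb[of b "b + \<psi>2" "1 / \<rho> (r - 1)" "-1"] ab psi cond3 by (cases "2 \<le> r") auto
    moreover have "eventually (\<lambda>\<epsilon>. 0 < \<epsilon>) (at_right (0 :: real))" by (rule eventually_at_right_less)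
    moreover have "eventually (\<lambda>\<epsilon>. \<epsilon> < min \<psi>1 (min \<psi>2 (a - ?\<psi>))) (at_right 0)"
      using psi by (intro order_tendstoD(2)[OF tendsto_ident_at]) auto
    ultimately have "eventually (\<lambda>\<epsilon>. 1 / \<rho> r < rate_I a (?\<psi> + 1 * \<epsilon>) \<and>
        (2 \<le> r \<longrightarrow> 1 / \<rho> r < rate_I b (b + \<psi>1 + -1 * \<epsilon>)) \<and>
        (2 \<le> r \<longrightarrow> 1 / \<rho> (r - 1) < rate_I b (b + \<psi>2 + -1 * \<epsilon>)) \<and> 0 < \<epsilon> \<and>
        \<epsilon> < min \<psi>1 (min \<psi>2 (a - ?\<psi>))) (at_right 0)"
      by (intro eventually_conj)
    from eventually_happens'[OF trivial_limit_at_right_real this] show thesis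
      by (elim exE conjE) (rule that, auto)
  qed
  define \<beta> where "\<beta> = (if 2 \<le> r then b + \<psi>1 - \<epsilon> else ?\<psi>)"
  define I1 I2 I3 where "I1 = rate_I a (?\<psi> + \<epsilon>)" and "I2 = rate_I b \<beta>" and "I3 = rate_I b (b + \<psi>2 - \<epsilon>)"
  have v1: "1 < \<rho> r * I1" using r1 rho_pos by (simp add: I1_def field_simps)
  have v2: "1 < \<rho> r * I2" if "2 \<le> r \<or> \<rho> r < 1"
  proof (cases "2 \<le> r")
    case True
    then show ?thesis using r2 rho_pos by (simp add: I2_def \<beta>_def field_simps)
  next
    case False
    then have "r = 1" using r_pos by simp
    then show ?thesis using that cond4 rho_pos by (simp add: I2_def \<beta>_def field_simps)
  qed
  have v3: "1 < \<rho> (r - 1) * I3" if "2 \<le> r"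
    using r3[OF that] rho_pos'[of "r - 1"] that by (simp add: I3_def field_simps)
  \<comment> \<open>For a dropped condition any value above 1 would do; 2 keeps \<delta>
    positive.\<close>
  define w2 where "w2 = (if 2 \<le> r \<or> \<rho> r < 1 then \<rho> r * I2 else 2)"
  define w3 where "w3 = (if 2 \<le> r then \<rho> (r - 1) * I3 else 2)"
  define \<delta> where "\<delta> = min 1 (min ((\<rho> r * I1 - 1) / 2) (min ((w2 - 1) / 2) ((w3 - 1) / 2)))"
  have \<delta>: "0 < \<delta>" "\<delta> \<le> 1" using v1 v2 v3 by (auto simp: \<delta>_def w2_def w3_def)
  have "\<delta> \<le> (\<rho> r * I1 - 1) / 2" "\<delta> \<le> (w2 - 1) / 2" "\<delta> \<le> (w3 - 1) / 2"
    unfolding \<delta>_def by linarith+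
  then have d1: "1 + 2 * \<delta> \<le> \<rho> r * I1"
    and d2: "2 \<le> r \<or> \<rho> r < 1 \<Longrightarrow> 1 + 2 * \<delta> \<le> \<rho> r * I2"
    and d3: "2 \<le> r \<Longrightarrow> 1 + 2 * \<delta> \<le> \<rho> (r - 1) * I3"
    by (auto simp: w2_def w3_def)
  \<comment> \<open>Half of the smallest proportion leaves room for the floor: \<rho> n - 1 is at
    least \<rho> n / 2 once \<rho> n >= 2.\<close>
  define \<kappa> where "\<kappa> = \<rho> r / 2"
  have \<kappa>: "0 < \<kappa>" using rho_pos by (simp add: \<kappa>_def)
  show ?thesis
  \<comment> \<open>The penalty must strictly exceed the spectral bound with constant
    \<open>Cs\<close>.\<close>
  proof (rule exI[of _ "Cs + 1"], intro allI impI)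
    \<comment> \<open>assume \<open>D1\<close> and \<open>D2\<close> are the levels that sqrt(ln n)
      must pass for the two size conditions on \<eta> and t; the last summand of \<open>D\<close>
      lets n^(\<delta>/2) absorb the constant 2 + 3r. \<open>M\<close> ensures n >= 3, rates at most
      \<delta>n, and \<rho> n >= 2.\<close>
    fix Cc assume Cc: "Cs + 1 \<le> Cc"
    define D1 D2 where "D1 = Cc / (\<epsilon> * \<kappa>)" and "D2 = Cs / (2 * \<epsilon> * \<kappa>\<^sup>2)"
    define D where "D = D1\<^sup>2 + D2\<^sup>2 + (2 + 3 * real r) * 2 / \<delta>"
    define M where "M = 3 + (\<bar>I1\<bar> + \<bar>I2\<bar> + \<bar>I3\<bar>) / \<delta> + 2 / \<rho> r"
    have "eventually (\<lambda>n. D < ln (real n)) sequentially"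
      using filterlim_compose[OF ln_at_top filterlim_real_sequentially] by (simp add: filterlim_at_top_dense)
    moreover have "eventually (\<lambda>n. ln (real n) / real n < 1 / a) sequentially"
      using a0 by (intro order_tendstoD(2)[OF lim_ln_over_n]) auto
    moreover have "eventually (\<lambda>n. M \<le> real n) sequentially"
      using filterlim_real_sequentially by (simp add: filterlim_at_top)
    ultimately have "eventually (\<lambda>n. D < ln (real n) \<and> ln (real n) / real n < 1 / a \<and> M \<le> real n) sequentially"
      by (intro eventually_conj)
    then obtain N where N: "\<And>n. N \<le> n \<Longrightarrow> D < ln (real n) \<and> ln (real n) / real n < 1 / a \<and> M \<le> real n"
      by (auto simp: eventually_sequentially)
    show "\<exists>c>0. \<exists>N. \<forall>n\<ge>N. \<forall>C. valid_clusters n r (cluster_size \<rho> n) C \<longrightarrow>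
        measure_pmf.prob (sbm_adj n r C (a * ln n / n) (b * ln n / n))
          {A. unique_maximizer (sdp_base_feasible n)
                (sdp2_objective n (Cc * sqrt (ln n)) (?\<psi> * ln n / n) A) (cluster_matrix r C)}
        \<ge> 1 - real n powr (- c)"
    proof (intro exI[of _ "\<delta> / 2"] conjI exI[of _ N] allI impI)
      show "0 < \<delta> / 2" using \<delta> by simp
      fix n C assume "N \<le> n" and valid: "valid_clusters n r (cluster_size \<rho> n) C"
      from N[OF this(1)] have nD: "D < ln n" and na: "ln n / n < 1 / a" and nM: "M \<le> n" by auto
      have parts: "0 \<le> (\<bar>I1\<bar> + \<bar>I2\<bar> + \<bar>I3\<bar>) / \<delta>" "0 \<le> 2 / \<rho> r" using \<delta> rho_pos by auto
      then have n3: "3 \<le> n" using nM unfolding M_def by linarith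
      have nI: "\<bar>I1\<bar> + \<bar>I2\<bar> + \<bar>I3\<bar> \<le> \<delta> * n"
      proof -
        have "(\<bar>I1\<bar> + \<bar>I2\<bar> + \<bar>I3\<bar>) / \<delta> \<le> n" using nM parts unfolding M_def by linarith
        then show ?thesis using \<delta> by (simp add: field_simps)
      qed
      have n\<rho>: "2 \<le> \<rho> r * n"
      proof -
        have "2 / \<rho> r \<le> n" using nM parts unfolding M_def by linarith
        then show ?thesis using rho_pos by (simp add: field_simps)
      qed
      have p1: "a * (ln n / n) \<le> 1" using na a0 by (simp add: field_simps)
      have L: "0 < ln n" using n3 by simp
      have z3: "0 \<le> (2 + 3 * real r) * 2 / \<delta>" using \<delta> by simp
      have "D1\<^sup>2 < ln n" using nD z3 zero_le_power2[of D2] unfolding D_def by linarith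
      moreover have "D2\<^sup>2 < ln n" using nD z3 zero_le_power2[of D1] unfolding D_def by linarith
      ultimately have D: "D1 < sqrt (ln n)" "D2 < sqrt (ln n)" by (simp_all add: real_less_rsqrt)
      have D3: "(2 + 3 * real r) * 2 / \<delta> \<le> ln n"
        using nD zero_le_power2[of D1] zero_le_power2[of D2] unfolding D_def by linarith
      have t2: "Cc * sqrt (ln n) < \<epsilon> * (ln n / n) * (\<kappa> * n)"
      proof -
        have "Cc < \<epsilon> * \<kappa> * sqrt (ln n)" using D(1) \<epsilon> \<kappa> by (simp add: D1_def field_simps)
        then have "Cc * sqrt (ln n) < \<epsilon> * \<kappa> * sqrt (ln n) * sqrt (ln n)"
          using L by (intro mult_strict_right_mono) auto
        also have "\<dots> = \<epsilon> * \<kappa> * ln n" using L by (simp add: mult.assoc)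
        finally show ?thesis using n3 by (simp add: mult_ac)
      qed
      have t3: "Cs * sqrt (ln n) * n < 2 * \<epsilon> * (ln n / n) * (\<kappa> * n)\<^sup>2"
      proof -
        have "Cs < 2 * \<epsilon> * \<kappa>\<^sup>2 * sqrt (ln n)" using D(2) \<epsilon> \<kappa> by (simp add: D2_def field_simps)
        then have "Cs * sqrt (ln n) < 2 * \<epsilon> * \<kappa>\<^sup>2 * sqrt (ln n) * sqrt (ln n)"
          using L by (intro mult_strict_right_mono) auto
        also have "\<dots> = 2 * \<epsilon> * \<kappa>\<^sup>2 * ln n" using L by (simp add: mult.assoc)
        finally have "Cs * sqrt (ln n) * n < 2 * \<epsilon> * \<kappa>\<^sup>2 * ln n * n"
          using n3 by (intro mult_strict_right_mono) auto
        then show ?thesis using n3 by (simp add: power2_eq_square field_simps)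
      qed
      have size: "\<rho> k * n - 1 \<le> real (cluster_size \<rho> n k)" if "k \<in> {1..r}" for k
        using rho_pos'[OF that] by (intro cluster_size_ge) simp
      have decay: "exp (- (ln n / n * real (cluster_size \<rho> n k) * I)) \<le> real n powr (- 1 - \<delta>)"
        if k: "k \<in> {1..r}" and \<rho>': "\<rho>' \<le> \<rho> k" "0 < \<rho>'" and I: "1 + 2 * \<delta> \<le> \<rho>' * I" "I \<le> \<delta> * n" for k \<rho>' I
      proof -
        have "0 < \<rho>' * I" using I \<delta> by linarith
        then have "0 \<le> I" using \<rho>' by (simp add: zero_less_mult_iff)
        moreover have "\<rho>' * I \<le> \<rho> k * I" using \<rho>' calculation by (intro mult_right_mono) auto
        ultimately show ?thesis using n3 I size[OF k] by (intro exp_rate_decay[where \<rho> = "\<rho> k"]) auto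
      qed
      have "1 - (2 * real n powr (- 3) + n * r * (3 * real n powr (- 1 - \<delta>))) \<le>
          measure_pmf.prob (sbm_adj n r C (a * ln n / n) (b * ln n / n))
          {A. unique_maximizer (sdp_base_feasible n)
                (sdp2_objective n (Cc * sqrt (ln n)) (?\<psi> * ln n / n) A) (cluster_matrix r C)}"
      proof (rule sbm_recovery[OF valid n3 ab p1 \<epsilon> \<kappa>])
        show "\<kappa> * n \<le> real (cluster_size \<rho> n k)" if "k \<in> {1..r}" for k
        proof -
          have "\<rho> r * n \<le> \<rho> k * n" using rho_le[of k r] that by (intro mult_right_mono) auto
          then show ?thesis using size[OF that] n\<rho> by (simp add: \<kappa>_def)
        qed
        let ?P = "\<lambda>(i, j). if same_cluster r C i j then a * (ln n / n) else b * (ln n / n)"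
        show "measure_pmf.prob (edge_pmf n ?P)
          {\<omega>. \<exists>x. \<bar>bilin n (symmat (\<lambda>e v. of_bool v - ?P e) \<omega>) x x\<bar> > Cs * sqrt (ln n) * sqn n x} \<le> 2 * real n powr (-3)"
        proof (rule spectral[OF n3])
          show "a * ln n / n \<le> 1" using p1 by simp
          have "b * (ln n / n) \<le> a * (ln n / n)" using ab L n3 by (intro mult_right_mono) auto
          then show "0 \<le> ?P e \<and> ?P e \<le> a * ln n / n" for e
            using ab L n3 by (auto split: prod.split)
        qed
        show "Cs * sqrt (ln n) < Cc * sqrt (ln n)" using Cc L by simp
        show "exp (- (ln n / n * real (cluster_size \<rho> n k) * rate_I a (?\<psi> + \<epsilon>))) \<le> real n powr (- 1 - \<delta>)"
          if "k \<in> {1..r}" for k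
          unfolding I1_def[symmetric] using that rho_le[of k r] rho_pos d1 nI by (intro decay[where \<rho>' = "\<rho> r"]) auto
        show "exp (- (ln n / n * real (cluster_size \<rho> n k) * rate_I b (if 2 \<le> r then b + \<psi>1 - \<epsilon> else ?\<psi>))) \<le> real n powr (- 1 - \<delta>)"
          if k: "k \<in> {1..r}" and K: "cluster_size \<rho> n k < n" for k
        proof -
          \<comment> \<open>Otherwise r = 1 and the single cluster fills all n vertices,
            contradicting K_k < n; this is where the fourth condition becomes available exactly when
            outliers exist.\<close>
          have "2 \<le> r \<or> \<rho> r < 1"
          proof (rule ccontr)
            assume "\<not> (2 \<le> r \<or> \<rho> r < 1)"
            then have "k = r" "1 \<le> \<rho> r" using k by auto
            then have "1 * real n \<le> \<rho> k * n" by (intro mult_right_mono) auto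
            then have "int n \<le> \<lfloor>\<rho> k * n\<rfloor>" by (simp add: le_floor_iff)
            then show False using K by (simp add: cluster_size_def)
          qed
          from d2[OF this] show ?thesis
            unfolding I2_def[symmetric] \<beta>_def[symmetric]
            using k rho_le[of k r] rho_pos nI by (intro decay[where \<rho>' = "\<rho> r"]) auto
        qed
        show "exp (- (ln n / n * real (cluster_size \<rho> n k) * rate_I b (b + \<psi>2 - \<epsilon>))) \<le> real n powr (- 1 - \<delta>)"
          if k: "k \<in> {1..<r}" for k
          unfolding I3_def[symmetric] using k rho_le[of k "r - 1"] rho_pos'[of "r - 1"] d3 nI
          by (intro decay[where \<rho>' = "\<rho> (r - 1)"]) auto
      qed (use t2 t3 in auto)
      moreover have "2 * real n powr (- 3) + n * r * (3 * real n powr (- 1 - \<delta>)) \<le> real n powr (- (\<delta> / 2))"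
      proof -
        have "real n powr 1 * real n powr (- 1 - \<delta>) = real n powr (- \<delta>)"
          unfolding powr_add[symmetric] by simp
        then have 1: "n * r * (3 * real n powr (- 1 - \<delta>)) = 3 * r * real n powr (- \<delta>)" using n3 by simp
        have "real n powr (- 3) \<le> real n powr (- \<delta>)" using n3 \<delta> by (intro powr_mono) auto
        then have "2 * real n powr (- 3) + n * r * (3 * real n powr (- 1 - \<delta>)) \<le> (2 + 3 * real r) * real n powr (- \<delta>)"
          unfolding 1 by (simp add: algebra_simps)
        also have "\<dots> \<le> real n powr (\<delta> / 2) * real n powr (- \<delta>)"
        proof (rule mult_right_mono)
          have "2 + 3 * real r \<le> \<delta> / 2 * ln n" using D3 \<delta> by (simp add: field_simps)
          also have "\<dots> \<le> exp (\<delta> / 2 * ln n)" using exp_ge_add_one_self[of "\<delta> / 2 * ln n"] by linarith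
          also have "\<dots> = real n powr (\<delta> / 2)" using n3 by (simp add: powr_def)
          finally show "2 + 3 * real r \<le> real n powr (\<delta> / 2)" .
        qed simp
        also have "\<dots> = real n powr (- (\<delta> / 2))" by (simp flip: powr_add)
        finally show ?thesis by simp
      qed
      ultimately show "1 - real n powr (- (\<delta> / 2)) \<le> measure_pmf.prob (sbm_adj n r C (a * ln n / n) (b * ln n / n))
          {A. unique_maximizer (sdp_base_feasible n)
                (sdp2_objective n (Cc * sqrt (ln n)) (?\<psi> * ln n / n) A) (cluster_matrix r C)}"
        by linarith
    qed
  qed
qed

theorem theorem8:
  fixes r :: nat and a b \<psi>1 \<psi>2 :: real and \<rho> :: "nat \<Rightarrow> real"
  assumes r_pos: "1 \<le> r"
    and ab: "0 < b" "b < a"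
    and rho_mono: "\<forall>k\<in>{1..<r}. \<rho> (Suc k) \<le> \<rho> k"
    and rho_pos: "0 < \<rho> r"
    and rho_sum: "(\<Sum>k\<in>{1..r}. \<rho> k) \<le> 1"
    and psi: "0 < \<psi>1" "0 < \<psi>2" "b + \<psi>1 + \<psi>2 < a"
    and cond1: "rate_I a (b + \<psi>1 + \<psi>2) > 1 / \<rho> r"
    and cond2: "2 \<le> r \<longrightarrow> rate_I b (b + \<psi>1) > 1 / \<rho> r"
    and cond3: "2 \<le> r \<longrightarrow> rate_I b (b + \<psi>2) > 1 / \<rho> (r - 1)"
    and cond4: "(r = 1 \<and> (\<Sum>k\<in>{1..r}. \<rho> k) < 1) \<longrightarrow> rate_I b (b + \<psi>1 + \<psi>2) > 1 / \<rho> r"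
  shows
    \<comment> \<open>program (i)\<close>
    "(\<exists>c>0. \<exists>N. \<forall>n\<ge>N. \<forall>C. valid_clusters n r (cluster_size \<rho> n) C \<longrightarrow>
        measure_pmf.prob
          (sbm_adj n r C (a * ln n / n) (b * ln n / n))
          {A. unique_maximizer (sdp1_feasible n r (cluster_size \<rho> n))
                (\<lambda>Z. inner_n n A Z) (cluster_matrix r C)}
        \<ge> 1 - real n powr (- c))
     \<and>
     \<comment> \<open>program (ii), with eta* = Cc sqrt(log n) for all sufficiently large Cc\<close>
     (\<exists>C0. \<forall>Cc\<ge>C0. \<exists>c>0. \<exists>N. \<forall>n\<ge>N. \<forall>C. valid_clusters n r (cluster_size \<rho> n) C \<longrightarrow>
        measure_pmf.prob
          (sbm_adj n r C (a * ln n / n) (b * ln n / n))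
          {A. unique_maximizer (sdp_base_feasible n)
                (sdp2_objective n (Cc * sqrt (ln n)) ((b + \<psi>1 + \<psi>2) * ln n / n) A)
                (cluster_matrix r C)}
        \<ge> 1 - real n powr (- c))"
proof -
  let ?U1 = "\<lambda>n C. {A. unique_maximizer (sdp1_feasible n r (cluster_size \<rho> n)) (\<lambda>Z. inner_n n A Z) (cluster_matrix r C)}"
  let ?U2 = "\<lambda>Cc n C. {A. unique_maximizer (sdp_base_feasible n)
    (sdp2_objective n (Cc * sqrt (ln n)) ((b + \<psi>1 + \<psi>2) * ln n / n) A) (cluster_matrix r C)}"
  let ?prob = "\<lambda>n C. measure_pmf.prob (sbm_adj n r C (a * ln n / n) (b * ln n / n))"
  have ii: "\<exists>C0. \<forall>Cc\<ge>C0. \<exists>c>0. \<exists>N. \<forall>n\<ge>N. \<forall>C. valid_clusters n r (cluster_size \<rho> n) C \<longrightarrow>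
      ?prob n C (?U2 Cc n C) \<ge> 1 - real n powr (- c)"
    by (rule sdp2_recovery) fact+
  \<comment> \<open>Program (i) has no penalty constant, so one admissible \<open>Cc\<close>, the
    threshold itself, is enough.\<close>
  then obtain Cc c N where "c > 0" and N: "\<And>n C. N \<le> n \<Longrightarrow> valid_clusters n r (cluster_size \<rho> n) C \<Longrightarrow>
      ?prob n C (?U2 Cc n C) \<ge> 1 - real n powr (- c)"
    by (meson order_refl)
  have "?prob n C (?U1 n C) \<ge> 1 - real n powr (- c)"
    if "N \<le> n" and valid: "valid_clusters n r (cluster_size \<rho> n) C" for n C
  proof -
    have "?prob n C (?U2 Cc n C) \<le> ?prob n C (?U1 n C)"
      using unique_maximizer_sdp1_of_sdp2[OF valid] by (intro measure_pmf.finite_measure_mono) auto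
    with N[OF that] show ?thesis by linarith
  qed
  with \<open>c > 0\<close> ii show ?thesis by blast
qed

end
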